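(* Let $(\mathcal X^+,\mathcal X^-;p)$ be the generalized polar geometry of a Jordan triple system $(V,T)$ over $\mathbb K$, and let $\alpha:V\to V$ be a structural transformation, i.e. a $\mathbb K$-linear map with $T(\alpha x,y,\alpha z)=\alpha T(x,\alpha y,z)$ for all $x,y,z\in V$. Let $V_\alpha=(V,T_\alpha)$, $T_\alpha(x,y,z)=T(x,\alpha y,z)$, be the $\alpha$-homotope of $(V,T)$ and let $(\mathcal X^+_\alpha,\mathcal X^-_\alpha;p_\alpha)$ be the generalized polar geometry associated to $(V,T_\alpha)$, with symmetric space denoted by $M_\alpha\subset\mathcal X^+_\alpha$. Then there exists a canonical embedding $\Phi_\alpha:\mathcal X_\alpha^+\to\mathcal X^+$ having the following properties: (1) The affine image of $M_\alpha$ under this embedding coincides with the description of $M_\alpha$ in the chart $V_\alpha$, i.e. $$\Phi_\alpha(M_\alpha)\cap V=\{x\in V\mid B(x,-\alpha x)\in\mathrm{GL}(V)\}.$$ (2) The tangent map of $\Phi_\alpha$ at the origin can be algebraically defined, and it is the identity map $V_\alpha\to V$. (3) If $\alpha$ is invertible, then the image of $M_\alpha$ under this embedding is precisely the symmetric space $M^{(p\circ\alpha)}$ associated to the polarity $p\circ\alpha:\mathcal X^+\to\mathcal X^-$.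
   Context: $\mathbb K$ is a commutative ring in which $2$ and $3$ are invertible. A (linear) Jordan triple system (JTS) is a $\mathbb K$-module $V$ with a trilinear map $T$ such that $T(x,y,z)=T(z,y,x)$ and $T(u,v,T(x,y,z))=T(T(u,v,x),y,z)-T(x,T(v,u,y),z)+T(x,y,T(u,v,z))$. Write $T(x,y)=T(x,y,\cdot)$, $Q(x)=\tfrac12T(x,\cdot,x)$, $B(x,y)=\mathrm{id}_V-T(x,y)+Q(x)Q(y)$. If $\alpha$ is structural then $T_\alpha$ is again a JTS. The underlying Jordan pair of $(V,T)$ is $(V^+,V^-)=(V,V)$ with $T^\pm=T$. A homomorphism of Jordan pairs is a pair of linear maps $(h^+,h^-):(V^+,V^-)\to(W^+,W^-)$ with $h^\pm T^\pm(x,y,z)=T^\pm(h^\pm x,h^\mp y,h^\pm z)$. Geometry of a Jordan pair $(V^+,V^-)$. Let $\mathfrak g=\mathfrak g_1\oplus\mathfrak g_0\oplus\mathfrak g_{-1}$ be the 3-graded Lie algebra with $\mathfrak g_{\pm1}=V^\pm$ abelian, $\mathfrak g_0\subset\mathrm{End}(V^+)\times\mathrm{End}(V^-)$ spanned by $(\mathrm{id},-\mathrm{id})$ and all $D(x,y)=(T^+(x,y,\cdot),-T^-(y,x,\cdot))$, acting naturally, and $[x,y]=D(x,y)$ for $x\in V^+,y\in V^-$. For $x\in\mathfrak g_{\pm1}$, $\exp(x):=\exp(\mathrm{ad}\,x)\in\mathrm{Aut}(\mathfrak g)$. Let $U^\pm=\exp(\mathfrak g_{\pm1})$, $G=\langle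 U^+,U^-\rangle$, $H\subset G$ the subgroup preserving the 3-grading, $P^\pm=U^\pm H$, $\mathcal X^+=G/P^-$, $\mathcal X^-=G/P^+$, $o^+=eP^-$, $o^-=eP^+$. Elements $x\in\mathcal X^+$, $a\in\mathcal X^-$ are transversal, $x\top a$, if $(x,a)=(g.o^+,g.o^-)$ for some $g\in G$; $\mathfrak v_a=\{x\in\mathcal X^+\mid x\top a\}$, and dually $\mathfrak v_x\subset\mathcal X^-$. The affine parts at the base point are identified with $V^\pm$: $V^+\ni x\leftrightarrow\exp(x).o^+\in\mathfrak v_{o^-}$ and $V^-\ni a\leftrightarrow\exp(-a).o^-\in\mathfrak v_{o^+}$; all sets $\mathfrak v_{g.o^\mp}=g.\mathfrak v_{o^\mp}$ carry the transported affine structures over $\mathbb K$. $r_{x,a}(y)$ denotes $(1-r)x+ry$ in the affine space $\mathfrak v_a$; for invertible $r$ the map $r_{x,a}$ extends to a bijection of $\mathcal X^+$, the first component of an automorphism of the geometry. Homomorphisms of geometries are pairs of maps compatible with transversality and with the affine structures. The construction is functorial: a Jordan pair homomorphism $(h^+,h^-)$ induces a homomorphism of geometries preserving base points and restricting to $(h^+,h^-)$ on the affine parts $(V^+,V^-)$. Polar geometry of a JTS $(V,T)$: take the geometry of $(V,V)$ and the bijection $p:\mathcal X^+\to\mathcal X^-$ induced by the exchange involution of $(V,V)$, i.e. $p(gP^-)=(\theta g\theta^{-1})P^+$ with $\theta\in\mathrm{Aut}(\mathfrak g)$ given by $\mathfrak g_{\pm1}=V\ni x\mapsto-x\in V=\mathfrak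 g_{\mp1}$, $(A,B)\mapsto(B,A)$ on $\mathfrak g_0$; on affine parts $p$ is the identity $V^+=V\to V=V^-$. A polarity is a bijection $p:\mathcal X^+\to\mathcal X^-$ such that $(p,p^{-1})$ is an isomorphism onto the dual geometry $(\mathcal X^-,\mathcal X^+)$ and $x\top p(x)$ for some $x$. Its symmetric space is $M^{(p)}=\{x\in\mathcal X^+\mid x\top p(x)\}$ with product $\mu(x,y)=(-1)_{x,p(x)}(y)$; $M_\alpha:=M^{(p_\alpha)}\subset\mathcal X_\alpha^+$. "Canonical embedding": an injective map that is the first component of the homomorphism of geometries $(\mathcal X_\alpha^+,\mathcal X_\alpha^-)\to(\mathcal X^+,\mathcal X^-)$ induced by the Jordan pair homomorphism $(\mathrm{id},\alpha):(V_\alpha,V_\alpha)\to(V,V)$. Algebraic tangent map at the origin: if a map between such geometries sends base point to base point and the affine part $V_\alpha$ linearly into the affine part $V$, the tangent map at the origin is this linear map. In (3), for invertible $\alpha$ the pair $(\alpha,\alpha^{-1})$ is an automorphism of the Jordan pair $(V,V)$, and $\alpha:\mathcal X^+\to\mathcal X^+$ also denotes the first component of the induced automorphism of the geometry. *)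

theory Defs
  imports
    Complex_Main
    "HOL-Algebra.Bij"
    "HOL-Algebra.Generated_Groups"
    "HOL-Library.Function_Algebras"
    "HOL-Library.Product_Plus"
begin

section \<open>Jordan triple systems\<close>

locale jordan_triple_system = module sc
  for sc :: "'k::comm_ring_1 \<Rightarrow> 'v::ab_group_add \<Rightarrow> 'v" +
  fixes T :: "'v \<Rightarrow> 'v \<Rightarrow> 'v \<Rightarrow> 'v"
  assumes linear_1: "module_hom sc sc (\<lambda>x. T x y z)"
    and linear_2: "module_hom sc sc (\<lambda>y. T x y z)"
    and linear_3: "module_hom sc sc (\<lambda>z. T x y z)"
    and symmetric: "T x y z = T z y x"
    and jordan_identity:
      "T u v (T x y z) = T (T u v x) y z - T x (T v u y) z + T x y (T u v z)"

definition structural ::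
  "('k::comm_ring_1 \<Rightarrow> 'v::ab_group_add \<Rightarrow> 'v) \<Rightarrow> ('v \<Rightarrow> 'v \<Rightarrow> 'v \<Rightarrow> 'v) \<Rightarrow> ('v \<Rightarrow> 'v) \<Rightarrow> bool"
  where "structural sc T \<alpha> \<longleftrightarrow>
    module_hom sc sc \<alpha> \<and> (\<forall>x y z. T (\<alpha> x) y (\<alpha> z) = \<alpha> (T x (\<alpha> y) z))"

definition homotope :: "('v \<Rightarrow> 'v \<Rightarrow> 'v \<Rightarrow> 'v) \<Rightarrow> ('v \<Rightarrow> 'v) \<Rightarrow> ('v \<Rightarrow> 'v \<Rightarrow> 'v \<Rightarrow> 'v)"
  where "homotope T \<alpha> x y z = T x (\<alpha> y) z"

text \<open>Only meaningful for invertible arguments.\<close>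

definition ring_inv :: "'k::comm_ring_1 \<Rightarrow> 'k"
  where "ring_inv r = (THE s. r * s = 1)"

definition quad_op ::
  "('k::comm_ring_1 \<Rightarrow> 'v::ab_group_add \<Rightarrow> 'v) \<Rightarrow> ('v \<Rightarrow> 'v \<Rightarrow> 'v \<Rightarrow> 'v) \<Rightarrow> 'v \<Rightarrow> 'v \<Rightarrow> 'v"
  where "quad_op sc T x y = sc (ring_inv 2) (T x y x)"

definition bergman ::
  "('k::comm_ring_1 \<Rightarrow> 'v::ab_group_add \<Rightarrow> 'v) \<Rightarrow> ('v \<Rightarrow> 'v \<Rightarrow> 'v \<Rightarrow> 'v) \<Rightarrow> 'v \<Rightarrow> 'v \<Rightarrow> 'v \<Rightarrow> 'v"
  where "bergman sc T x y z = z - T x y z + quad_op sc T x (quad_op sc T y z)"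

definition GL :: "('k::comm_ring_1 \<Rightarrow> 'v::ab_group_add \<Rightarrow> 'v) \<Rightarrow> ('v \<Rightarrow> 'v) set"
  where "GL sc = {f. module_hom sc sc f \<and> bij f}"

section \<open>Jordan pairs\<close>

record ('k, 'p, 'm) jordan_pair =
  scp :: "'k \<Rightarrow> 'p \<Rightarrow> 'p"
  scm :: "'k \<Rightarrow> 'm \<Rightarrow> 'm"
  Tp :: "'p \<Rightarrow> 'm \<Rightarrow> 'p \<Rightarrow> 'p"
  Tm :: "'m \<Rightarrow> 'p \<Rightarrow> 'm \<Rightarrow> 'm"

definition jts_pair ::
  "('k \<Rightarrow> 'v \<Rightarrow> 'v) \<Rightarrow> ('v \<Rightarrow> 'v \<Rightarrow> 'v \<Rightarrow> 'v) \<Rightarrow> ('k, 'v, 'v) jordan_pair"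
  where "jts_pair sc T = \<lparr>scp = sc, scm = sc, Tp = T, Tm = T\<rparr>"

definition jordan_pair_hom ::
  "('k::comm_ring_1, 'p::ab_group_add, 'm::ab_group_add) jordan_pair \<Rightarrow>
   ('k, 'q::ab_group_add, 'n::ab_group_add) jordan_pair \<Rightarrow> ('p \<Rightarrow> 'q) \<Rightarrow> ('m \<Rightarrow> 'n) \<Rightarrow> bool"
  where "jordan_pair_hom J J' hp hm \<longleftrightarrow>
    module_hom (scp J) (scp J') hp \<and> module_hom (scm J) (scm J') hm \<and>
    (\<forall>x y z. hp (Tp J x y z) = Tp J' (hp x) (hm y) (hp z)) \<and>
    (\<forall>x y z. hm (Tm J x y z) = Tm J' (hm x) (hp y) (hm z))"

section \<open>The 3-graded Lie algebra of a Jordan pair\<close>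

text \<open>
  A triple \<open>(x, (A, B), y)\<close> is the sum of its components in degrees 1, 0 and -1.
\<close>

type_synonym ('p, 'm) tkk = "'p \<times> (('p \<Rightarrow> 'p) \<times> ('m \<Rightarrow> 'm)) \<times> 'm"

context
  fixes J :: "('k::comm_ring_1, 'p::ab_group_add, 'm::ab_group_add) jordan_pair"
begin

definition inner_der :: "'p \<Rightarrow> 'm \<Rightarrow> ('p \<Rightarrow> 'p) \<times> ('m \<Rightarrow> 'm)"
  where "inner_der x y = (Tp J x y, \<lambda>z. - Tm J y x z)"

definition scale0 :: "'k \<Rightarrow> ('p \<Rightarrow> 'p) \<times> ('m \<Rightarrow> 'm) \<Rightarrow> ('p \<Rightarrow> 'p) \<times> ('m \<Rightarrow> 'm)"
  where "scale0 r = (\<lambda>(A, B). (\<lambda>x. scp J r (A x), \<lambda>y. scm J r (B y)))"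

definition degree0 :: "(('p \<Rightarrow> 'p) \<times> ('m \<Rightarrow> 'm)) set"
  where "degree0 =
    module.span scale0 (insert (\<lambda>x. x, \<lambda>y. - y) {inner_der x y | x y. True})"

definition lie_alg :: "('p, 'm) tkk set"
  where "lie_alg = UNIV \<times> degree0 \<times> UNIV"

definition lie_scale :: "'k \<Rightarrow> ('p, 'm) tkk \<Rightarrow> ('p, 'm) tkk"
  where "lie_scale r = (\<lambda>(x, A, y). (scp J r x, scale0 r A, scm J r y))"

definition lie_bracket :: "('p, 'm) tkk \<Rightarrow> ('p, 'm) tkk \<Rightarrow> ('p, 'm) tkk"
  where "lie_bracket = (\<lambda>(x, (A, B), y) (x', (A', B'), y').
    (A x' - A' x,
     (A \<circ> A' - A' \<circ> A, B \<circ> B' - B' \<circ> B) + inner_der x y' - inner_der x' y,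
     B y' - B' y))"

definition grade :: "int \<Rightarrow> ('p, 'm) tkk set"
  where "grade i =
    (if i = 1 then {(x, 0, 0) | x. True}
     else if i = 0 then {(0, A, 0) | A. A \<in> degree0}
     else if i = -1 then {(0, 0, y) | y. True}
     else {0})"

text \<open>
  For \<open>z\<close> of degree \<open>\<plusminus>1\<close> one has \<open>(ad z)^3 = 0\<close>, so the exponential series of \<open>ad z\<close>
  ends with the quadratic term.
\<close>

definition exp_ad :: "('p, 'm) tkk \<Rightarrow> ('p, 'm) tkk \<Rightarrow> ('p, 'm) tkk"
  where "exp_ad z = (\<lambda>w\<in>lie_alg.
    w + lie_bracket z w + lie_scale (ring_inv 2) (lie_bracket z (lie_bracket z w)))"

definition exp_plus :: "'p \<Rightarrow> ('p, 'm) tkk \<Rightarrow> ('p, 'm) tkk"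
  where "exp_plus x = exp_ad (x, 0, 0)"

definition exp_minus :: "'m \<Rightarrow> ('p, 'm) tkk \<Rightarrow> ('p, 'm) tkk"
  where "exp_minus y = exp_ad (0, 0, y)"

section \<open>The geometry of a Jordan pair\<close>

text \<open>
  All groups are subsets of the group of bijections of the Lie algebra; points of the
  homogeneous spaces are left cosets, on which a group element acts by \<open>l_coset\<close>.
\<close>

definition ambient :: "(('p, 'm) tkk \<Rightarrow> ('p, 'm) tkk) monoid"
  where "ambient = BijGroup lie_alg"

definition el_group :: "(('p, 'm) tkk \<Rightarrow> ('p, 'm) tkk) set"
  where "el_group = generate ambient (range exp_plus \<union> range exp_minus)"

definition H_group :: "(('p, 'm) tkk \<Rightarrow> ('p, 'm) tkk) set"
  where "H_group = {g \<in> el_group. \<forall>i\<in>{1, 0, -1}. g ` grade i = grade i}"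

definition P_plus :: "(('p, 'm) tkk \<Rightarrow> ('p, 'm) tkk) set"
  where "P_plus = range exp_plus <#>\<^bsub>ambient\<^esub> H_group"

definition P_minus :: "(('p, 'm) tkk \<Rightarrow> ('p, 'm) tkk) set"
  where "P_minus = range exp_minus <#>\<^bsub>ambient\<^esub> H_group"

definition X_plus :: "(('p, 'm) tkk \<Rightarrow> ('p, 'm) tkk) set set"
  where "X_plus = {g <#\<^bsub>ambient\<^esub> P_minus | g. g \<in> el_group}"

definition X_minus :: "(('p, 'm) tkk \<Rightarrow> ('p, 'm) tkk) set set"
  where "X_minus = {g <#\<^bsub>ambient\<^esub> P_plus | g. g \<in> el_group}"

definition o_plus :: "(('p, 'm) tkk \<Rightarrow> ('p, 'm) tkk) set"
  where "o_plus = \<one>\<^bsub>ambient\<^esub> <#\<^bsub>ambient\<^esub> P_minus"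

definition o_minus :: "(('p, 'm) tkk \<Rightarrow> ('p, 'm) tkk) set"
  where "o_minus = \<one>\<^bsub>ambient\<^esub> <#\<^bsub>ambient\<^esub> P_plus"

definition transversal ::
  "(('p, 'm) tkk \<Rightarrow> ('p, 'm) tkk) set \<Rightarrow> (('p, 'm) tkk \<Rightarrow> ('p, 'm) tkk) set \<Rightarrow> bool"
  where "transversal x a \<longleftrightarrow>
    (\<exists>g\<in>el_group. x = g <#\<^bsub>ambient\<^esub> o_plus \<and> a = g <#\<^bsub>ambient\<^esub> o_minus)"

definition affine_plus :: "'p \<Rightarrow> (('p, 'm) tkk \<Rightarrow> ('p, 'm) tkk) set"
  where "affine_plus x = exp_plus x <#\<^bsub>ambient\<^esub> o_plus"

definition affine_minus :: "'m \<Rightarrow> (('p, 'm) tkk \<Rightarrow> ('p, 'm) tkk) set"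
  where "affine_minus a = exp_minus (- a) <#\<^bsub>ambient\<^esub> o_minus"

text \<open>
  The affine combination \<open>(1 - r - s) x + r y + s z\<close> in the affine space of all points
  transversal to \<open>a\<close>, whose structure is transported from the base point by any \<open>g\<close> with
  \<open>a = g.o_minus\<close>.
\<close>

definition comb_in_plus ::
  "(('p, 'm) tkk \<Rightarrow> ('p, 'm) tkk) set \<Rightarrow> 'k \<Rightarrow> 'k \<Rightarrow>
   (('p, 'm) tkk \<Rightarrow> ('p, 'm) tkk) set \<Rightarrow> (('p, 'm) tkk \<Rightarrow> ('p, 'm) tkk) set \<Rightarrow>
   (('p, 'm) tkk \<Rightarrow> ('p, 'm) tkk) set \<Rightarrow> (('p, 'm) tkk \<Rightarrow> ('p, 'm) tkk) set"
  where "comb_in_plus a r s x y z = (THE q. \<exists>g\<in>el_group. \<exists>u v w.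
    a = g <#\<^bsub>ambient\<^esub> o_minus \<and>
    x = g <#\<^bsub>ambient\<^esub> affine_plus u \<and>
    y = g <#\<^bsub>ambient\<^esub> affine_plus v \<and>
    z = g <#\<^bsub>ambient\<^esub> affine_plus w \<and>
    q = g <#\<^bsub>ambient\<^esub> affine_plus (scp J (1 - r - s) u + scp J r v + scp J s w))"

definition comb_in_minus ::
  "(('p, 'm) tkk \<Rightarrow> ('p, 'm) tkk) set \<Rightarrow> 'k \<Rightarrow> 'k \<Rightarrow>
   (('p, 'm) tkk \<Rightarrow> ('p, 'm) tkk) set \<Rightarrow> (('p, 'm) tkk \<Rightarrow> ('p, 'm) tkk) set \<Rightarrow>
   (('p, 'm) tkk \<Rightarrow> ('p, 'm) tkk) set \<Rightarrow> (('p, 'm) tkk \<Rightarrow> ('p, 'm) tkk) set"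
  where "comb_in_minus x r s a b c = (THE q. \<exists>g\<in>el_group. \<exists>u v w.
    x = g <#\<^bsub>ambient\<^esub> o_plus \<and>
    a = g <#\<^bsub>ambient\<^esub> affine_minus u \<and>
    b = g <#\<^bsub>ambient\<^esub> affine_minus v \<and>
    c = g <#\<^bsub>ambient\<^esub> affine_minus w \<and>
    q = g <#\<^bsub>ambient\<^esub> affine_minus (scm J (1 - r - s) u + scm J r v + scm J s w))"

text \<open>
  For invertible \<open>r\<close>, the bijection \<open>r_{x,a}\<close> of all of \<open>X_plus\<close>. The automorphism
  \<open>\<rho>\<close> acting by \<open>r^i\<close> in degree \<open>i\<close> normalizes the group and \<open>P_minus\<close>, hence acts on
  cosets by \<open>hP \<mapsto> (\<rho>h\<rho>\<^sup>-\<^sup>1)P\<close>; in the affine chart this is multiplication by \<open>r\<close>, i.e. the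
  dilation at \<open>(o_plus, o_minus)\<close>. It is transported to \<open>(x, a) = g.(o_plus, o_minus)\<close>
  by conjugation with \<open>g\<close>.
\<close>

definition grading_aut :: "'k \<Rightarrow> ('p, 'm) tkk \<Rightarrow> ('p, 'm) tkk"
  where "grading_aut r =
    (\<lambda>w\<in>lie_alg. case w of (x, A, y) \<Rightarrow> (scp J r x, A, scm J (ring_inv r) y))"

definition dilation ::
  "'k \<Rightarrow> (('p, 'm) tkk \<Rightarrow> ('p, 'm) tkk) set \<Rightarrow> (('p, 'm) tkk \<Rightarrow> ('p, 'm) tkk) set \<Rightarrow>
   (('p, 'm) tkk \<Rightarrow> ('p, 'm) tkk) set \<Rightarrow> (('p, 'm) tkk \<Rightarrow> ('p, 'm) tkk) set"
  where "dilation r x a y = (THE q. \<exists>g\<in>el_group.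
    x = g <#\<^bsub>ambient\<^esub> o_plus \<and> a = g <#\<^bsub>ambient\<^esub> o_minus \<and>
    q = (\<lambda>h. g \<otimes>\<^bsub>ambient\<^esub> (grading_aut r \<otimes>\<^bsub>ambient\<^esub> (inv\<^bsub>ambient\<^esub> g \<otimes>\<^bsub>ambient\<^esub> h)
              \<otimes>\<^bsub>ambient\<^esub> inv\<^bsub>ambient\<^esub> (grading_aut r))) ` y)"

end

section \<open>Homomorphisms and polarities\<close>

record ('k, 'x, 'a) geom =
  pts_plus :: "'x set"
  pts_minus :: "'a set"
  transv :: "'x \<Rightarrow> 'a \<Rightarrow> bool"
  comb_plus :: "'a \<Rightarrow> 'k \<Rightarrow> 'k \<Rightarrow> 'x \<Rightarrow> 'x \<Rightarrow> 'x \<Rightarrow> 'x"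
  comb_minus :: "'x \<Rightarrow> 'k \<Rightarrow> 'k \<Rightarrow> 'a \<Rightarrow> 'a \<Rightarrow> 'a \<Rightarrow> 'a"

definition geometry ::
  "('k::comm_ring_1, 'p::ab_group_add, 'm::ab_group_add) jordan_pair \<Rightarrow>
   ('k, (('p, 'm) tkk \<Rightarrow> ('p, 'm) tkk) set, (('p, 'm) tkk \<Rightarrow> ('p, 'm) tkk) set) geom"
  where "geometry J = \<lparr>pts_plus = X_plus J, pts_minus = X_minus J, transv = transversal J,
    comb_plus = comb_in_plus J, comb_minus = comb_in_minus J\<rparr>"

definition dual_geom :: "('k, 'x, 'a) geom \<Rightarrow> ('k, 'a, 'x) geom"
  where "dual_geom \<X> = \<lparr>pts_plus = pts_minus \<X>, pts_minus = pts_plus \<X>,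
    transv = (\<lambda>a x. transv \<X> x a), comb_plus = comb_minus \<X>, comb_minus = comb_plus \<X>\<rparr>"

definition geom_hom ::
  "('k, 'x, 'a) geom \<Rightarrow> ('k, 'y, 'b) geom \<Rightarrow> ('x \<Rightarrow> 'y) \<Rightarrow> ('a \<Rightarrow> 'b) \<Rightarrow> bool"
  where "geom_hom \<X> \<Y> f f' \<longleftrightarrow>
    f ` pts_plus \<X> \<subseteq> pts_plus \<Y> \<and> f' ` pts_minus \<X> \<subseteq> pts_minus \<Y> \<and>
    (\<forall>x\<in>pts_plus \<X>. \<forall>a\<in>pts_minus \<X>. transv \<X> x a \<longrightarrow> transv \<Y> (f x) (f' a)) \<and>
    (\<forall>a\<in>pts_minus \<X>. \<forall>x\<in>pts_plus \<X>. \<forall>y\<in>pts_plus \<X>. \<forall>z\<in>pts_plus \<X>. \<forall>r s.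
      transv \<X> x a \<longrightarrow> transv \<X> y a \<longrightarrow> transv \<X> z a \<longrightarrow>
      f (comb_plus \<X> a r s x y z) = comb_plus \<Y> (f' a) r s (f x) (f y) (f z)) \<and>
    (\<forall>x\<in>pts_plus \<X>. \<forall>a\<in>pts_minus \<X>. \<forall>b\<in>pts_minus \<X>. \<forall>c\<in>pts_minus \<X>. \<forall>r s.
      transv \<X> x a \<longrightarrow> transv \<X> x b \<longrightarrow> transv \<X> x c \<longrightarrow>
      f' (comb_minus \<X> x r s a b c) = comb_minus \<Y> (f x) r s (f' a) (f' b) (f' c))"

definition geom_iso ::
  "('k, 'x, 'a) geom \<Rightarrow> ('k, 'y, 'b) geom \<Rightarrow> ('x \<Rightarrow> 'y) \<Rightarrow> ('a \<Rightarrow> 'b) \<Rightarrow> bool"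
  where "geom_iso \<X> \<Y> f f' \<longleftrightarrow>
    bij_betw f (pts_plus \<X>) (pts_plus \<Y>) \<and> bij_betw f' (pts_minus \<X>) (pts_minus \<Y>) \<and>
    geom_hom \<X> \<Y> f f' \<and>
    geom_hom \<Y> \<X> (inv_into (pts_plus \<X>) f) (inv_into (pts_minus \<X>) f')"

definition polarity :: "('k, 'x, 'a) geom \<Rightarrow> ('x \<Rightarrow> 'a) \<Rightarrow> bool"
  where "polarity \<X> p \<longleftrightarrow>
    bij_betw p (pts_plus \<X>) (pts_minus \<X>) \<and>
    geom_iso \<X> (dual_geom \<X>) p (inv_into (pts_plus \<X>) p) \<and>
    (\<exists>x\<in>pts_plus \<X>. transv \<X> x (p x))"

text \<open>
  \<open>(f, f')\<close> is the homomorphism of geometries induced by the Jordan pair homomorphism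
  \<open>(hp, hm)\<close>. The last four clauses say that it intertwines the actions of \<open>exp v\<close> and
  \<open>exp (h v)\<close>, i.e. sends \<open>exp v\<^sub>1 \<dots> exp v\<^sub>n.o\<close> to \<open>exp (h v\<^sub>1) \<dots> exp (h v\<^sub>n).o\<close>; as the
  exponentials generate the group, this singles out one map on each set of points.
\<close>

definition induced_hom ::
  "('k::comm_ring_1, 'p::ab_group_add, 'm::ab_group_add) jordan_pair \<Rightarrow>
   ('k, 'q::ab_group_add, 'n::ab_group_add) jordan_pair \<Rightarrow> ('p \<Rightarrow> 'q) \<Rightarrow> ('m \<Rightarrow> 'n) \<Rightarrow>
   ((('p, 'm) tkk \<Rightarrow> ('p, 'm) tkk) set \<Rightarrow> (('q, 'n) tkk \<Rightarrow> ('q, 'n) tkk) set) \<Rightarrow>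
   ((('p, 'm) tkk \<Rightarrow> ('p, 'm) tkk) set \<Rightarrow> (('q, 'n) tkk \<Rightarrow> ('q, 'n) tkk) set) \<Rightarrow> bool"
  where "induced_hom J J' hp hm f f' \<longleftrightarrow>
    jordan_pair_hom J J' hp hm \<and>
    geom_hom (geometry J) (geometry J') f f' \<and>
    f (o_plus J) = o_plus J' \<and> f' (o_minus J) = o_minus J' \<and>
    (\<forall>x. f (affine_plus J x) = affine_plus J' (hp x)) \<and>
    (\<forall>a. f' (affine_minus J a) = affine_minus J' (hm a)) \<and>
    (\<forall>\<xi>\<in>X_plus J. \<forall>v.
      f (exp_plus J v <#\<^bsub>ambient J\<^esub> \<xi>) = exp_plus J' (hp v) <#\<^bsub>ambient J'\<^esub> f \<xi>) \<and>
    (\<forall>\<xi>\<in>X_plus J. \<forall>v.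
      f (exp_minus J v <#\<^bsub>ambient J\<^esub> \<xi>) = exp_minus J' (hm v) <#\<^bsub>ambient J'\<^esub> f \<xi>) \<and>
    (\<forall>\<xi>\<in>X_minus J. \<forall>v.
      f' (exp_plus J v <#\<^bsub>ambient J\<^esub> \<xi>) = exp_plus J' (hp v) <#\<^bsub>ambient J'\<^esub> f' \<xi>) \<and>
    (\<forall>\<xi>\<in>X_minus J. \<forall>v.
      f' (exp_minus J v <#\<^bsub>ambient J\<^esub> \<xi>) = exp_minus J' (hm v) <#\<^bsub>ambient J'\<^esub> f' \<xi>)"

definition has_tangent_map_at_origin ::
  "('k::comm_ring_1, 'p::ab_group_add, 'm::ab_group_add) jordan_pair \<Rightarrow>
   ('k, 'q::ab_group_add, 'n::ab_group_add) jordan_pair \<Rightarrow>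
   ((('p, 'm) tkk \<Rightarrow> ('p, 'm) tkk) set \<Rightarrow> (('q, 'n) tkk \<Rightarrow> ('q, 'n) tkk) set) \<Rightarrow>
   ('p \<Rightarrow> 'q) \<Rightarrow> bool"
  where "has_tangent_map_at_origin J J' f L \<longleftrightarrow>
    f (o_plus J) = o_plus J' \<and> module_hom (scp J) (scp J') L \<and>
    (\<forall>x. f (affine_plus J x) = affine_plus J' (L x))"

section \<open>Polar geometry of a Jordan triple system and symmetric spaces\<close>

definition exchange ::
  "('k::comm_ring_1, 'v::ab_group_add, 'v) jordan_pair \<Rightarrow> ('v, 'v) tkk \<Rightarrow> ('v, 'v) tkk"
  where "exchange J = (\<lambda>w\<in>lie_alg J. case w of (x, (A, B), y) \<Rightarrow> (- y, (B, A), - x))"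

text \<open>
  Conjugation by the exchange automorphism \<open>\<theta>\<close> maps \<open>P_minus\<close> onto \<open>P_plus\<close>, so the image
  of the coset \<open>gP_minus\<close> under it is the coset \<open>(\<theta>g\<theta>\<^sup>-\<^sup>1)P_plus\<close>.
\<close>

definition polar_map ::
  "('k::comm_ring_1, 'v::ab_group_add, 'v) jordan_pair \<Rightarrow>
   (('v, 'v) tkk \<Rightarrow> ('v, 'v) tkk) set \<Rightarrow> (('v, 'v) tkk \<Rightarrow> ('v, 'v) tkk) set"
  where "polar_map J \<xi> =
    (\<lambda>h. exchange J \<otimes>\<^bsub>ambient J\<^esub> h \<otimes>\<^bsub>ambient J\<^esub> inv\<^bsub>ambient J\<^esub> (exchange J)) ` \<xi>"

definition sym_space :: "('k, 'x, 'a) geom \<Rightarrow> ('x \<Rightarrow> 'a) \<Rightarrow> 'x set"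
  where "sym_space \<X> p = {x \<in> pts_plus \<X>. transv \<X> x (p x)}"

definition sym_prod ::
  "('k::comm_ring_1, 'p::ab_group_add, 'm::ab_group_add) jordan_pair \<Rightarrow>
   ((('p, 'm) tkk \<Rightarrow> ('p, 'm) tkk) set \<Rightarrow> (('p, 'm) tkk \<Rightarrow> ('p, 'm) tkk) set) \<Rightarrow>
   (('p, 'm) tkk \<Rightarrow> ('p, 'm) tkk) set \<Rightarrow> (('p, 'm) tkk \<Rightarrow> ('p, 'm) tkk) set \<Rightarrow>
   (('p, 'm) tkk \<Rightarrow> ('p, 'm) tkk) set"
  where "sym_prod J p x y = dilation J (-1) x (p x) y"

end

theory Submission
  imports Defs
begin

text \<open>
  The Euler element \<open>E = (0, (id, -id), 0)\<close> controls the geometry: \<open>H\<close> is the stabilizer of \<open>E\<close> in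
  the elementary group \<open>G\<close>, and \<open>g \<in> P\<^sup>\<plusminus>\<close> iff \<open>g E - E\<close> lies in degree \<open>\<plusminus>1\<close>.
  The key is a rigidity property: if \<open>g E = (0, (id, B), y)\<close> with \<open>g \<in> G\<close>, then \<open>B = -id\<close>.
  Indeed \<open>X = ad (g E)\<close> satisfies \<open>X\<^sup>3 = X\<close>; this makes \<open>N = B + id\<close> idempotent, and the image of \<open>N\<close>
  generates an ideal without component in degree 1, which forces it to be central, hence fixed
  by \<open>G\<close>, hence zero.

  A Jordan pair homomorphism \<open>h\<close> relates words in the exponentials. If \<open>g E - E\<close> has degree -1,
  then for the corresponding word \<open>g'\<close> one has \<open>g' E = E + k + y'\<close>, where \<open>k\<close> has degree 0 and kills the
  image of \<open>h\<close>. After removing \<open>y'\<close>, both \<open>E + k\<close> and \<open>E - k\<close> are conjugate to \<open>E\<close>, and comparing the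
  equations \<open>X\<^sup>3 = X\<close> for the two gives \<open>k = 0\<close>; so \<open>h\<close> induces maps of the coset spaces. For
  \<open>h = (id, \<alpha>)\<close> rigidity yields injectivity. It also shows that transversality of affine points
  is equivalent to invertibility of the Bergman operator on \<open>V\<^sup>+\<close> alone, which is the same
  operator for \<open>(V, T\<^sub>\<alpha>)\<close> at \<open>(x, -x)\<close> and for \<open>(V, T)\<close> at \<open>(x, -\<alpha> x)\<close>.
\<close>

section \<open>The 3-graded Lie algebra\<close>

context module
begin

lemma double_eq_0:
  fixes x :: 'b
  assumes "2 dvd (1::'a)" "x + x = 0"
  shows "x = 0"
proof -
  obtain s :: 'a where s: "1 = 2 * s" using assms(1) by (auto simp: dvd_def)
  have "2 *s x = (1 + 1) *s x" by simp
  also have "\<dots> = 0" using assms(2) by (simp only: scale_left_distrib scale_one)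
  finally have "s *s 2 *s x = 0" by simp
  thus ?thesis using s by (simp add: mult.commute)
qed

lemma triple_eq_0:
  fixes x :: 'b
  assumes "3 dvd (1::'a)" "x + x + x = 0"
  shows "x = 0"
proof -
  obtain s :: 'a where s: "1 = 3 * s" using assms(1) by (auto simp: dvd_def)
  have "3 *s x = (1 + 1 + 1) *s x" by simp
  also have "\<dots> = 0" using assms(2) by (simp only: scale_left_distrib scale_one)
  finally have "s *s 3 *s x = 0" by simp
  thus ?thesis using s by (simp add: mult.commute)
qed

end

locale jts_sixth = jordan_triple_system sc T
  for sc :: "'k::comm_ring_1 \<Rightarrow> 'v::ab_group_add \<Rightarrow> 'v"
    and T :: "'v \<Rightarrow> 'v \<Rightarrow> 'v \<Rightarrow> 'v" +
  assumes two_unit: "(2::'k) dvd 1" and three_unit: "(3::'k) dvd 1"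
begin

lemmas T_add = module_hom.add[OF linear_1] module_hom.add[OF linear_2] module_hom.add[OF linear_3]
lemmas T_scale = module_hom.scale[OF linear_1] module_hom.scale[OF linear_2]
  module_hom.scale[OF linear_3]
lemmas T_zero [simp] = module_hom.zero[OF linear_1] module_hom.zero[OF linear_2]
  module_hom.zero[OF linear_3]
lemmas T_minus [simp] = module_hom.neg[OF linear_1] module_hom.neg[OF linear_2]
  module_hom.neg[OF linear_3]
lemmas T_diff = module_hom.diff[OF linear_1] module_hom.diff[OF linear_2]
  module_hom.diff[OF linear_3]

text \<open>Inverses in a commutative ring are unique, so the definite description in
  \<open>ring_inv\<close> denotes the inverse as soon as 2 is a unit.\<close>

lemma two_ring_inv: "2 * ring_inv 2 = (1::'k)"
proof -
  obtain s :: 'k where s: "2 * s = 1" using two_unit by (metis dvd_def)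
  moreover have "t = s" if "2 * t = 1" for t :: 'k
    by (metis s that mult.assoc mult.commute mult.right_neutral)
  ultimately show ?thesis unfolding ring_inv_def by (metis (mono_tags, lifting) theI)
qed

lemma half_double: "sc (ring_inv 2) x + sc (ring_inv 2) x = x"
  by (metis two_ring_inv scale_left_distrib mult_2 scale_one)

lemmas double_zero = double_eq_0[OF two_unit] and triple_zero = triple_eq_0[OF three_unit]

abbreviation J where "J \<equiv> jts_pair sc T"
abbreviation L where "L \<equiv> lie_alg J"
abbreviation D where "D \<equiv> inner_der J"
abbreviation Q where "Q \<equiv> quad_op sc T"

lemma J_sel [simp]: "scp J = sc" "scm J = sc" "Tp J = T" "Tm J = T"
  by (simp_all add: jts_pair_def)

definition e0 :: "('v \<Rightarrow> 'v) \<times> ('v \<Rightarrow> 'v)" where "e0 = (\<lambda>x. x, \<lambda>y. - y)"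

definition E :: "('v, 'v) tkk" where "E = (0, e0, 0)"

lemma D_eq: "D x y = (T x y, \<lambda>z. - T y x z)"
  by (simp add: inner_der_def)

lemma D_zero [simp]: "D 0 y = 0" "D x 0 = 0"
  by (auto simp: D_eq zero_prod_def fun_eq_iff)

lemma D_linear: "D (x + x') y = D x y + D x' y" "D x (y + y') = D x y + D x y'"
  "D (- x) y = - D x y" "D x (- y) = - D x y"
  "D (sc r x) y = scale0 J r (D x y)" "D x (sc r y) = scale0 J r (D x y)"
  by (auto simp: D_eq fun_eq_iff T_add T_scale scale0_def)

lemma Q_double: "Q x y + Q x y = T x y x"
  by (simp add: quad_op_def half_double)

lemma Q_linear [simp]: "Q (- x) y = Q x y" "Q x 0 = 0" "Q 0 y = 0" "Q x (- y) = - Q x y"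
  "Q x (y + y') = Q x y + Q x y'"  "Q x (y - y') = Q x y - Q x y'" "Q x (sc r y) = sc r (Q x y)"
  by (simp_all add: quad_op_def T_add T_diff T_scale scale_right_distrib
      scale_right_diff_distrib mult.commute)

lemma scale0_eq: "scale0 J r c = (\<lambda>x. sc r (fst c x), \<lambda>y. sc r (snd c y))"
  by (simp add: scale0_def split: prod.splits)

lemma lie_scale_eq:
  "lie_scale J r v = (sc r (fst v), scale0 J r (fst (snd v)), sc r (snd (snd v)))"
  by (simp add: lie_scale_def split: prod.splits)

sublocale deg0: module "scale0 J"
  by unfold_locales (simp_all add: scale0_eq scale_left_distrib scale_right_distrib prod_eq_iff
      fun_eq_iff)

sublocale lie: module "lie_scale J"
  by unfold_locales (simp_all add: lie_scale_eq scale_left_distrib scale_right_distrib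
      deg0.scale_left_distrib deg0.scale_right_distrib prod_eq_iff)

text \<open>The derivations of the Jordan pair. They form a subspace containing the generators of
  \<open>degree0\<close>, so degree 0 elements are pairs of linear maps that obey the Leibniz
  rules.\<close>

definition derivations :: "(('v \<Rightarrow> 'v) \<times> ('v \<Rightarrow> 'v)) set" where
  "derivations = {(A, B). module_hom sc sc A \<and> module_hom sc sc B \<and>
    (\<forall>x y z. A (T x y z) = T (A x) y z + T x (B y) z + T x y (A z)) \<and>
    (\<forall>x y z. B (T x y z) = T (B x) y z + T x (A y) z + T x y (B z))}"

lemma module_homI: "(\<And>x y. f (x + y) = f x + f y) \<Longrightarrow> (\<And>r x. f (sc r x) = sc r (f x)) \<Longrightarrow>
    module_hom sc sc f"
  by unfold_locales auto

lemma degree0_derivations: "degree0 J \<subseteq> derivations"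
  unfolding degree0_def
proof (rule deg0.span_minimal)
  have "D x y \<in> derivations" for x y
    using jordan_identity[of x y] jordan_identity[of y x]
    by (auto simp: D_eq derivations_def T_add T_scale intro!: module_homI)
  moreover have "e0 \<in> derivations"
    by (auto simp: e0_def derivations_def intro!: module_homI)
  ultimately show "insert (\<lambda>x. x, \<lambda>y. - y) {D x y |x y. True} \<subseteq> derivations"
    by (auto simp: e0_def)
  show "deg0.subspace derivations"
  proof (rule deg0.subspaceI)
    show "0 \<in> derivations" by (auto simp: derivations_def zero_prod_def intro!: module_homI)
    fix c d assume "c \<in> derivations" "d \<in> derivations"
    thus "c + d \<in> derivations"
      by (auto simp: derivations_def T_add module_hom.add module_hom.scale scale_right_distrib
          intro!: module_homI)
  next
    fix c r assume "c \<in> derivations"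
    thus "scale0 J r c \<in> derivations"
      by (auto simp: derivations_def scale0_def T_scale module_hom.add module_hom.scale
          scale_right_distrib mult.commute intro!: module_homI)
  qed
qed

lemma degree0D:
  assumes "(A, B) \<in> degree0 J"
  shows "module_hom sc sc A" "module_hom sc sc B"
    "A (T x y z) = T (A x) y z + T x (B y) z + T x y (A z)"
    "B (T x y z) = T (B x) y z + T x (A y) z + T x y (B z)"
  using degree0_derivations assms by (auto simp: derivations_def)

lemma degree0_linear:
  assumes "(A, B) \<in> degree0 J"
  shows "A (x + y) = A x + A y" "B (x + y) = B x + B y" "A (- x) = - A x" "B (- x) = - B x"
    "A (x - y) = A x - A y" "B (x - y) = B x - B y" "A (sc r x) = sc r (A x)"
    "B (sc r x) = sc r (B x)" "A 0 = 0" "B 0 = 0"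
  using degree0D(1,2)[OF assms]
  by (simp_all add: module_hom.add module_hom.neg module_hom.diff module_hom.scale module_hom.zero)

lemma degree0_closed [intro, simp]:
  "e0 \<in> degree0 J" "D x y \<in> degree0 J" "0 \<in> degree0 J"
  "c \<in> degree0 J \<Longrightarrow> d \<in> degree0 J \<Longrightarrow> c + d \<in> degree0 J"
  "c \<in> degree0 J \<Longrightarrow> d \<in> degree0 J \<Longrightarrow> c - d \<in> degree0 J"
  "c \<in> degree0 J \<Longrightarrow> - c \<in> degree0 J"
  "c \<in> degree0 J \<Longrightarrow> scale0 J r c \<in> degree0 J"
  unfolding degree0_def e0_def
  by (auto intro: deg0.span_base deg0.span_zero deg0.span_add deg0.span_diff deg0.span_neg
      deg0.span_scale)

lemma lie_alg_iff [simp]: "(x, c, y) \<in> L \<longleftrightarrow> c \<in> degree0 J"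
  by (simp add: lie_alg_def)

lemma E_in_L [simp, intro]: "E \<in> L" by (simp add: E_def)

lemma lie_alg_closed [intro, simp]:
  "0 \<in> L" "v \<in> L \<Longrightarrow> w \<in> L \<Longrightarrow> v + w \<in> L" "v \<in> L \<Longrightarrow> w \<in> L \<Longrightarrow> v - w \<in> L" "v \<in> L \<Longrightarrow> - v \<in> L"
  "v \<in> L \<Longrightarrow> lie_scale J r v \<in> L"
  by (simp_all add: lie_alg_def mem_Times_iff lie_scale_eq)

text \<open>
  In the definition of \<open>lie_bracket\<close>, \<open>A \<circ> A' - A' \<circ> A\<close> parses as \<open>A \<circ> (A' - A') \<circ> A\<close>, which vanishes
  for linear \<open>A\<close>. The exponentials only use brackets with elements of degree \<open>\<plusminus>1\<close>, where this
  makes no difference; the Lie bracket itself is the following one.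
\<close>

definition br :: "('v, 'v) tkk \<Rightarrow> ('v, 'v) tkk \<Rightarrow> ('v, 'v) tkk" where
  "br = (\<lambda>(x, (A, B), y) (x', (A', B'), y').
    (A x' - A' x, (A \<circ> A', B \<circ> B') - (A' \<circ> A, B' \<circ> B) + D x y' - D x' y, B y' - B' y))"

lemma br_eq: "br (x, (A, B), y) (x', (A', B'), y') = (A x' - A' x,
   (\<lambda>z. A (A' z) - A' (A z) + T x y' z - T x' y z,
    \<lambda>z. B (B' z) - B' (B z) - T y' x z + T y x' z), B y' - B' y)"
  by (simp add: br_def D_eq fun_eq_iff)

lemma lie_bracket_degree1:
  assumes "w \<in> L"
  shows "lie_bracket J (x, 0, 0) w = br (x, 0, 0) w" "lie_bracket J (0, 0, y) w = br (0, 0, y) w"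
proof -
  obtain x' A' B' y' where w: "w = (x', (A', B'), y')" by (metis surj_pair)
  show "lie_bracket J (x, 0, 0) w = br (x, 0, 0) w" "lie_bracket J (0, 0, y) w = br (0, 0, y) w"
    using assms degree0_linear(9,10)[of A' B']
    by (simp_all add: w lie_bracket_def br_def zero_prod_def fun_eq_iff)
qed

lemma commutator_D:
  assumes "(A, B) \<in> degree0 J"
  shows "(A \<circ> fst (D x y), B \<circ> snd (D x y)) - (fst (D x y) \<circ> A, snd (D x y) \<circ> B) =
    D (A x) y + D x (B y)"
  using degree0D(3,4)[OF assms] degree0_linear[OF assms] by (auto simp: D_eq fun_eq_iff)

text \<open>The commutator with a fixed element is linear in \<open>d\<close>, so generators
  suffice: \<open>e0\<close> commutes with linear maps, and the Leibniz rule turns the commutator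
  with \<open>D x y\<close> into \<open>D (A x) y + D x (B y)\<close>.\<close>

lemma commutator_closed:
  assumes c: "(A, B) \<in> degree0 J" and "d \<in> degree0 J"
  shows "(A \<circ> fst d, B \<circ> snd d) - (fst d \<circ> A, snd d \<circ> B) \<in> degree0 J"
proof -
  define S where "S = {d. (A \<circ> fst d, B \<circ> snd d) - (fst d \<circ> A, snd d \<circ> B) \<in> degree0 J}"
  note lin = degree0_linear[OF c]
  have "degree0 J \<subseteq> S"
    unfolding degree0_def
  proof (rule deg0.span_minimal)
    have "(A \<circ> fst e0, B \<circ> snd e0) - (fst e0 \<circ> A, snd e0 \<circ> B) = 0"
      by (simp add: zero_prod_def fun_eq_iff e0_def lin)
    thus "insert (\<lambda>x. x, \<lambda>y. - y) {D x y |x y. True} \<subseteq> S"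
      using commutator_D[OF c] by (auto simp: S_def e0_def simp del: diff_Pair)
    show "deg0.subspace S"
    proof (rule deg0.subspaceI)
      have "(A \<circ> fst d, B \<circ> snd d) - (fst d \<circ> A, snd d \<circ> B) = 0" if "d = 0" for d
        by (simp add: that prod_eq_iff fun_eq_iff lin)
      thus "0 \<in> S" by (simp add: S_def)
    next
      fix d d' assume "d \<in> S" "d' \<in> S"
      moreover have "(A \<circ> fst (d + d'), B \<circ> snd (d + d')) - (fst (d + d') \<circ> A, snd (d + d') \<circ> B) =
          ((A \<circ> fst d, B \<circ> snd d) - (fst d \<circ> A, snd d \<circ> B)) +
          ((A \<circ> fst d', B \<circ> snd d') - (fst d' \<circ> A, snd d' \<circ> B))"
        by (simp add: prod_eq_iff fun_eq_iff lin)
      ultimately show "d + d' \<in> S" by (simp only: S_def mem_Collect_eq degree0_closed)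
    next
      fix d r assume "d \<in> S"
      moreover have "(A \<circ> fst (scale0 J r d), B \<circ> snd (scale0 J r d)) -
            (fst (scale0 J r d) \<circ> A, snd (scale0 J r d) \<circ> B) =
          scale0 J r ((A \<circ> fst d, B \<circ> snd d) - (fst d \<circ> A, snd d \<circ> B))"
        by (simp add: scale0_eq prod_eq_iff fun_eq_iff lin scale_right_diff_distrib)
      ultimately show "scale0 J r d \<in> S" by (simp only: S_def mem_Collect_eq degree0_closed)
    qed
  qed
  thus ?thesis using assms(2) by (auto simp: S_def)
qed

lemma br_closed [intro, simp]:
  assumes "v \<in> L" "w \<in> L"
  shows "br v w \<in> L"
proof -
  obtain x A B y where v: "v = (x, (A, B), y)" by (metis surj_pair)
  obtain x' A' B' y' where w: "w = (x', (A', B'), y')" by (metis surj_pair)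
  show ?thesis using assms commutator_closed[of A B "(A', B')"]
    by (simp add: v w br_def)
qed

lemma br_add:
  assumes "u \<in> L" "v \<in> L" "w \<in> L"
  shows "br (u + v) w = br u w + br v w" "br w (u + v) = br w u + br w v"
proof -
  obtain x A B y where u: "u = (x, (A, B), y)" by (metis surj_pair)
  obtain x' A' B' y' where v: "v = (x', (A', B'), y')" by (metis surj_pair)
  obtain p P R q where w: "w = (p, (P, R), q)" by (metis surj_pair)
  have "(P, R) \<in> degree0 J" using assms by (simp add: w)
  note lin = degree0_linear[OF this]
  show "br (u + v) w = br u w + br v w" "br w (u + v) = br w u + br w v"
    by (simp_all add: u v w br_eq T_add lin fun_eq_iff)
qed

lemma br_scale:
  assumes "v \<in> L" "w \<in> L"
  shows "br (lie_scale J r v) w = lie_scale J r (br v w)"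
    "br w (lie_scale J r v) = lie_scale J r (br w v)"
proof -
  obtain x' A' B' y' where v: "v = (x', (A', B'), y')" by (metis surj_pair)
  obtain p P R q where w: "w = (p, (P, R), q)" by (metis surj_pair)
  have "(P, R) \<in> degree0 J" using assms by (simp add: w)
  note lin = degree0_linear[OF this]
  show "br (lie_scale J r v) w = lie_scale J r (br v w)"
    "br w (lie_scale J r v) = lie_scale J r (br w v)"
    by (simp_all add: v w br_eq T_scale lin fun_eq_iff lie_scale_def scale0_def
        scale_right_diff_distrib scale_right_distrib)
qed

text \<open>The Jacobi identity with one entry of degree 1. In components it comes down to linearity
  and the Leibniz rules of the degree 0 entries; the outer symmetry of \<open>T\<close> matches the
  remaining terms.\<close>

lemma br_derivation_plus:
  assumes "v \<in> L" "w \<in> L"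
  shows "br (x, 0, 0) (br v w) = br (br (x, 0, 0) v) w + br v (br (x, 0, 0) w)"
proof -
  obtain x' A' B' y' where v: "v = (x', (A', B'), y')" by (metis surj_pair)
  obtain p P R q where w: "w = (p, (P, R), q)" by (metis surj_pair)
  have *: "(A', B') \<in> degree0 J" "(P, R) \<in> degree0 J" using assms by (simp_all add: v w)
  note lin = degree0_linear[OF *(1)] degree0_linear[OF *(2)] degree0D(3,4)[OF *(1)]
    degree0D(3,4)[OF *(2)]
  show ?thesis
    by (simp add: v w br_eq T_add T_diff lin fun_eq_iff zero_prod_def symmetric[of p _ x]
       symmetric[of x' _ x] symmetric[of q _ y'])
qed

lemma br_derivation_minus:
  assumes "v \<in> L" "w \<in> L"
  shows "br (0, 0, y) (br v w) = br (br (0, 0, y) v) w + br v (br (0, 0, y) w)"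
proof -
  obtain x' A' B' y' where v: "v = (x', (A', B'), y')" by (metis surj_pair)
  obtain p P R q where w: "w = (p, (P, R), q)" by (metis surj_pair)
  have *: "(A', B') \<in> degree0 J" "(P, R) \<in> degree0 J" using assms by (simp_all add: v w)
  note lin = degree0_linear[OF *(1)] degree0_linear[OF *(2)] degree0D(3,4)[OF *(1)]
    degree0D(3,4)[OF *(2)]
  show ?thesis
    by (simp add: v w br_eq T_add T_diff lin fun_eq_iff zero_prod_def symmetric[of q _ y]
       symmetric[of y' _ y] symmetric[of p _ x'])
qed

section \<open>The exponentials in components\<close>

lemma exp_plus_br:
  "w \<in> L \<Longrightarrow> exp_plus J x w =
    w + br (x, 0, 0) w + lie_scale J (ring_inv 2) (br (x, 0, 0) (br (x, 0, 0) w))"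
  by (simp add: exp_plus_def exp_ad_def lie_bracket_degree1)

lemma exp_minus_br:
  "w \<in> L \<Longrightarrow> exp_minus J y w =
    w + br (0, 0, y) w + lie_scale J (ring_inv 2) (br (0, 0, y) (br (0, 0, y) w))"
  by (simp add: exp_minus_def exp_ad_def lie_bracket_degree1)

text \<open>The linear term of the series contributes \<open>- A x\<close> and \<open>D x q\<close>,
  the quadratic term half of \<open>- T x q x\<close>, which is \<open>- Q x q\<close>.\<close>

lemma exp_plus_eq:
  assumes "(A, B) \<in> degree0 J"
  shows "exp_plus J x (p, (A, B), q) = (p - A x - Q x q, (A, B) + D x q, q)"
  using assms degree0_linear(9,10)[OF assms]
  by (simp add: exp_plus_br)
    (simp add: br_eq zero_prod_def lie_scale_def scale0_def D_eq fun_eq_iff quad_op_def)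

lemma exp_minus_eq:
  assumes "(A, B) \<in> degree0 J"
  shows "exp_minus J y (p, (A, B), q) = (p, (A, B) - D p y, q - B y - Q y p)"
  using assms degree0_linear(9,10)[OF assms]
  by (simp add: exp_minus_br)
    (simp add: br_eq zero_prod_def lie_scale_def scale0_def D_eq fun_eq_iff quad_op_def)

end

section \<open>The elementary group\<close>

context jts_sixth
begin

lemmas lie_double_zero = lie.double_eq_0[OF two_unit]
  and lie_triple_zero = lie.triple_eq_0[OF three_unit]

lemma lie_half_double: "lie_scale J (ring_inv 2) w + lie_scale J (ring_inv 2) w = w"
  by (metis two_ring_inv lie.scale_left_distrib mult_2 lie.scale_one)

text \<open>
  The Leibniz rule for the third and fourth powers of the derivation, which vanish, kills the terms
  of order 3 and 4 in the product of the two exponential series.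
\<close>

lemma exp_br:
  fixes z
  defines "ex \<equiv> \<lambda>w. w + br z w + lie_scale J (ring_inv 2) (br z (br z w))"
  assumes z: "z \<in> L"
    and der: "\<And>v w. v \<in> L \<Longrightarrow> w \<in> L \<Longrightarrow> br z (br v w) = br (br z v) w + br v (br z w)"
    and cube: "\<And>w. w \<in> L \<Longrightarrow> br z (br z (br z w)) = 0"
    and v: "v \<in> L" and w: "w \<in> L"
  shows "ex (br v w) = br (ex v) (ex w)"
proof -
  let ?h = "lie_scale J (ring_inv 2)"
  define v1 w1 v2 w2 where "v1 = br z v" "w1 = br z w" "v2 = br z v1" "w2 = br z w1"
  note z_act = this[symmetric]
  have cubes: "br z v2 = 0" "br z w2 = 0" using cube v w by (simp_all flip: z_act)
  have in_L [simp]: "v1 \<in> L" "w1 \<in> L" "v2 \<in> L" "w2 \<in> L" using z v w by (simp_all flip: z_act)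
  note [simp] = z v w
  have zero: "br 0 u = 0" "br u 0 = 0" if "u \<in> L" for u
  proof -
    have "br (0 + 0) u = br 0 u + br 0 u" "br u (0 + 0) = br u 0 + br u 0"
      using br_add[of 0 0 u] that by blast+
    thus "br 0 u = 0" "br u 0 = 0" unfolding add_0 by (metis add_cancel_left_right)+
  qed
  note ders = der[of v w] der[of v1 w] der[of v w1] der[of v2 w] der[of v1 w1] der[of v w2]
    der[of v2 w1] der[of v1 w2]
  have d2: "br z (br z (br v w)) = br v2 w + (br v1 w1 + br v1 w1) + br v w2"
    by (simp add: ders z_act br_add)
  have "br z (br z (br z (br v w))) = br v2 w1 + br v1 w2 + (br v2 w1 + br v1 w2) +
      (br v2 w1 + br v1 w2)"
    unfolding d2 by (simp add: ders z_act br_add cubes zero algebra_simps)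
  hence s3: "br v2 w1 + br v1 w2 = 0"
    unfolding cube[OF br_closed[OF v w]] by (rule lie_triple_zero[OF sym])
  have "br z (br v2 w1 + br v1 w2) = br v2 w2 + br v2 w2"
    by (simp add: ders z_act br_add cubes zero algebra_simps)
  hence s4: "br v2 w2 = 0"
    unfolding s3 zero(2)[OF z] by (rule lie_double_zero[OF sym])
  \<comment> \<open>The product is grouped by order so that \<open>s3\<close> and \<open>s4\<close>
    apply. The single term \<open>br v1 w1\<close> is then split into two halves, as it appears in
    half of \<open>d2\<close>.\<close>
  have "br (ex v) (ex w) = br v w + br v1 w + br v w1 + ?h (br v2 w) + br v1 w1 + ?h (br v w2)
      + ?h (br v2 w1 + br v1 w2) + ?h (?h (br v2 w2))"
    by (simp add: ex_def z_act br_add br_scale lie.scale_right_distrib algebra_simps del: lie.scale_scale)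
  also have "\<dots> = br v w + br v1 w + br v w1 + ?h (br v2 w) + (?h (br v1 w1) + ?h (br v1 w1)) +
      ?h (br v w2)"
    by (simp add: s3 s4 lie_half_double)
  also have "\<dots> = ex (br v w)"
    by (simp add: ex_def ders z_act br_add lie.scale_right_distrib algebra_simps)
  finally show ?thesis by simp
qed

lemma exp_plus_closed [simp, intro]: "w \<in> L \<Longrightarrow> exp_plus J x w \<in> L"
  and exp_minus_closed [simp, intro]: "w \<in> L \<Longrightarrow> exp_minus J y w \<in> L"
  by (simp_all add: exp_plus_br exp_minus_br)

lemma exp_plus_bracket:
  assumes "v \<in> L" "w \<in> L"
  shows "exp_plus J x (br v w) = br (exp_plus J x v) (exp_plus J x w)"
proof -
  have "br (x, 0, 0) (br (x, 0, 0) (br (x, 0, 0) w)) = 0" if wL: "w \<in> L" for w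
  proof -
    obtain p A B q where w: "w = (p, (A, B), q)" by (metis surj_pair)
    have "A 0 = 0" "B 0 = 0" using degree0_linear wL by (auto simp: w)
    thus ?thesis by (simp add: w br_eq zero_prod_def fun_eq_iff)
  qed
  thus ?thesis
    using exp_br[OF _ br_derivation_plus _ assms, of x] assms by (simp add: exp_plus_br)
qed

lemma exp_minus_bracket:
  assumes "v \<in> L" "w \<in> L"
  shows "exp_minus J y (br v w) = br (exp_minus J y v) (exp_minus J y w)"
proof -
  have "br (0, 0, y) (br (0, 0, y) (br (0, 0, y) w)) = 0" if wL: "w \<in> L" for w
  proof -
    obtain p A B q where w: "w = (p, (A, B), q)" by (metis surj_pair)
    have "A 0 = 0" "B 0 = 0" using degree0_linear wL by (auto simp: w)
    thus ?thesis by (simp add: w br_eq zero_prod_def fun_eq_iff)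
  qed
  thus ?thesis
    using exp_br[OF _ br_derivation_minus _ assms, of y] assms by (simp add: exp_minus_br)
qed

lemma exp_add:
  assumes "v \<in> L" "w \<in> L"
  shows "exp_plus J x (v + w) = exp_plus J x v + exp_plus J x w"
    "exp_minus J y (v + w) = exp_minus J y v + exp_minus J y w"
  using assms by (simp_all add: exp_plus_br exp_minus_br br_add lie.scale_right_distrib)

lemma exp_scale:
  assumes "v \<in> L"
  shows "exp_plus J x (lie_scale J r v) = lie_scale J r (exp_plus J x v)"
    "exp_minus J y (lie_scale J r v) = lie_scale J r (exp_minus J y v)"
  using assms
  by (simp_all add: exp_plus_br exp_minus_br br_scale lie.scale_right_distrib mult.commute)

lemma exp_plus_neg:
  assumes "w \<in> L"
  shows "exp_plus J (- x) (exp_plus J x w) = w"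
proof -
  obtain p A B q where w: "w = (p, (A, B), q)" by (metis surj_pair)
  have AB: "(A, B) \<in> degree0 J" using assms by (simp add: w)
  moreover have "(A, B) + D x q \<in> degree0 J" using AB by blast
  ultimately show ?thesis
    using Q_double[of x q, symmetric]
    by (simp add: w exp_plus_eq D_eq degree0_linear[OF AB] fun_eq_iff)
qed

lemma exp_minus_neg:
  assumes "w \<in> L"
  shows "exp_minus J (- y) (exp_minus J y w) = w"
proof -
  obtain p A B q where w: "w = (p, (A, B), q)" by (metis surj_pair)
  have AB: "(A, B) \<in> degree0 J" using assms by (simp add: w)
  moreover have "(A, B) - D p y \<in> degree0 J" using AB by blast
  ultimately show ?thesis
    using Q_double[of y p, symmetric]
    by (simp add: w exp_minus_eq D_eq degree0_linear[OF AB] fun_eq_iff)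
qed

section \<open>The elementary group as a group of bijections\<close>

abbreviation \<A> where "\<A> \<equiv> ambient J"
abbreviation G where "G \<equiv> el_group J"

sublocale amb: group \<A>
  by (simp add: ambient_def group_BijGroup)

lemma amb_carrier: "carrier \<A> = Bij L"
  by (simp add: ambient_def BijGroup_def)

lemma amb_mult: "g \<in> carrier \<A> \<Longrightarrow> h \<in> carrier \<A> \<Longrightarrow> w \<in> L \<Longrightarrow> (g \<otimes>\<^bsub>\<A>\<^esub> h) w = g (h w)"
  by (simp add: ambient_def BijGroup_def compose_eq)

lemma amb_one: "w \<in> L \<Longrightarrow> \<one>\<^bsub>\<A>\<^esub> w = w"
  by (simp add: ambient_def BijGroup_def)

lemma amb_eqI:
  "g \<in> carrier \<A> \<Longrightarrow> h \<in> carrier \<A> \<Longrightarrow> (\<And>w. w \<in> L \<Longrightarrow> g w = h w) \<Longrightarrow> g = h"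
  by (auto simp: amb_carrier Bij_def intro: extensionalityI)

lemma amb_closed: "g \<in> carrier \<A> \<Longrightarrow> w \<in> L \<Longrightarrow> g w \<in> L"
  by (auto simp: amb_carrier Bij_def bij_betw_def)

lemma amb_inv:
  assumes "g \<in> carrier \<A>" "w \<in> L"
  shows "(inv\<^bsub>\<A>\<^esub> g) (g w) = w" "g ((inv\<^bsub>\<A>\<^esub> g) w) = w"
  using amb_mult[of "inv\<^bsub>\<A>\<^esub> g" g w] amb_mult[of g "inv\<^bsub>\<A>\<^esub> g" w] assms by (simp_all add: amb_one)

lemma exp_in_carrier [simp, intro]: "exp_plus J x \<in> carrier \<A>" "exp_minus J y \<in> carrier \<A>"
proof -
  have "bij_betw (exp_plus J x) L L"
    using exp_plus_neg[of _ x] exp_plus_neg[of _ "- x"]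
    by (intro bij_betw_byWitness[where f' = "exp_plus J (- x)"]) auto
  thus "exp_plus J x \<in> carrier \<A>"
    by (auto simp: amb_carrier Bij_def exp_plus_def exp_ad_def)
  have "bij_betw (exp_minus J y) L L"
    using exp_minus_neg[of _ y] exp_minus_neg[of _ "- y"]
    by (intro bij_betw_byWitness[where f' = "exp_minus J (- y)"]) auto
  thus "exp_minus J y \<in> carrier \<A>"
    by (auto simp: amb_carrier Bij_def exp_minus_def exp_ad_def)
qed

lemma inv_exp [simp]: "inv\<^bsub>\<A>\<^esub> (exp_plus J x) = exp_plus J (- x)"
  "inv\<^bsub>\<A>\<^esub> (exp_minus J y) = exp_minus J (- y)"
  by (rule amb.inv_equality; auto intro!: amb_eqI simp: amb_mult amb_one exp_plus_neg exp_minus_neg)+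

lemma G_subgroup: "subgroup G \<A>"
  unfolding el_group_def by (intro amb.generate_is_subgroup) auto

lemma G_carrier [simp, intro]: "g \<in> G \<Longrightarrow> g \<in> carrier \<A>"
  by (rule subgroup.mem_carrier[OF G_subgroup])

lemma G_closed [simp, intro]:
  "\<one>\<^bsub>\<A>\<^esub> \<in> G" "g \<in> G \<Longrightarrow> h \<in> G \<Longrightarrow> g \<otimes>\<^bsub>\<A>\<^esub> h \<in> G" "g \<in> G \<Longrightarrow> inv\<^bsub>\<A>\<^esub> g \<in> G"
  "exp_plus J x \<in> G" "exp_minus J y \<in> G"
  using subgroup.one_closed[OF G_subgroup] subgroup.m_closed[OF G_subgroup]
    subgroup.m_inv_closed[OF G_subgroup]
  by (auto simp: el_group_def intro: generate.incl)

text \<open>The exponentials are closed under inverses, so every element is reached from the unit by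
  multiplying with exponentials on the left.\<close>

lemma el_group_induct [consumes 1, case_names one plus minus]:
  assumes "g \<in> G" and one: "P \<one>\<^bsub>\<A>\<^esub>"
    and plus: "\<And>x g. g \<in> G \<Longrightarrow> P g \<Longrightarrow> P (exp_plus J x \<otimes>\<^bsub>\<A>\<^esub> g)"
    and minus: "\<And>y g. g \<in> G \<Longrightarrow> P g \<Longrightarrow> P (exp_minus J y \<otimes>\<^bsub>\<A>\<^esub> g)"
  shows "P g"
proof -
  let ?S = "range (exp_plus J) \<union> range (exp_minus J)"
  have step: "P (s \<otimes>\<^bsub>\<A>\<^esub> g)" if "s \<in> ?S" "g \<in> G" "P g" for s g
    using that plus minus by auto
  \<comment> \<open>The product case of \<open>generate\<close> calls for a stronger claim: left
    multiplication by \<open>g\<close> preserves \<open>P\<close>. Applied to the unit it gives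
    \<open>P g\<close>.\<close>
  have "\<forall>k\<in>G. P k \<longrightarrow> P (g \<otimes>\<^bsub>\<A>\<^esub> k)"
    using assms(1) unfolding el_group_def
  proof (induction rule: generate.induct)
    case one
    then show ?case by (auto simp: el_group_def[symmetric])
  next
    case (incl s)
    then show ?case using step by (auto simp: el_group_def[symmetric])
  next
    case (inv s)
    hence "inv\<^bsub>\<A>\<^esub> s \<in> ?S" by auto
    then show ?case using step by (auto simp: el_group_def[symmetric])
  next
    case (eng h1 h2)
    then show ?case by (auto simp: el_group_def[symmetric] amb.m_assoc)
  qed
  from this[rule_format, OF _ one] show ?thesis using assms(1) by simp
qed

lemma G_L [simp, intro]: "g \<in> G \<Longrightarrow> w \<in> L \<Longrightarrow> g w \<in> L"
  using amb_closed by blast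

text \<open>The group acts by automorphisms of the Lie algebra: the exponentials do, and the
  property passes to products.\<close>

lemma G_aut:
  assumes "g \<in> G"
  shows "(\<forall>v\<in>L. \<forall>w\<in>L. g (v + w) = g v + g w \<and> g (br v w) = br (g v) (g w)) \<and>
    (\<forall>v\<in>L. \<forall>r. g (lie_scale J r v) = lie_scale J r (g v))"
  using assms
  by (induction rule: el_group_induct)
    (auto simp: amb_one amb_mult exp_add exp_scale exp_plus_bracket exp_minus_bracket)

lemma G_add: "g \<in> G \<Longrightarrow> v \<in> L \<Longrightarrow> w \<in> L \<Longrightarrow> g (v + w) = g v + g w"
  and G_br: "g \<in> G \<Longrightarrow> v \<in> L \<Longrightarrow> w \<in> L \<Longrightarrow> g (br v w) = br (g v) (g w)"
  and G_scale: "g \<in> G \<Longrightarrow> v \<in> L \<Longrightarrow> g (lie_scale J r v) = lie_scale J r (g v)"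
  using G_aut by blast+

lemma G_zero: "g \<in> G \<Longrightarrow> g 0 = 0"
  using G_add[of g 0 0] by simp

lemma G_neg: "g \<in> G \<Longrightarrow> v \<in> L \<Longrightarrow> g (- v) = - g v"
  using G_add[of g v "- v"] G_zero[of g] by (simp add: eq_neg_iff_add_eq_0 add.commute)

lemma G_diff: "g \<in> G \<Longrightarrow> v \<in> L \<Longrightarrow> w \<in> L \<Longrightarrow> g (v - w) = g v - g w"
  using G_add[of g v "- w"] G_neg[of g w] by simp

lemmas G_inv = amb_inv[OF G_carrier]

lemma G_mult: "g \<in> G \<Longrightarrow> h \<in> G \<Longrightarrow> w \<in> L \<Longrightarrow> (g \<otimes>\<^bsub>\<A>\<^esub> h) w = g (h w)"
  by (simp add: amb_mult)

end

section \<open>The Euler element\<close>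

lemma (in group) l_coset_eq_iff:
  assumes "subgroup H G" "x \<in> carrier G" "y \<in> carrier G"
  shows "x <# H = y <# H \<longleftrightarrow> inv x \<otimes> y \<in> H"
proof
  assume "x <# H = y <# H"
  moreover have "y \<in> y <# H"
    using assms subgroup.one_closed[of H G] by (force simp: l_coset_def)
  ultimately obtain h where "h \<in> H" "y = x \<otimes> h" by (auto simp: l_coset_def)
  thus "inv x \<otimes> y \<in> H"
    using assms subgroup.mem_carrier by (fastforce simp flip: m_assoc)
next
  assume *: "inv x \<otimes> y \<in> H"
  have "y = x \<otimes> (inv x \<otimes> y)" using assms by (simp flip: m_assoc)
  hence "y <# H = x <# ((inv x \<otimes> y) <# H)"
    using assms by (metis lcos_m_assoc inv_closed m_closed subgroup.subset)
  also have "(inv x \<otimes> y) <# H = H"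
    using * assms(1) by (simp add: coset_join3 subgroup.mem_carrier)
  finally show "x <# H = y <# H" by simp
qed

context jts_sixth
begin

lemma br_E: "(p, c, q) \<in> L \<Longrightarrow> br E (p, c, q) = (p, 0, - q)"
proof -
  assume *: "(p, c, q) \<in> L"
  obtain A B where c: "c = (A, B)" by force
  have "(A, B) \<in> degree0 J" using * by (simp add: c)
  thus ?thesis by (simp add: E_def e0_def c br_eq zero_prod_def fun_eq_iff degree0_linear)
qed

text \<open>The grading is the eigenspace decomposition of ad \<open>E\<close>; invertibility of 2
  separates the eigenvalues 1 and -1. Membership in a degree thus becomes an equation that
  automorphisms transport.\<close>

lemma grade_iff:
  assumes "w \<in> L"
  shows "w \<in> grade J 1 \<longleftrightarrow> br E w = w" "w \<in> grade J 0 \<longleftrightarrow> br E w = 0"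
    "w \<in> grade J (- 1) \<longleftrightarrow> br E w = - w"
proof -
  obtain p A B q where w: "w = (p, (A, B), q)" by (metis surj_pair)
  have [simp]: "x = - x \<longleftrightarrow> x = 0" "- x = x \<longleftrightarrow> x = 0" for x :: 'v
    using double_zero[of x] by (metis add.inverse_neutral add.right_inverse)+
  show "w \<in> grade J 1 \<longleftrightarrow> br E w = w" "w \<in> grade J 0 \<longleftrightarrow> br E w = 0"
    "w \<in> grade J (- 1) \<longleftrightarrow> br E w = - w"
    using assms br_E[of p "(A, B)" q] by (auto simp: w grade_def zero_prod_def)
qed

lemma br_E_cube:
  assumes "w \<in> L"
  shows "br E (br E (br E w)) = br E w"
proof -
  obtain p c q where "w = (p, c, q)" by (metis surj_pair)
  thus ?thesis using assms by (simp add: br_E)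
qed

text \<open>With eigenvalues 1, 0 and -1, X = ad \<open>E\<close> satisfies X^3 = X, and conjugation
  by \<open>g\<close> carries this over. Both rigidity arguments below start from it.\<close>

lemma br_GE_cube:
  assumes "g \<in> G" "w \<in> L"
  shows "br (g E) (br (g E) (br (g E) w)) = br (g E) w"
proof -
  define w' where "w' = (inv\<^bsub>\<A>\<^esub> g) w"
  have "w' \<in> L" "w = g w'" using assms by (auto simp: w'_def G_inv)
  thus ?thesis using br_E_cube[of w'] assms by (simp add: G_br[symmetric])
qed

lemma grade_subset: "grade J i \<subseteq> L"
  by (auto simp: grade_def lie_alg_def mem_Times_iff)

text \<open>If \<open>g\<close> preserves the grading, then \<open>g E\<close> has degree 0 and acts
  on degrees 1 and -1 with the same eigenvalues as \<open>E\<close>, so it is \<open>E\<close>.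
  Conversely, an automorphism fixing \<open>E\<close> commutes with ad \<open>E\<close> and
  preserves its eigenspaces.\<close>

lemma H_iff: "g \<in> H_group J \<longleftrightarrow> g \<in> G \<and> g E = E"
proof
  assume "g \<in> H_group J"
  hence g: "g \<in> G" and gr: "g ` grade J 1 = grade J 1" "g ` grade J 0 = grade J 0"
      "g ` grade J (- 1) = grade J (- 1)"
    by (auto simp: H_group_def)
  have "E \<in> grade J 0"
    using degree0_closed(1) by (auto simp: grade_def E_def e0_def)
  hence "g E \<in> grade J 0" using gr by blast
  then obtain A B where AB: "g E = (0, (A, B), 0)" "(A, B) \<in> degree0 J"
    by (auto simp: grade_def)
  have "A p = p" for p
  proof -
    have "(p, 0, 0) \<in> g ` grade J 1" unfolding gr by (simp add: grade_def)
    then obtain w where w: "w \<in> grade J 1" "g w = (p, 0, 0)" by force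
    moreover have "w \<in> L" using w grade_subset by blast
    ultimately have "br (g E) (p, 0, 0) = (p, 0, 0)" using g grade_iff(1)[of w] by (metis G_br E_in_L)
    thus ?thesis by (simp add: AB br_eq zero_prod_def)
  qed
  moreover have "B p = - p" for p
  proof -
    have "(0, 0, p) \<in> g ` grade J (- 1)" unfolding gr by (simp add: grade_def)
    then obtain w where w: "w \<in> grade J (- 1)" "g w = (0, 0, p)" by force
    moreover have "w \<in> L" using w grade_subset by blast
    ultimately have "br (g E) (0, 0, p) = - (0, 0, p)"
      using g grade_iff(3)[of w] by (metis G_br E_in_L G_neg)
    thus ?thesis by (simp add: AB br_eq zero_prod_def)
  qed
  ultimately show "g \<in> G \<and> g E = E" using g AB by (auto simp: E_def e0_def fun_eq_iff)
next
  assume *: "g \<in> G \<and> g E = E"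
  have sub: "k ` grade J i \<subseteq> grade J i" if k: "k \<in> G" "k E = E" and i: "i \<in> {1, 0, - 1}" for k i
  proof
    fix w assume "w \<in> k ` grade J i"
    then obtain v where v: "v \<in> grade J i" "w = k v" by auto
    have vL: "v \<in> L" using v grade_subset by auto
    have "br E w = k (br E v)" using k vL v by (simp add: G_br)
    moreover have "w \<in> L" using k v vL by simp
    moreover have "i = 1 \<or> i = 0 \<or> i = - 1" using i by blast
    ultimately show "w \<in> grade J i"
      using v vL k by (elim disjE) (simp_all add: grade_iff G_neg G_zero)
  qed
  have i: "inv\<^bsub>\<A>\<^esub> g \<in> G" "(inv\<^bsub>\<A>\<^esub> g) E = E" using * G_inv(1)[of g E] by auto
  have "grade J i \<subseteq> g ` grade J i" if "i \<in> {1, 0, - 1}" for i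
  proof
    fix w assume "w \<in> grade J i"
    hence "(inv\<^bsub>\<A>\<^esub> g) w \<in> grade J i" "w = g ((inv\<^bsub>\<A>\<^esub> g) w)"
      using sub[OF i that] grade_subset[of i] G_inv(2)[of g w] * by auto
    thus "w \<in> g ` grade J i" by blast
  qed
  hence "g ` grade J i = grade J i" if "i \<in> {1, 0, - 1}" for i
    using * sub[of g i] that by (intro equalityI) blast+
  thus "g \<in> H_group J" using * by (simp add: H_group_def)
qed

lemma exp_E: "exp_plus J x E = (- x, e0, 0)" "exp_minus J y E = (0, e0, y)"
  using degree0_closed(1) unfolding E_def e0_def by (simp_all add: exp_plus_eq exp_minus_eq)

text \<open>Since \<open>exp_minus J y\<close> sends \<open>E\<close> to \<open>E\<close> plus
  \<open>y\<close> in degree -1, multiplying \<open>g\<close> by \<open>exp_minus J (- y)\<close>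
  yields an element that fixes \<open>E\<close>.\<close>

lemma P_minus_iff: "g \<in> P_minus J \<longleftrightarrow> g \<in> G \<and> (\<exists>y. g E = (0, e0, y))"
proof
  assume "g \<in> P_minus J"
  then obtain y h where "g = exp_minus J y \<otimes>\<^bsub>\<A>\<^esub> h" "h \<in> H_group J"
    by (auto simp: P_minus_def set_mult_def)
  thus "g \<in> G \<and> (\<exists>y. g E = (0, e0, y))" by (auto simp: H_iff G_mult exp_E)
next
  assume "g \<in> G \<and> (\<exists>y. g E = (0, e0, y))"
  then obtain y where g: "g \<in> G" "g E = (0, e0, y)" by auto
  define h where "h = exp_minus J (- y) \<otimes>\<^bsub>\<A>\<^esub> g"
  have "h \<in> H_group J"
    using g exp_minus_neg[of E y] by (auto simp: h_def H_iff G_mult exp_E)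
  moreover have "g = exp_minus J y \<otimes>\<^bsub>\<A>\<^esub> h"
    using g inv_exp(2)[of "- y"] by (simp add: h_def amb.m_assoc[symmetric])
      (metis G_carrier amb.l_inv amb.l_one exp_in_carrier(2) inv_exp(2) minus_minus)
  ultimately show "g \<in> P_minus J" by (auto simp: P_minus_def set_mult_def)
qed

lemma P_plus_iff: "g \<in> P_plus J \<longleftrightarrow> g \<in> G \<and> (\<exists>x. g E = (x, e0, 0))"
proof
  assume "g \<in> P_plus J"
  then obtain y h where "g = exp_plus J y \<otimes>\<^bsub>\<A>\<^esub> h" "h \<in> H_group J"
    by (auto simp: P_plus_def set_mult_def)
  thus "g \<in> G \<and> (\<exists>x. g E = (x, e0, 0))" by (auto simp: H_iff G_mult exp_E)
next
  assume "g \<in> G \<and> (\<exists>x. g E = (x, e0, 0))"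
  then obtain y where g: "g \<in> G" "g E = (y, e0, 0)" by auto
  define h where "h = exp_plus J y \<otimes>\<^bsub>\<A>\<^esub> g"
  have "h \<in> H_group J"
    using g exp_plus_neg[of E "- y"] by (auto simp: h_def H_iff G_mult exp_E)
  moreover have "g = exp_plus J (- y) \<otimes>\<^bsub>\<A>\<^esub> h"
    using g by (simp add: h_def amb.m_assoc[symmetric])
      (metis G_carrier amb.l_inv amb.l_one exp_in_carrier(1) inv_exp(1))
  ultimately show "g \<in> P_plus J" by (auto simp: P_plus_def set_mult_def)
qed

text \<open>The image is an eigenvector of ad (\<open>g E\<close>) for the eigenvalue -1. Its degree
  1 component \<open>p\<close> then equals \<open>- p\<close>, hence vanishes, and the degree 0
  component, which is expressed through \<open>p\<close> and \<open>y\<close>, vanishes with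
  it.\<close>

lemma P_minus_degree:
  assumes "g \<in> G" "g E = (0, e0, y)"
  shows "\<exists>v'. g (0, 0, v) = (0, 0, v')"
proof -
  obtain p A B q where gv: "g (0, 0, v) = (p, (A, B), q)" by (metis surj_pair)
  have "(0, 0, v) \<in> L" by simp
  hence "br (g E) (g (0, 0, v)) = - g (0, 0, v)" and AB: "(A, B) \<in> degree0 J"
    using assms G_br[of g E "(0, 0, v)"] G_neg[of g "(0, 0, v)"] br_E[of 0 0 v] gv
      G_L[of g "(0, 0, v)"]
    by auto
  hence eq: "p = - p" "\<And>z. A z = T p y z" "\<And>z. B z = - T y p z"
    using degree0_linear[OF AB] by (auto simp: assms gv e0_def br_eq fun_eq_iff)
  have "p = 0" using eq(1) double_zero[of p] by (metis add.right_inverse)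
  hence "A = 0 \<and> B = 0" using eq(2,3) by (auto simp: fun_eq_iff)
  thus ?thesis using \<open>p = 0\<close> gv by (auto simp: zero_prod_def)
qed

lemma P_plus_degree:
  assumes "g \<in> G" "g E = (x, e0, 0)"
  shows "\<exists>v'. g (v, 0, 0) = (v', 0, 0)"
proof -
  obtain p A B q where gv: "g (v, 0, 0) = (p, (A, B), q)" by (metis surj_pair)
  have "(v, 0, 0) \<in> L" by simp
  hence "br (g E) (g (v, 0, 0)) = g (v, 0, 0)" and AB: "(A, B) \<in> degree0 J"
    using assms G_br[of g E "(v, 0, 0)"] br_E[of v 0 0] gv
      G_L[of g "(v, 0, 0)"]
    by auto
  hence eq: "q = - q" "\<And>z. A z = T x q z" "\<And>z. B z = - T q x z"
    using degree0_linear[OF AB] by (auto simp: assms gv e0_def br_eq fun_eq_iff)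
  have "q = 0" using eq(1) double_zero[of q] by (metis add.right_inverse)
  hence "A = 0 \<and> B = 0" using eq(2,3) by (auto simp: fun_eq_iff)
  thus ?thesis using \<open>q = 0\<close> gv by (auto simp: zero_prod_def)
qed

section \<open>Rigidity of the Euler element\<close>

lemma annihilator_fixed:
  assumes "\<And>x z. T w x z = 0" "\<And>x z. T x w z = 0" and "g \<in> G"
  shows "g (0, 0, w) = (0, 0, w)"
proof -
  have "exp_plus J x (0, 0, w) = (0, 0, w)" "exp_minus J y (0, 0, w) = (0, 0, w)" for x y
    using exp_plus_eq[of 0 0 x 0 w] exp_minus_eq[of 0 0 y 0 w] assms(1,2) degree0_closed(3)
    by (simp_all add: zero_prod_def D_eq quad_op_def fun_eq_iff)
  with assms(3) show ?thesis
    by (induction rule: el_group_induct) (simp_all add: amb_one amb_mult)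
qed

text \<open>The middle argument of the product on V^+ comes from V^-, so these are the elements of
  V^- acting trivially on V^+. As outer arguments, in the product on V^-, they may still act
  nontrivially.\<close>

definition degenerate :: "'v set" where "degenerate = {w. \<forall>x z. T x w z = 0}"

text \<open>The ideal of the Lie algebra generated by the degenerate part of \<open>V\<^sup>-\<close> avoids degree 1.\<close>

definition degenerate_ideal :: "('v, 'v) tkk set" where
  "degenerate_ideal =
    {v \<in> L. \<exists>M w. v = (0, (0, M), w) \<and> w \<in> degenerate \<and> range M \<subseteq> degenerate}"

text \<open>In the Jordan identity for \<open>T x w\<close> applied to \<open>T u z v\<close>, every
  term with \<open>w\<close> in the middle vanishes, which leaves only
  \<open>T u (T w x z) v\<close>.\<close>

lemma degenerate_T:
  assumes "w \<in> degenerate"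
  shows "T w x z \<in> degenerate"
proof -
  have "T u (T w x z) v = 0" for u v
    using jordan_identity[of x w u z v] assms by (simp add: degenerate_def)
  thus ?thesis by (simp add: degenerate_def)
qed

text \<open>It suffices to follow the two exponentials. Neither creates a degree 1 component,
  because \<open>Q x w = 0\<close>, and the new terms \<open>T w x z\<close> and \<open>M x\<close>
  are again degenerate.\<close>

lemma degenerate_ideal_stable:
  assumes "v \<in> degenerate_ideal" "g \<in> G"
  shows "g v \<in> degenerate_ideal"
proof -
  have diff: "w - w' \<in> degenerate" if "w \<in> degenerate" "w' \<in> degenerate" for w w'
    using that by (simp add: degenerate_def T_diff)
  have step: "exp_plus J x v \<in> degenerate_ideal \<and> exp_minus J x v \<in> degenerate_ideal"
    if v: "v \<in> degenerate_ideal" for x v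
  proof -
    obtain M w where vL: "v \<in> L"
      and vw: "v = (0, (0, M), w)" "w \<in> degenerate" "range M \<subseteq> degenerate"
      using v by (auto simp: degenerate_ideal_def)
    have M: "(0, M) \<in> degree0 J" using vL vw by simp
    have "exp_plus J x v = (0, (0, \<lambda>z. M z - T w x z), w)"
      using vw by (simp add: exp_plus_eq[OF M] quad_op_def degenerate_def D_eq fun_eq_iff)
    moreover have "exp_minus J x v = (0, (0, M), w - M x)"
      using vw by (simp add: exp_minus_eq[OF M] zero_prod_def)
    moreover have "exp_plus J x v \<in> L" "exp_minus J x v \<in> L" using vL by auto
    moreover have "range (\<lambda>z. M z - T w x z) \<subseteq> degenerate" "w - M x \<in> degenerate"
      using degenerate_T diff vw by blast+
    ultimately show ?thesis using vw unfolding degenerate_ideal_def by auto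
  qed
  have vL: "v \<in> L" using assms by (simp add: degenerate_ideal_def)
  show ?thesis
    using \<open>g \<in> G\<close>
    by (induction rule: el_group_induct) (simp_all add: amb_one amb_mult vL step assms(1))
qed

lemma euler_rigid:
  assumes g: "g \<in> G" and gE: "g E = (0, (\<lambda>x. x, B), y)"
  shows "B = (\<lambda>z. - z)"
proof -
  define N where "N = (\<lambda>z. B z + z)"
  have B: "B z = N z - z" for z by (simp add: N_def)
  have AB: "(\<lambda>x. x, B) \<in> degree0 J" using G_L[OF g E_in_L] by (simp add: gE)
  have "(\<lambda>x. x, B) - e0 \<in> degree0 J" using AB by blast
  also have "(\<lambda>x. x, B) - e0 = (0, N)" by (simp add: e0_def N_def fun_eq_iff)
  finally have N: "(0, N) \<in> degree0 J" .
  note lin = degree0_linear[OF N]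
  \<comment> \<open>The counterpart of \<open>N\<close> on V^+ is 0. Hence the Leibniz rule on V^+
    makes the image of \<open>N\<close> degenerate, and on V^- only the outer arguments are
    differentiated.\<close>
  have TN [simp]: "T x (N z) w = 0" for x z w using degree0D(3)[OF N, of x z w] by simp
  have NT: "N (T x y z) = T (N x) y z + T x y (N z)" for x y z
    using degree0D(4)[OF N, of x y z] by simp
  have br_V: "br (g E) (0, 0, w) = (0, 0, B w)" for w
    by (simp add: gE br_eq zero_prod_def fun_eq_iff B lin)
  have br_D: "br (g E) (0, D x w, q) = (0, D x (N w), B q + T w x y)" for x w q
    by (simp add: gE D_eq br_eq zero_prod_def fun_eq_iff B lin NT T_diff)
  \<comment> \<open>With B = N - 1, the identity B^3 = B reads N^3 + 2N = 3N^2.\<close>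
  have N3: "N (N (N w)) + (N w + N w) = N (N w) + N (N w) + N (N w)" for w
    using br_GE_cube[OF g, of "(0, 0, w)"] by (simp add: br_V B lin algebra_simps)
  \<comment> \<open>Such a \<open>w\<close> is fixed by \<open>g\<close>, so it keeps its eigenvalue
    -1 when \<open>E\<close> is replaced by \<open>g E\<close>; thus
    \<open>B w = - w\<close>.\<close>
  have fixN: "N w = 0" if "\<And>x z. T w x z = 0" "\<And>x z. T x w z = 0" for w
  proof -
    have "g (0, 0, w) = (0, 0, w)" using annihilator_fixed that g by blast
    moreover have "br E (0, 0, w) = - (0, 0, w)" by (simp add: br_E)
    moreover have "(0, 0, w) \<in> L" by simp
    ultimately have "br (g E) (0, 0, w) = - (0, 0, w)" using g by (metis G_br G_neg E_in_L)
    thus ?thesis by (simp add: br_V B)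
  qed
  \<comment> \<open>The cubic identity on \<open>D x w\<close> gives N^3 = N inside the first
    argument of \<open>T\<close>; with \<open>N3\<close>, three times
    \<open>T (N (N w) - N w) x z\<close> is 0. So \<open>fixN\<close> applies to
    \<open>N (N w) - N w\<close>, giving N^3 = N^2, and \<open>N3\<close> becomes 2(N^2 - N) =
    0.\<close>
  have NN: "N (N w) = N w" for w
  proof -
    have "T (N (N (N w))) x z = T (N w) x z" for x z
      using br_GE_cube[OF g, of "(0, D x w, 0)"] by (simp add: br_D) (simp add: D_eq fun_eq_iff)
    moreover have "T (N (N (N w))) x z + (T (N w) x z + T (N w) x z) =
        T (N (N w)) x z + T (N (N w)) x z + T (N (N w)) x z" for x z
      using N3[of w] by (metis T_add(1))
    ultimately have "(T (N (N w)) x z - T (N w) x z) + (T (N (N w)) x z - T (N w) x z) +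
        (T (N (N w)) x z - T (N w) x z) = 0" for x z
      by (simp add: algebra_simps)
    hence "T (N (N w) - N w) x z = 0" for x z unfolding T_diff by (rule triple_zero)
    hence "N (N (N w)) = N (N w)" using fixN[of "N (N w) - N w"] by (simp add: lin T_diff)
    hence "(N (N w) - N w) + (N (N w) - N w) = 0" using N3[of w] by (simp add: algebra_simps)
    hence "N (N w) - N w = 0" by (rule double_zero)
    thus ?thesis by simp
  qed
  have "T (N w) x z = 0" for w x z
  proof -
    \<comment> \<open>By the Leibniz rule and idempotence, \<open>N\<close> doubles this element;
      comparing N^2 with \<open>N\<close> on it then shows that its double is 0.\<close>
    have TNN: "T (N w) x (N z) = 0" for z
    proof -
      have "N (T (N w) x (N z)) = T (N w) x (N z) + T (N w) x (N z)" by (simp add: NT NN)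
      moreover have "N (N (T (N w) x (N z))) = N (T (N w) x (N z))" by (rule NN)
      ultimately have "T (N w) x (N z) + T (N w) x (N z) = 0" by (simp add: lin NT NN)
      thus ?thesis by (rule double_zero)
    qed
    \<comment> \<open>The degree -1 component is chosen so that \<open>f\<close> is fixed by ad
      (\<open>g E\<close>): it is fixed by \<open>N\<close>, so \<open>B\<close> kills it and
      \<open>br_D\<close> reproduces it. Pulled back by \<open>g\<close>, \<open>f\<close> has
      degree 1; yet it lies in the stable ideal without degree 1 component, so it is 0.\<close>
    define f where "f = (0::'v, D x (N w), T (N w) x y)"
    have fL: "f \<in> L" by (simp add: f_def)
    have Nfix: "N (T (N w) x z) = T (N w) x z" for z by (simp add: NT NN TNN)
    have "br (g E) f = f" by (simp add: f_def br_D NN B Nfix)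
    define f' where "f' = (inv\<^bsub>\<A>\<^esub> g) f"
    have "f' \<in> L" "f = g f'" using g fL by (auto simp: f'_def G_inv)
    have "g (br E f') = g f'"
      using g \<open>f' \<in> L\<close> \<open>br (g E) f = f\<close> \<open>f = g f'\<close> by (simp add: G_br)
    hence "br E f' = f'"
      by (metis G_inv(1) \<open>f' \<in> L\<close> g E_in_L br_closed)
    hence "f' \<in> grade J 1" using \<open>f' \<in> L\<close> by (simp add: grade_iff)
    have "T u (T (N w) x v) z = 0" for u v z using Nfix TN by metis
    hence "f \<in> degenerate_ideal"
      using fL by (auto simp: degenerate_ideal_def degenerate_def f_def D_eq fun_eq_iff)
    hence "f' \<in> degenerate_ideal"
      unfolding f'_def using g by (simp add: degenerate_ideal_stable)
    with \<open>f' \<in> grade J 1\<close> have "f' = 0"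
      by (auto simp: grade_def degenerate_ideal_def zero_prod_def)
    hence "f = 0" using \<open>f = g f'\<close> g by (simp add: G_zero)
    thus ?thesis by (auto simp: f_def D_eq zero_prod_def fun_eq_iff)
  qed
  hence "N (N w) = 0" for w by (rule fixN) (rule TN)
  hence "N w = 0" for w by (simp only: NN)
  thus ?thesis by (intro ext) (simp only: B, simp)
qed

lemma P_minus_subgroup: "subgroup (P_minus J) \<A>"
proof (rule amb.subgroupI)
  show "P_minus J \<subseteq> carrier \<A>" by (auto simp: P_minus_iff)
  have "\<one>\<^bsub>\<A>\<^esub> \<in> P_minus J" by (auto simp: P_minus_iff amb_one E_def)
  thus "P_minus J \<noteq> {}" by blast
next
  fix g h assume "g \<in> P_minus J" "h \<in> P_minus J"
  then obtain y y' where *: "g \<in> G" "h \<in> G" "g E = (0, e0, y)" "h E = (0, e0, y')"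
    by (auto simp: P_minus_iff)
  obtain v where v: "g (0, 0, y') = (0, 0, v)" using P_minus_degree * by blast
  have "h E = E + (0, 0, y')" using * by (simp add: E_def)
  hence "g (h E) = (0, e0, y + v)" using * v by (simp add: G_add)
  thus "g \<otimes>\<^bsub>\<A>\<^esub> h \<in> P_minus J" using * by (auto simp: P_minus_iff G_mult)
next
  fix g assume "g \<in> P_minus J"
  \<comment> \<open>The factorization helps with the inverse: that of \<open>h\<close> fixes
    \<open>E\<close> and preserves degree -1, so the inverse of \<open>g\<close> moves
    \<open>E\<close> only by the image of \<open>- y\<close>.\<close>
  then obtain y h where gh: "g = exp_minus J y \<otimes>\<^bsub>\<A>\<^esub> h" "h \<in> H_group J"
    by (auto simp: P_minus_def set_mult_def)
  let ?h = "inv\<^bsub>\<A>\<^esub> h"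
  have h: "h \<in> G" "?h \<in> G" "?h E = (0, e0, 0)"
    using gh(2) G_inv(1)[of h E] by (auto simp: H_iff E_def)
  obtain v where v: "?h (0, 0, - y) = (0, 0, v)" using P_minus_degree h by blast
  have "inv\<^bsub>\<A>\<^esub> g = ?h \<otimes>\<^bsub>\<A>\<^esub> exp_minus J (- y)"
    using h by (simp add: gh amb.inv_mult_group)
  moreover have "exp_minus J (- y) E = E + (0, 0, - y)" unfolding exp_E by (simp add: E_def)
  ultimately have "(inv\<^bsub>\<A>\<^esub> g) E = (0, e0, v)" "inv\<^bsub>\<A>\<^esub> g \<in> G"
    using h v by (simp_all add: G_mult G_add)
  thus "inv\<^bsub>\<A>\<^esub> g \<in> P_minus J" by (auto simp: P_minus_iff)
qed

lemma P_plus_subgroup: "subgroup (P_plus J) \<A>"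
proof (rule amb.subgroupI)
  show "P_plus J \<subseteq> carrier \<A>" by (auto simp: P_plus_iff)
  have "\<one>\<^bsub>\<A>\<^esub> \<in> P_plus J" by (auto simp: P_plus_iff amb_one E_def)
  thus "P_plus J \<noteq> {}" by blast
next
  fix g h assume "g \<in> P_plus J" "h \<in> P_plus J"
  then obtain x x' where *: "g \<in> G" "h \<in> G" "g E = (x, e0, 0)" "h E = (x', e0, 0)"
    by (auto simp: P_plus_iff)
  obtain v where v: "g (x', 0, 0) = (v, 0, 0)" using P_plus_degree * by blast
  have "h E = E + (x', 0, 0)" using * by (simp add: E_def)
  hence "g (h E) = (x + v, e0, 0)" using * v by (simp add: G_add)
  thus "g \<otimes>\<^bsub>\<A>\<^esub> h \<in> P_plus J" using * by (auto simp: P_plus_iff G_mult)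
next
  fix g assume "g \<in> P_plus J"
  then obtain x h where gh: "g = exp_plus J x \<otimes>\<^bsub>\<A>\<^esub> h" "h \<in> H_group J"
    by (auto simp: P_plus_def set_mult_def)
  let ?h = "inv\<^bsub>\<A>\<^esub> h"
  have h: "h \<in> G" "?h \<in> G" "?h E = (0, e0, 0)"
    using gh(2) G_inv(1)[of h E] by (auto simp: H_iff E_def)
  obtain v where v: "?h (x, 0, 0) = (v, 0, 0)" using P_plus_degree h by blast
  have "inv\<^bsub>\<A>\<^esub> g = ?h \<otimes>\<^bsub>\<A>\<^esub> exp_plus J (- x)"
    using h by (simp add: gh amb.inv_mult_group)
  moreover have "exp_plus J (- x) E = E + (x, 0, 0)" unfolding exp_E by (simp add: E_def)
  ultimately have "(inv\<^bsub>\<A>\<^esub> g) E = (v, e0, 0)" "inv\<^bsub>\<A>\<^esub> g \<in> G"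
    using h v by (simp_all add: G_mult G_add)
  thus "inv\<^bsub>\<A>\<^esub> g \<in> P_plus J" by (auto simp: P_plus_iff)
qed

section \<open>Points as cosets\<close>

abbreviation act (infixr "\<cdot>" 75) where "g \<cdot> \<xi> \<equiv> g <#\<^bsub>\<A>\<^esub> \<xi>"

lemma o_plus_eq: "o_plus J = P_minus J" and o_minus_eq: "o_minus J = P_plus J"
  using subgroup.subset[OF P_minus_subgroup] subgroup.subset[OF P_plus_subgroup]
  by (simp_all add: o_plus_def o_minus_def amb.lcos_mult_one)

lemma points_carrier: "\<xi> \<in> X_plus J \<Longrightarrow> \<xi> \<subseteq> carrier \<A>" "\<xi> \<in> X_minus J \<Longrightarrow> \<xi> \<subseteq> carrier \<A>"
  "o_plus J \<subseteq> carrier \<A>" "o_minus J \<subseteq> carrier \<A>"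
  using subgroup.subset[OF P_minus_subgroup] subgroup.subset[OF P_plus_subgroup]
    amb.l_coset_subset_G[OF subgroup.subset[OF P_minus_subgroup] G_carrier]
    amb.l_coset_subset_G[OF subgroup.subset[OF P_plus_subgroup] G_carrier]
  unfolding X_plus_def X_minus_def o_plus_eq o_minus_eq by blast+

lemma act_assoc [simp]:
  assumes "g \<in> G" "h \<in> G"
  shows "g \<cdot> h \<cdot> o_plus J = (g \<otimes>\<^bsub>\<A>\<^esub> h) \<cdot> o_plus J" "g \<cdot> h \<cdot> o_minus J = (g \<otimes>\<^bsub>\<A>\<^esub> h) \<cdot> o_minus J"
  using assms points_carrier(3,4) by (simp_all add: amb.lcos_m_assoc)

lemma coset_plus_eq_iff:
  assumes "g \<in> G" "h \<in> G"
  shows "g \<cdot> o_plus J = h \<cdot> o_plus J \<longleftrightarrow> (\<exists>y. (inv\<^bsub>\<A>\<^esub> g) (h E) = (0, e0, y))"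
  using amb.l_coset_eq_iff[OF P_minus_subgroup] assms by (simp add: o_plus_eq P_minus_iff G_mult)

lemma coset_minus_eq_iff:
  assumes "g \<in> G" "h \<in> G"
  shows "g \<cdot> o_minus J = h \<cdot> o_minus J \<longleftrightarrow> (\<exists>x. (inv\<^bsub>\<A>\<^esub> g) (h E) = (x, e0, 0))"
  using amb.l_coset_eq_iff[OF P_plus_subgroup] assms by (simp add: o_minus_eq P_plus_iff G_mult)

lemma X_plus_iff: "\<xi> \<in> X_plus J \<longleftrightarrow> (\<exists>g\<in>G. \<xi> = g \<cdot> o_plus J)"
  and X_minus_iff: "\<xi> \<in> X_minus J \<longleftrightarrow> (\<exists>g\<in>G. \<xi> = g \<cdot> o_minus J)"
  by (auto simp: X_plus_def X_minus_def o_plus_eq o_minus_eq)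

end

section \<open>Affine charts and transversality\<close>

context jts_sixth
begin

lemma act_act [simp]: "\<xi> \<subseteq> carrier \<A> \<Longrightarrow> g \<in> G \<Longrightarrow> h \<in> G \<Longrightarrow> g \<cdot> h \<cdot> \<xi> = (g \<otimes>\<^bsub>\<A>\<^esub> h) \<cdot> \<xi>"
  by (simp add: amb.lcos_m_assoc)

lemma act_one [simp]: "\<xi> \<subseteq> carrier \<A> \<Longrightarrow> \<one>\<^bsub>\<A>\<^esub> \<cdot> \<xi> = \<xi>"
  by (rule amb.lcos_mult_one)

lemma act_cancel:
  assumes "\<xi> \<subseteq> carrier \<A>" "\<eta> \<subseteq> carrier \<A>" "g \<in> G" "h \<in> G" "g \<cdot> \<xi> = h \<cdot> \<eta>"
  shows "\<xi> = (inv\<^bsub>\<A>\<^esub> g \<otimes>\<^bsub>\<A>\<^esub> h) \<cdot> \<eta>"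
proof -
  have "\<xi> = inv\<^bsub>\<A>\<^esub> g \<cdot> g \<cdot> \<xi>" using assms(1,3) by simp
  also have "\<dots> = (inv\<^bsub>\<A>\<^esub> g \<otimes>\<^bsub>\<A>\<^esub> h) \<cdot> \<eta>"
    unfolding assms(5) using assms(2-4) by (simp only: act_act G_closed)
  finally show ?thesis .
qed

lemmas o_carrier [simp, intro] = points_carrier(3,4)

lemma affine_carrier [simp, intro]: "affine_plus J x \<subseteq> carrier \<A>" "affine_minus J x \<subseteq> carrier \<A>"
  by (simp_all add: affine_plus_def affine_minus_def amb.l_coset_subset_G)

text \<open>The quotient of \<open>g\<close> and \<open>h\<close> fixes \<open>E\<close> and
  therefore lies in both parabolic subgroups.\<close>

lemma coset_eqI:
  assumes "g \<in> G" "h \<in> G" "g E = h E"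
  shows "g \<cdot> o_plus J = h \<cdot> o_plus J" "g \<cdot> o_minus J = h \<cdot> o_minus J"
  unfolding coset_plus_eq_iff[OF assms(1,2)] coset_minus_eq_iff[OF assms(1,2)]
  using assms G_inv(1)[of g E] by (auto simp: E_def)

lemma affine_inj [simp]:
  "affine_plus J x = affine_plus J y \<longleftrightarrow> x = y" "affine_minus J x = affine_minus J y \<longleftrightarrow> x = y"
proof -
  have e: "(\<lambda>x. x, uminus) \<in> degree0 J" using degree0_closed(1) by (simp add: e0_def)
  show "affine_plus J x = affine_plus J y \<longleftrightarrow> x = y"
    by (simp add: affine_plus_def coset_plus_eq_iff exp_E)
      (auto simp: e0_def exp_plus_eq[OF e])
  show "affine_minus J x = affine_minus J y \<longleftrightarrow> x = y"
    by (simp add: affine_minus_def coset_minus_eq_iff exp_E)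
      (auto simp: e0_def exp_minus_eq[OF e])
qed

lemma affine_zero: "affine_plus J 0 = o_plus J" "affine_minus J 0 = o_minus J"
proof -
  have "exp_plus J 0 E = \<one>\<^bsub>\<A>\<^esub> E" "exp_minus J 0 E = \<one>\<^bsub>\<A>\<^esub> E"
    by (simp_all only: exp_E amb_one E_in_L) (simp_all add: E_def)
  hence "exp_plus J 0 \<cdot> o_plus J = \<one>\<^bsub>\<A>\<^esub> \<cdot> o_plus J" "exp_minus J 0 \<cdot> o_minus J = \<one>\<^bsub>\<A>\<^esub> \<cdot> o_minus J"
    using coset_eqI by blast+
  thus "affine_plus J 0 = o_plus J" "affine_minus J 0 = o_minus J"
    by (simp_all add: affine_plus_def affine_minus_def)
qed

text \<open>Such a \<open>k\<close> lies in \<open>P_plus\<close> and preserves degree 1, which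
  gives the linear part; the displacement of \<open>E\<close> under \<open>k\<close> gives the
  translation. The sign comes from \<open>exp_plus J u\<close> sending \<open>E\<close> to
  \<open>E - (u, 0, 0)\<close>.\<close>

lemma stabilizer_affine_plus:
  assumes k: "k \<in> G" and "k \<cdot> o_minus J = o_minus J"
  shows "\<exists>l z. module_hom sc sc l \<and> (\<forall>u. k \<cdot> affine_plus J u = affine_plus J (l u + z))"
proof -
  have "\<one>\<^bsub>\<A>\<^esub> \<cdot> o_minus J = k \<cdot> o_minus J" using assms by simp
  then obtain x where x: "k E = (x, e0, 0)"
    using coset_minus_eq_iff[of "\<one>\<^bsub>\<A>\<^esub>" k] k by (auto simp: amb_one)
  define l where "l = (\<lambda>u. fst (k (u, 0, 0)))"
  have l: "k (u, 0, 0) = (l u, 0, 0)" for u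
    using P_plus_degree[OF k x, of u] by (auto simp: l_def)
  have "k ((u, 0, 0) + (v, 0, 0)) = k (u, 0, 0) + k (v, 0, 0)" for u v
    using k by (intro G_add) auto
  hence add: "l (u + v) = l u + l v" for u v by (simp add: l)
  have "k (lie_scale J r (u, 0, 0)) = lie_scale J r (k (u, 0, 0))" for r u
    using k by (intro G_scale) auto
  hence "l (sc r u) = sc r (l u)" for r u by (simp add: l lie_scale_eq)
  hence "module_hom sc sc l" using add by (intro module_homI)
  moreover have "k \<cdot> affine_plus J u = affine_plus J (l u + - x)" for u
  proof -
    have "exp_plus J u E = E - (u, 0, 0)" unfolding exp_E by (simp add: E_def)
    hence "(k \<otimes>\<^bsub>\<A>\<^esub> exp_plus J u) E = (x - l u, e0, 0)"
      using k x l[of u] by (simp add: G_mult G_diff)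
    also have "\<dots> = exp_plus J (l u + - x) E" by (simp add: exp_E)
    finally show ?thesis using k by (simp add: affine_plus_def coset_eqI)
  qed
  ultimately show ?thesis by blast
qed

lemma stabilizer_affine_minus:
  assumes k: "k \<in> G" and "k \<cdot> o_plus J = o_plus J"
  shows "\<exists>l z. module_hom sc sc l \<and> (\<forall>u. k \<cdot> affine_minus J u = affine_minus J (l u + z))"
proof -
  have "\<one>\<^bsub>\<A>\<^esub> \<cdot> o_plus J = k \<cdot> o_plus J" using assms by simp
  then obtain y where y: "k E = (0, e0, y)"
    using coset_plus_eq_iff[of "\<one>\<^bsub>\<A>\<^esub>" k] k by (auto simp: amb_one)
  define l where "l = (\<lambda>u. snd (snd (k (0, 0, u))))"
  have l: "k (0, 0, u) = (0, 0, l u)" for u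
    using P_minus_degree[OF k y, of u] by (auto simp: l_def)
  have "k ((0, 0, u) + (0, 0, v)) = k (0, 0, u) + k (0, 0, v)" for u v
    using k by (intro G_add) auto
  hence add: "l (u + v) = l u + l v" for u v by (simp add: l)
  have "k (lie_scale J r (0, 0, u)) = lie_scale J r (k (0, 0, u))" for r u
    using k by (intro G_scale) auto
  hence "l (sc r u) = sc r (l u)" for r u by (simp add: l lie_scale_eq)
  hence "module_hom sc sc l" using add by (intro module_homI)
  moreover have "k \<cdot> affine_minus J u = affine_minus J (l u + - y)" for u
  proof -
    have "exp_minus J (- u) E = E - (0, 0, u)" unfolding exp_E by (simp add: E_def)
    hence "(k \<otimes>\<^bsub>\<A>\<^esub> exp_minus J (- u)) E = (0, e0, y - l u)"
      using k y l[of u] by (simp add: G_mult G_diff)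
    also have "\<dots> = exp_minus J (- (l u + - y)) E" by (simp add: exp_E)
    finally show ?thesis using k by (simp add: affine_minus_def coset_eqI)
  qed
  ultimately show ?thesis by blast
qed

text \<open>Two group elements that agree on \<open>b\<close> differ by an element of its
  stabilizer. By \<open>stab\<close> this acts by an affine map of the chart, which preserves
  combinations with coefficient sum 1. Stating it for an abstract chart covers both signs.\<close>

lemma the_affine_combination:
  assumes sub: "\<And>u. aff u \<subseteq> carrier \<A>" "b \<subseteq> carrier \<A>"
    and inj: "\<And>u v. aff u = aff v \<longleftrightarrow> u = v"
    and stab: "\<And>k. k \<in> G \<Longrightarrow> k \<cdot> b = b \<Longrightarrow>
      \<exists>l z. module_hom sc sc l \<and> (\<forall>u. k \<cdot> aff u = aff (l u + z))"
    and g: "g \<in> G"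
  shows "(THE q. \<exists>h\<in>G. \<exists>u' v' w'. g \<cdot> b = h \<cdot> b \<and> g \<cdot> aff u = h \<cdot> aff u' \<and>
      g \<cdot> aff v = h \<cdot> aff v' \<and> g \<cdot> aff w = h \<cdot> aff w' \<and>
      q = h \<cdot> aff (sc (1 - r - s) u' + sc r v' + sc s w')) =
    g \<cdot> aff (sc (1 - r - s) u + sc r v + sc s w)"
proof (rule the_equality)
  show "\<exists>h\<in>G. \<exists>u' v' w'. g \<cdot> b = h \<cdot> b \<and> g \<cdot> aff u = h \<cdot> aff u' \<and>
      g \<cdot> aff v = h \<cdot> aff v' \<and> g \<cdot> aff w = h \<cdot> aff w' \<and>
      g \<cdot> aff (sc (1 - r - s) u + sc r v + sc s w) =
      h \<cdot> aff (sc (1 - r - s) u' + sc r v' + sc s w')"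
    using g by blast
next
  fix q assume "\<exists>h\<in>G. \<exists>u' v' w'. g \<cdot> b = h \<cdot> b \<and> g \<cdot> aff u = h \<cdot> aff u' \<and>
      g \<cdot> aff v = h \<cdot> aff v' \<and> g \<cdot> aff w = h \<cdot> aff w' \<and>
      q = h \<cdot> aff (sc (1 - r - s) u' + sc r v' + sc s w')"
  then obtain h u' v' w' where h: "h \<in> G" "g \<cdot> b = h \<cdot> b" "g \<cdot> aff u = h \<cdot> aff u'"
      "g \<cdot> aff v = h \<cdot> aff v'" "g \<cdot> aff w = h \<cdot> aff w'"
    and q: "q = h \<cdot> aff (sc (1 - r - s) u' + sc r v' + sc s w')"
    by blast
  define k where "k = inv\<^bsub>\<A>\<^esub> g \<otimes>\<^bsub>\<A>\<^esub> h"
  have k: "k \<in> G" "k \<cdot> b = b" using act_cancel[OF sub(2,2) g h(1,2)] g h by (simp_all add: k_def)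
  then obtain l z where l: "module_hom sc sc l" "\<And>u. k \<cdot> aff u = aff (l u + z)" using stab by blast
  have uvw: "u = l u' + z" "v = l v' + z" "w = l w' + z"
    using act_cancel[OF sub(1,1) g h(1,3)] act_cancel[OF sub(1,1) g h(1,4)]
      act_cancel[OF sub(1,1) g h(1,5)] by (simp_all add: l inj flip: k_def)
  have "g \<otimes>\<^bsub>\<A>\<^esub> k = h" using g h by (simp add: k_def flip: amb.m_assoc)
  hence "q = g \<cdot> k \<cdot> aff (sc (1 - r - s) u' + sc r v' + sc s w')"
    using g k sub by (simp add: q)
  also have "\<dots> = g \<cdot> aff (sc (1 - r - s) (l u') + sc r (l v') + sc s (l w') + z)"
    by (simp add: l module_hom.add[OF l(1)] module_hom.scale[OF l(1)])
  also have "sc (1 - r - s) (l u') + sc r (l v') + sc s (l w') + z =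
      sc (1 - r - s) u + sc r v + sc s w"
    unfolding uvw by (simp add: scale_right_distrib scale_left_diff_distrib algebra_simps)
  finally show "q = g \<cdot> aff (sc (1 - r - s) u + sc r v + sc s w)" .
qed

lemma comb_in_plus_eq:
  "g \<in> G \<Longrightarrow> comb_in_plus J (g \<cdot> o_minus J) r s (g \<cdot> affine_plus J u) (g \<cdot> affine_plus J v)
      (g \<cdot> affine_plus J w) = g \<cdot> affine_plus J (sc (1 - r - s) u + sc r v + sc s w)"
  using the_affine_combination[of "affine_plus J" "o_minus J"] stabilizer_affine_plus
  by (simp add: comb_in_plus_def)

lemma comb_in_minus_eq:
  "g \<in> G \<Longrightarrow> comb_in_minus J (g \<cdot> o_plus J) r s (g \<cdot> affine_minus J u) (g \<cdot> affine_minus J v)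
      (g \<cdot> affine_minus J w) = g \<cdot> affine_minus J (sc (1 - r - s) u + sc r v + sc s w)"
  using the_affine_combination[of "affine_minus J" "o_plus J"] stabilizer_affine_minus
  by (simp add: comb_in_minus_def)

text \<open>The element \<open>h\<close> realizing transversality differs from \<open>g\<close> by a
  stabilizer of \<open>o_minus\<close>, which keeps the base point inside the affine part.\<close>

lemma transversal_chart_plus:
  assumes g: "g \<in> G" and "transversal J \<xi> (g \<cdot> o_minus J)"
  shows "\<exists>u. \<xi> = g \<cdot> affine_plus J u"
proof -
  obtain h where h: "h \<in> G" "\<xi> = h \<cdot> o_plus J" "g \<cdot> o_minus J = h \<cdot> o_minus J"
    using assms by (auto simp: transversal_def)
  define k where "k = inv\<^bsub>\<A>\<^esub> g \<otimes>\<^bsub>\<A>\<^esub> h"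
  have k: "k \<in> G" "k \<cdot> o_minus J = o_minus J"
    using act_cancel[OF _ _ g h(1,3)] g h by (simp_all add: k_def)
  then obtain v where "k \<cdot> o_plus J = affine_plus J v"
    using stabilizer_affine_plus[OF k] affine_zero by metis
  moreover have "g \<otimes>\<^bsub>\<A>\<^esub> k = h" using g h by (simp add: k_def flip: amb.m_assoc)
  ultimately have "\<xi> = g \<cdot> affine_plus J v" using g k h by (metis act_assoc(1))
  thus ?thesis by blast
qed

lemma transversal_chart_minus:
  assumes g: "g \<in> G" and "transversal J (g \<cdot> o_plus J) \<xi>"
  shows "\<exists>u. \<xi> = g \<cdot> affine_minus J u"
proof -
  obtain h where h: "h \<in> G" "\<xi> = h \<cdot> o_minus J" "g \<cdot> o_plus J = h \<cdot> o_plus J"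
    using assms by (auto simp: transversal_def)
  define k where "k = inv\<^bsub>\<A>\<^esub> g \<otimes>\<^bsub>\<A>\<^esub> h"
  have k: "k \<in> G" "k \<cdot> o_plus J = o_plus J"
    using act_cancel[OF _ _ g h(1,3)] g h by (simp_all add: k_def)
  then obtain v where "k \<cdot> o_minus J = affine_minus J v"
    using stabilizer_affine_minus[OF k] affine_zero by metis
  moreover have "g \<otimes>\<^bsub>\<A>\<^esub> k = h" using g h by (simp add: k_def flip: amb.m_assoc)
  ultimately have "\<xi> = g \<cdot> affine_minus J v" using g k h by (metis act_assoc(2))
  thus ?thesis by blast
qed

text \<open>The three components of the inner exponential applied to \<open>v\<close> contribute
  \<open>v\<close>, \<open>- T x y v\<close> and \<open>Q x (Q y v)\<close> to degree 1.\<close>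

lemma bergman_block:
  "\<exists>c q. (exp_plus J (- x) \<otimes>\<^bsub>\<A>\<^esub> exp_minus J y) (v, 0, 0) = (bergman sc T x y v, c, q)"
proof -
  have "- D v y \<in> degree0 J" by blast
  hence "(- T v y, \<lambda>z. T y v z) \<in> degree0 J" by (simp add: D_eq fun_Compl_def)
  from exp_plus_eq[OF this, of "- x" v "- Q y v"] show ?thesis
    using exp_minus_eq[of 0 0 y v 0] degree0_closed(3)
    by (auto simp: G_mult zero_prod_def D_eq bergman_def symmetric[of x y v] fun_Compl_def
        fun_diff_def zero_fun_def)
qed

text \<open>
  In the converse direction, \<open>z\<close> is chosen such that the transported Euler element has no component
  in degree 1; invertibility of the Bergman operator then forces its degree 0
  component to act as the identity on \<open>V\<^sup>+\<close>, and rigidity does the rest.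
\<close>

lemma transversal_affine_iff:
  "transversal J (affine_plus J x) (affine_minus J a) \<longleftrightarrow> bij (bergman sc T x (- a))"
proof
  let ?u = "exp_plus J (- x) \<otimes>\<^bsub>\<A>\<^esub> exp_minus J (- a)"
  {
    assume "transversal J (affine_plus J x) (affine_minus J a)"
    then obtain z where "affine_plus J x = exp_minus J (- a) \<cdot> affine_plus J z"
      using transversal_chart_plus[of "exp_minus J (- a)"] by (auto simp: affine_minus_def)
    hence "exp_plus J x \<cdot> o_plus J = (exp_minus J (- a) \<otimes>\<^bsub>\<A>\<^esub> exp_plus J z) \<cdot> o_plus J"
      by (simp add: affine_plus_def)
    then obtain w where "exp_plus J (- x) ((exp_minus J (- a) \<otimes>\<^bsub>\<A>\<^esub> exp_plus J z) E) = (0, e0, w)"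
      using coset_plus_eq_iff by auto
    hence "(?u \<otimes>\<^bsub>\<A>\<^esub> exp_plus J z) E = (0, e0, w)" by (simp add: G_mult)
    hence "?u \<otimes>\<^bsub>\<A>\<^esub> exp_plus J z \<in> P_minus J" by (auto simp: P_minus_iff)
    \<comment> \<open>In this factorization \<open>exp_plus J z\<close> fixes degree 1 and
      \<open>exp_minus J y\<close> does not change degree 1 components. Hence \<open>h\<close>,
      which maps degree 1 bijectively onto itself, acts there by the Bergman operator.\<close>
    then obtain y h where yh: "?u \<otimes>\<^bsub>\<A>\<^esub> exp_plus J z = exp_minus J y \<otimes>\<^bsub>\<A>\<^esub> h" "h \<in> H_group J"
      by (auto simp: P_minus_def set_mult_def)
    have h: "h \<in> G" "h E = (0, e0, 0)" using yh(2) by (auto simp: H_iff E_def)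
    have hB: "h (v, 0, 0) = (bergman sc T x (- a) v, 0, 0)" for v
    proof -
      obtain v' where v': "h (v, 0, 0) = (v', 0, 0)" using P_plus_degree[OF h] by blast
      have zero: "(0, 0) \<in> degree0 J" using degree0_closed(3) by (simp add: zero_prod_def)
      have "exp_plus J z (v, 0, 0) = (v, 0, 0)"
        using exp_plus_eq[OF zero, of z v 0] by (simp add: zero_prod_def)
      hence "?u (v, 0, 0) = exp_minus J y (v', 0, 0)"
        using arg_cong[OF yh(1), of "\<lambda>g. g (v, 0, 0)"] h v' by (simp add: G_mult)
      also have "fst \<dots> = v'" using exp_minus_eq[OF zero, of y v' 0] by (simp add: zero_prod_def)
      finally show ?thesis using bergman_block[of x "- a" v] v' by auto
    qed
    have "inj (bergman sc T x (- a))"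
    proof (rule injI)
      fix v v' assume "bergman sc T x (- a) v = bergman sc T x (- a) v'"
      hence "h (v, 0, 0) = h (v', 0, 0)" by (simp add: hB)
      hence "(inv\<^bsub>\<A>\<^esub> h) (h (v, 0, 0)) = (inv\<^bsub>\<A>\<^esub> h) (h (v', 0, 0))" by simp
      thus "v = v'" using h(1) by (simp add: G_inv)
    qed
    moreover have "\<exists>v. v' = bergman sc T x (- a) v" for v'
    proof -
      have "(v', 0, 0) \<in> h ` grade J 1" using yh(2) by (auto simp: H_group_def grade_def)
      then obtain v where "(v', 0, 0) = h (v, 0, 0)" by (auto simp: grade_def)
      thus ?thesis by (auto simp: hB)
    qed
    ultimately show "bij (bergman sc T x (- a))" by (auto simp: bij_def surj_def)
  }
  assume bij: "bij (bergman sc T x (- a))"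
  obtain z where z: "fst (?u E) = bergman sc T x (- a) z" using bij by (metis bij_pointE)
  define k where "k = ?u \<otimes>\<^bsub>\<A>\<^esub> exp_plus J z"
  have k: "k \<in> G" by (simp add: k_def)
  have kv: "k (v, 0, 0) = ?u (v, 0, 0)" for v
    using exp_plus_eq[of 0 0 z v 0] degree0_closed(3) by (simp add: k_def G_mult zero_prod_def)
  have "exp_plus J z E = E - (z, 0, 0)" unfolding exp_E by (simp add: E_def)
  hence "k E = ?u E - ?u (z, 0, 0)" by (simp add: k_def G_mult G_diff)
  moreover have "fst (?u (z, 0, 0)) = fst (?u E)" using bergman_block[of x "- a" z] z by auto
  ultimately have "fst (k E) = 0" by simp
  then obtain A B y where kE: "k E = (0, (A, B), y)" by (metis surj_pair fst_conv)
  have AB: "(A, B) \<in> degree0 J" using G_L[OF k E_in_L] by (simp add: kE)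
  \<comment> \<open>Surjectivity of the Bergman operator makes \<open>v\<close> the degree 1
    component of some \<open>k (v', 0, 0)\<close>. This is an eigenvector of ad (\<open>k E\<close>)
    for the eigenvalue 1, and its degree 1 component gives the claim.\<close>
  have "A v = v" for v
  proof -
    obtain v' where v': "v = bergman sc T x (- a) v'" using bij by (metis bij_pointE)
    obtain C C' q where q: "k (v', 0, 0) = (v, (C, C'), q)"
      using bergman_block[of x "- a" v'] v' kv by (metis surj_pair)
    have "(v', 0, 0) \<in> L" by simp
    hence "(C, C') \<in> degree0 J" using G_L[OF k, of "(v', 0, 0)"] q by simp
    have "br (k E) (k (v', 0, 0)) = k (v', 0, 0)"
      using G_br[OF k E_in_L, of "(v', 0, 0)"] by (simp add: br_E)
    thus ?thesis
      using degree0_linear(9)[OF \<open>(C, C') \<in> degree0 J\<close>] by (simp add: kE q br_eq)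
  qed
  hence "A = (\<lambda>x. x)" by auto
  hence "k E = (0, e0, y)" using euler_rigid[OF k] kE by (simp add: e0_def)
  hence "exp_plus J (- x) ((exp_minus J (- a) \<otimes>\<^bsub>\<A>\<^esub> exp_plus J z) E) = (0, e0, y)"
    by (simp add: k_def G_mult)
  hence "exp_plus J x \<cdot> o_plus J = (exp_minus J (- a) \<otimes>\<^bsub>\<A>\<^esub> exp_plus J z) \<cdot> o_plus J"
    by (subst coset_plus_eq_iff) auto
  moreover have "exp_minus J (- a) \<cdot> o_minus J = (exp_minus J (- a) \<otimes>\<^bsub>\<A>\<^esub> exp_plus J z) \<cdot> o_minus J"
  proof (subst coset_minus_eq_iff)
    show "\<exists>x. (inv\<^bsub>\<A>\<^esub> exp_minus J (- a)) ((exp_minus J (- a) \<otimes>\<^bsub>\<A>\<^esub> exp_plus J z) E) = (x, e0, 0)"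
      using exp_minus_neg[of "exp_plus J z E" "- a"] by (simp add: G_mult) (simp add: exp_E)
  qed auto
  ultimately show "transversal J (affine_plus J x) (affine_minus J a)"
    unfolding transversal_def affine_plus_def affine_minus_def by blast
qed

lemma bergman_GL_iff: "bergman sc T x y \<in> GL sc \<longleftrightarrow> bij (bergman sc T x y)"
  by (auto simp: GL_def bergman_def T_add T_scale scale_right_distrib scale_right_diff_distrib
      intro!: module_homI)

end

section \<open>Geometries covered by charts\<close>

text \<open>
  A geometry covered by the images \<open>cp g\<close>, \<open>cm g\<close> of affine charts under a set of automorphisms,
  such that \<open>(cp g 0, cm g 0)\<close> are the transversal pairs.
\<close>

locale chart_geometry =
  fixes \<X> :: "('k::comm_ring_1, 'x, 'a) geom" and \<G> :: "'g set"
    and cp :: "'g \<Rightarrow> 'p::ab_group_add \<Rightarrow> 'x" and cm :: "'g \<Rightarrow> 'm::ab_group_add \<Rightarrow> 'a"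
    and sp :: "'k \<Rightarrow> 'p \<Rightarrow> 'p" and sm :: "'k \<Rightarrow> 'm \<Rightarrow> 'm"
  assumes pts_plus: "\<xi> \<in> pts_plus \<X> \<longleftrightarrow> (\<exists>g\<in>\<G>. \<xi> = cp g 0)"
    and pts_minus: "\<eta> \<in> pts_minus \<X> \<longleftrightarrow> (\<exists>g\<in>\<G>. \<eta> = cm g 0)"
    and transv: "transv \<X> \<xi> \<eta> \<longleftrightarrow> (\<exists>g\<in>\<G>. \<xi> = cp g 0 \<and> \<eta> = cm g 0)"
    and chart_plus: "g \<in> \<G> \<Longrightarrow> transv \<X> \<xi> (cm g 0) \<Longrightarrow> \<exists>u. \<xi> = cp g u"
    and chart_minus: "g \<in> \<G> \<Longrightarrow> transv \<X> (cp g 0) \<eta> \<Longrightarrow> \<exists>u. \<eta> = cm g u"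
    and comb_plus: "g \<in> \<G> \<Longrightarrow> comb_plus \<X> (cm g 0) r s (cp g u) (cp g v) (cp g w) =
      cp g (sp (1 - r - s) u + sp r v + sp s w)"
    and comb_minus: "g \<in> \<G> \<Longrightarrow> comb_minus \<X> (cp g 0) r s (cm g u') (cm g v') (cm g w') =
      cm g (sm (1 - r - s) u' + sm r v' + sm s w')"
begin

lemma dual: "chart_geometry (dual_geom \<X>) \<G> cm cp sm sp"
  by unfold_locales
    (auto simp: dual_geom_def pts_plus pts_minus comb_plus comb_minus chart_plus chart_minus transv
     intro: chart_plus[unfolded transv] chart_minus[unfolded transv])

text \<open>Transversality and affine combinations are all expressed in charts, so it is enough that
  the maps carry each pair of charts to a pair of charts linearly.\<close>

lemma geom_homI:
  assumes "chart_geometry \<Y> \<G>' cp' cm' sp' sm'" "module_hom sp sp' lp" "module_hom sm sm' lm"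
    and rel: "\<And>g. g \<in> \<G> \<Longrightarrow>
      \<exists>g'\<in>\<G>'. (\<forall>u. f (cp g u) = cp' g' (lp u)) \<and> (\<forall>u. f' (cm g u) = cm' g' (lm u))"
  shows "geom_hom \<X> \<Y> f f'"
proof -
  interpret Y: chart_geometry \<Y> \<G>' cp' cm' sp' sm' by fact
  interpret lp: module_hom sp sp' lp by fact
  interpret lm: module_hom sm sm' lm by fact
  show ?thesis
    unfolding geom_hom_def
  proof (intro conjI ballI allI impI subsetI)
    fix \<eta> assume "\<eta> \<in> f ` pts_plus \<X>"
    then obtain g where "g \<in> \<G>" "\<eta> = f (cp g 0)" by (auto simp: pts_plus)
    thus "\<eta> \<in> pts_plus \<Y>" using rel[of g] by (auto simp: Y.pts_plus)
  next
    fix \<eta> assume "\<eta> \<in> f' ` pts_minus \<X>"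
    then obtain g where "g \<in> \<G>" "\<eta> = f' (cm g 0)" by (auto simp: pts_minus)
    thus "\<eta> \<in> pts_minus \<Y>" using rel[of g] by (auto simp: Y.pts_minus)
  next
    fix x a assume "transv \<X> x a"
    then obtain g where "g \<in> \<G>" "x = cp g 0" "a = cm g 0" by (auto simp: transv)
    thus "transv \<Y> (f x) (f' a)" using rel[of g] by (auto simp: Y.transv)
  next
    fix a x y z r s assume "a \<in> pts_minus \<X>" "transv \<X> x a" "transv \<X> y a" "transv \<X> z a"
    then obtain g u v w where g: "g \<in> \<G>" "a = cm g 0" "x = cp g u" "y = cp g v" "z = cp g w"
      by (metis pts_minus chart_plus)
    obtain g' where "g' \<in> \<G>'" "\<And>u. f (cp g u) = cp' g' (lp u)" "f' (cm g 0) = cm' g' 0"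
      using rel[OF g(1)] lm.zero by metis
    thus "f (geom.comb_plus \<X> a r s x y z) = geom.comb_plus \<Y> (f' a) r s (f x) (f y) (f z)"
      using g by (simp add: comb_plus Y.comb_plus lp.add lp.scale)
  next
    fix x a b c r s assume "x \<in> pts_plus \<X>" "transv \<X> x a" "transv \<X> x b" "transv \<X> x c"
    then obtain g u v w where g: "g \<in> \<G>" "x = cp g 0" "a = cm g u" "b = cm g v" "c = cm g w"
      by (metis pts_plus chart_minus)
    obtain g' where "g' \<in> \<G>'" "\<And>u. f' (cm g u) = cm' g' (lm u)" "f (cp g 0) = cp' g' 0"
      using rel[OF g(1)] lp.zero by metis
    thus "f' (geom.comb_minus \<X> x r s a b c) = geom.comb_minus \<Y> (f x) r s (f' a) (f' b) (f' c)"
      using g by (simp add: comb_minus Y.comb_minus lm.add lm.scale)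
  qed
qed

end

section \<open>Conjugation in a group\<close>

context group
begin

definition conjugate :: "'a \<Rightarrow> 'a \<Rightarrow> 'a" where "conjugate s g = s \<otimes> g \<otimes> inv s"

lemma conjugate_closed [simp, intro]:
  "s \<in> carrier G \<Longrightarrow> g \<in> carrier G \<Longrightarrow> conjugate s g \<in> carrier G"
  by (simp add: conjugate_def)

lemma conjugate_mult:
  assumes "s \<in> carrier G" "g \<in> carrier G" "h \<in> carrier G"
  shows "conjugate s (g \<otimes> h) = conjugate s g \<otimes> conjugate s h"
  using assms by (simp add: conjugate_def m_assoc) (simp add: inv_solve_left' flip: m_assoc)

lemma conjugate_one: "s \<in> carrier G \<Longrightarrow> conjugate s \<one> = \<one>"
  by (simp add: conjugate_def)

lemma conjugate_inv: "s \<in> carrier G \<Longrightarrow> g \<in> carrier G \<Longrightarrow> conjugate s (inv g) = inv (conjugate s g)"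
  by (simp add: conjugate_def inv_mult_group m_assoc)

lemma conjugate_involution:
  assumes "s \<in> carrier G" "g \<in> carrier G" "inv s = s"
  shows "conjugate s (conjugate s g) = g"
proof -
  have "s \<otimes> s = \<one>" using assms r_inv by metis
  thus ?thesis using assms by (simp add: conjugate_def m_assoc) (simp flip: m_assoc)
qed

lemma conjugate_l_coset:
  assumes "s \<in> carrier G" "g \<in> carrier G" "\<xi> \<subseteq> carrier G"
  shows "conjugate s ` (g <# \<xi>) = conjugate s g <# (conjugate s ` \<xi>)"
  using assms conjugate_mult by (force simp: l_coset_def subset_iff)

end

context jts_sixth
begin

lemma chart: "chart_geometry (geometry J) G (\<lambda>g u. g \<cdot> affine_plus J u) (\<lambda>g u. g \<cdot> affine_minus J u)
    sc sc"
  by unfold_locales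
    (auto simp: geometry_def affine_zero X_plus_iff X_minus_iff transversal_def comb_in_plus_eq
      comb_in_minus_eq intro: transversal_chart_plus[unfolded transversal_def]
      transversal_chart_minus[unfolded transversal_def])

section \<open>The exchange involution and the polar map\<close>

lemma degree0_swap:
  assumes "(A, B) \<in> degree0 J"
  shows "(B, A) \<in> degree0 J"
proof -
  define S where "S = {c. (snd c, fst c) \<in> degree0 J}"
  have "degree0 J \<subseteq> S"
    unfolding degree0_def
  proof (rule deg0.span_minimal)
    \<comment> \<open>Swapping the components turns the generators \<open>e0\<close> and
      \<open>D x y\<close> into \<open>- e0\<close> and \<open>- D y x\<close>.\<close>
    have "- e0 \<in> degree0 J" "- D y x \<in> degree0 J" for x y by blast+
    thus "insert (\<lambda>x. x, \<lambda>y. - y) {D x y |x y. True} \<subseteq> S"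
      by (auto simp: S_def e0_def D_eq fun_Compl_def)
    show "deg0.subspace S"
    proof (rule deg0.subspaceI)
      show "0 \<in> S" using degree0_closed(3) by (simp add: S_def zero_prod_def)
    next
      fix c d assume "c \<in> S" "d \<in> S"
      thus "c + d \<in> S" using degree0_closed(4) by (fastforce simp: S_def)
    next
      fix c r assume "c \<in> S"
      thus "scale0 J r c \<in> S"
        using degree0_closed(7)[of "(snd c, fst c)" r] by (simp add: S_def scale0_eq)
    qed
  qed
  hence "(A, B) \<in> S" using assms by (rule subsetD)
  thus ?thesis by (simp add: S_def)
qed

abbreviation \<theta> where "\<theta> \<equiv> exchange J"

lemma exchange_eq: "(A, B) \<in> degree0 J \<Longrightarrow> \<theta> (x, (A, B), y) = (- y, (B, A), - x)"
  by (simp add: exchange_def)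

lemma exchange_involution:
  assumes "w \<in> L"
  shows "\<theta> w \<in> L" "\<theta> (\<theta> w) = w"
proof -
  obtain p A B q where w: "w = (p, (A, B), q)" by (metis surj_pair)
  show "\<theta> w \<in> L" "\<theta> (\<theta> w) = w" using assms by (simp_all add: w exchange_eq degree0_swap)
qed

lemma exchange_exp_plus:
  assumes "w \<in> L"
  shows "\<theta> (exp_plus J x w) = exp_minus J (- x) (\<theta> w)"
proof -
  obtain p A B q where w: "w = (p, (A, B), q)" by (metis surj_pair)
  have AB: "(A, B) \<in> degree0 J" using assms by (simp add: w)
  hence "(A, B) + D x q \<in> degree0 J" by blast
  thus ?thesis
    using AB by (simp add: w exp_plus_eq exp_minus_eq degree0_swap D_eq exchange_eq
        degree0_linear[OF AB] fun_eq_iff)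
qed

lemma exchange_exp_minus: "w \<in> L \<Longrightarrow> \<theta> (exp_minus J y w) = exp_plus J (- y) (\<theta> w)"
  using exchange_exp_plus[of "\<theta> w" "- y"] exchange_involution[of w]
    exchange_involution(2)[of "exp_plus J (- y) (\<theta> w)"] by simp

lemma amb_involution:
  assumes "s \<in> extensional L" "\<And>w. w \<in> L \<Longrightarrow> s w \<in> L" "\<And>w. w \<in> L \<Longrightarrow> s (s w) = w"
  shows "s \<in> carrier \<A>" "inv\<^bsub>\<A>\<^esub> s = s"
proof -
  have "bij_betw s L L" using assms by (intro bij_betw_byWitness[where f' = s]) auto
  thus *: "s \<in> carrier \<A>" using assms(1) by (simp add: amb_carrier Bij_def)
  thus "inv\<^bsub>\<A>\<^esub> s = s"
    by (intro amb.inv_equality amb_eqI) (auto simp: amb_mult amb_one assms)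
qed

lemma exchange_carrier [simp, intro]: "\<theta> \<in> carrier \<A>" and inv_exchange [simp]: "inv\<^bsub>\<A>\<^esub> \<theta> = \<theta>"
  using exchange_involution by (auto intro!: amb_involution simp: exchange_def)

text \<open>The automorphism of the elementary group behind \<open>polar_map\<close>: it
  interchanges the two kinds of exponentials and so the two parabolic subgroups.\<close>

abbreviation tw where "tw \<equiv> amb.conjugate \<theta>"

lemma conjugate_apply:
  "s \<in> carrier \<A> \<Longrightarrow> g \<in> carrier \<A> \<Longrightarrow> w \<in> L \<Longrightarrow> amb.conjugate s g w = s (g ((inv\<^bsub>\<A>\<^esub> s) w))"
  by (simp add: amb.conjugate_def amb_mult amb_closed)

lemma tw_exp [simp]: "tw (exp_plus J x) = exp_minus J (- x)" "tw (exp_minus J y) = exp_plus J (- y)"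
  by (auto intro!: amb_eqI simp: conjugate_apply exchange_exp_plus exchange_exp_minus exchange_involution)

lemma tw_mult: "g \<in> G \<Longrightarrow> h \<in> G \<Longrightarrow> tw (g \<otimes>\<^bsub>\<A>\<^esub> h) = tw g \<otimes>\<^bsub>\<A>\<^esub> tw h"
  by (simp add: amb.conjugate_mult)

lemma tw_one [simp]: "tw \<one>\<^bsub>\<A>\<^esub> = \<one>\<^bsub>\<A>\<^esub>"
  by (simp add: amb.conjugate_one)

lemma tw_G [simp, intro]: "g \<in> G \<Longrightarrow> tw g \<in> G"
  by (induction rule: el_group_induct) (simp_all add: tw_mult)

lemma tw_tw [simp]: "g \<in> carrier \<A> \<Longrightarrow> tw (tw g) = g"
  by (simp add: amb.conjugate_involution)

text \<open>The exchange automorphism sends \<open>E\<close> to \<open>- E\<close>, whence the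
  signs.\<close>

lemma tw_E:
  assumes "g \<in> G" "g E = (p, (A, B), q)"
  shows "tw g E = (q, (- B, - A), p)"
proof -
  have "(A, B) \<in> degree0 J" using G_L[OF assms(1) E_in_L] assms by simp
  hence "(- A, - B) \<in> degree0 J" using degree0_closed(6) by fastforce
  moreover have "\<theta> E = - E"
    using degree0_closed(1) by (auto simp: E_def e0_def exchange_eq)
  ultimately show ?thesis
    using assms by (simp add: conjugate_apply G_neg exchange_eq)
qed

lemma tw_P: "g \<in> G \<Longrightarrow> tw g \<in> P_plus J \<longleftrightarrow> g \<in> P_minus J"
  "g \<in> G \<Longrightarrow> tw g \<in> P_minus J \<longleftrightarrow> g \<in> P_plus J"
proof -
  have "- (\<lambda>y. - y) = (\<lambda>x::'v. x)" by (simp add: fun_eq_iff)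
  hence *: "tw g \<in> P_plus J" if "g \<in> P_minus J" for g
    using that tw_E[of g 0] by (auto simp: P_minus_iff P_plus_iff e0_def fun_Compl_def)
  have **: "tw g \<in> P_minus J" if "g \<in> P_plus J" for g
    using that tw_E[of g _ _ _ 0] by (auto simp: P_minus_iff P_plus_iff e0_def fun_Compl_def)
  show "g \<in> G \<Longrightarrow> tw g \<in> P_plus J \<longleftrightarrow> g \<in> P_minus J" "g \<in> G \<Longrightarrow> tw g \<in> P_minus J \<longleftrightarrow> g \<in> P_plus J"
    using *[of g] **[of g] *[of "tw g"] **[of "tw g"] tw_tw[of g] by auto
qed

lemma polar_map_eq: "polar_map J \<xi> = tw ` \<xi>"
  by (simp add: polar_map_def amb.conjugate_def)

lemma polar_map_o [simp]: "polar_map J (o_plus J) = o_minus J" "polar_map J (o_minus J) = o_plus J"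
proof -
  have "P_plus J \<subseteq> G" "P_minus J \<subseteq> G" by (auto simp: P_plus_iff P_minus_iff)
  hence "tw ` P_minus J = P_plus J" "tw ` P_plus J = P_minus J"
    by (force simp: tw_P intro!: image_eqI[where f = tw, OF tw_tw[symmetric]])+
  thus "polar_map J (o_plus J) = o_minus J" "polar_map J (o_minus J) = o_plus J"
    by (simp_all add: polar_map_eq o_plus_eq o_minus_eq)
qed

lemma polar_map_act: "g \<in> G \<Longrightarrow> \<xi> \<subseteq> carrier \<A> \<Longrightarrow> polar_map J (g \<cdot> \<xi>) = tw g \<cdot> polar_map J \<xi>"
  by (simp add: polar_map_eq amb.conjugate_l_coset)

text \<open>The sign in \<open>exchange\<close> cancels the one in \<open>affine_minus\<close>, so
  the polar map is the identity in the charts.\<close>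

lemma polar_map_affine [simp]:
  "polar_map J (affine_plus J x) = affine_minus J x" "polar_map J (affine_minus J x) = affine_plus J x"
  by (simp_all add: affine_plus_def affine_minus_def polar_map_act)

lemma polar_map_involution: "\<xi> \<subseteq> carrier \<A> \<Longrightarrow> polar_map J (polar_map J \<xi>) = \<xi>"
  by (force simp: polar_map_eq image_image subset_iff)

section \<open>The reflection at the base point\<close>

abbreviation \<rho> where "\<rho> \<equiv> grading_aut J (- 1)"

lemma reflection_eq: "c \<in> degree0 J \<Longrightarrow> \<rho> (x, c, y) = (- x, c, - y)"
proof -
  have "ring_inv (- 1) = (- 1 :: 'k)"
    unfolding ring_inv_def by (rule the_equality) (auto simp: minus_equation_iff[of _ 1])
  thus "c \<in> degree0 J \<Longrightarrow> \<rho> (x, c, y) = (- x, c, - y)"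
    by (simp add: grading_aut_def)
qed

lemma reflection_carrier [simp, intro]: "\<rho> \<in> carrier \<A>" and inv_reflection [simp]: "inv\<^bsub>\<A>\<^esub> \<rho> = \<rho>"
proof -
  have "\<rho> w \<in> L \<and> \<rho> (\<rho> w) = w" if "w \<in> L" for w
    using that by (cases w) (auto simp: reflection_eq)
  moreover have "\<rho> \<in> extensional L" by (simp add: grading_aut_def)
  ultimately show "\<rho> \<in> carrier \<A>" "inv\<^bsub>\<A>\<^esub> \<rho> = \<rho>" by (auto intro: amb_involution)
qed

abbreviation rfl where "rfl \<equiv> amb.conjugate \<rho>"

lemma rfl_exp [simp]:
  "rfl (exp_plus J x) = exp_plus J (- x)" "rfl (exp_minus J y) = exp_minus J (- y)"
proof -
  have *: "\<rho> (exp_plus J x (\<rho> w)) = exp_plus J (- x) w \<and> \<rho> (exp_minus J y (\<rho> w)) = exp_minus J (- y) w"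
    if wL: "w \<in> L" for w
  proof -
    obtain p A B q where w: "w = (p, (A, B), q)" by (metis surj_pair)
    have AB: "(A, B) \<in> degree0 J" using wL by (simp add: w)
    hence "(A, B) + D x (- q) \<in> degree0 J" "(A, B) - D (- p) y \<in> degree0 J" by blast+
    moreover have "D x (- q) = D (- x) q" "D (- p) y = D p (- y)" by (simp_all add: D_linear)
    ultimately show ?thesis
      using AB by (simp add: w exp_plus_eq exp_minus_eq reflection_eq degree0_linear[OF AB]
          del: add_Pair diff_Pair)
  qed
  show "rfl (exp_plus J x) = exp_plus J (- x)" "rfl (exp_minus J y) = exp_minus J (- y)"
    using * by (auto intro!: amb_eqI simp: conjugate_apply)
qed

lemma rfl_mult: "g \<in> G \<Longrightarrow> h \<in> G \<Longrightarrow> rfl (g \<otimes>\<^bsub>\<A>\<^esub> h) = rfl g \<otimes>\<^bsub>\<A>\<^esub> rfl h"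
  by (simp add: amb.conjugate_mult)

lemma rfl_one [simp]: "rfl \<one>\<^bsub>\<A>\<^esub> = \<one>\<^bsub>\<A>\<^esub>"
  by (simp add: amb.conjugate_one)

lemma rfl_G [simp, intro]: "g \<in> G \<Longrightarrow> rfl g \<in> G"
  by (induction rule: el_group_induct) (simp_all add: rfl_mult)

lemma rfl_refl [simp]: "g \<in> carrier \<A> \<Longrightarrow> rfl (rfl g) = g"
  by (simp add: amb.conjugate_involution)

lemma rfl_o_plus: "rfl ` o_plus J = o_plus J"
proof -
  have "rfl g \<in> P_minus J" if "g \<in> P_minus J" for g
    using that by (auto simp: P_minus_iff conjugate_apply reflection_eq E_def)
  moreover have "g = rfl (rfl g)" if "g \<in> P_minus J" for g
    using that by (simp add: P_minus_iff)
  ultimately show ?thesis unfolding o_plus_eq by blast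
qed

text \<open>An element fixing \<open>E\<close> preserves each degree, while \<rho> is a scalar 1 or
  -1 on each degree; so the two commute.\<close>

lemma rfl_H:
  assumes "k \<in> G" "k E = E"
  shows "rfl k = k"
proof (rule amb_eqI)
  fix w assume "w \<in> L"
  then obtain p c q where w: "w = (p, c, q)" "c \<in> degree0 J" by (metis surj_pair lie_alg_iff)
  have "k \<in> H_group J" using assms by (simp add: H_iff)
  hence gr: "k ` grade J 1 = grade J 1" "k ` grade J 0 = grade J 0" "k ` grade J (- 1) = grade J (- 1)"
    by (simp_all add: H_group_def)
  have "(p, 0, 0) \<in> grade J 1" "(0, c, 0) \<in> grade J 0" "(0, 0, q) \<in> grade J (- 1)"
    using w by (cases c; auto simp: grade_def)+
  hence "k (p, 0, 0) \<in> grade J 1" "k (0, c, 0) \<in> grade J 0" "k (0, 0, q) \<in> grade J (- 1)"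
    using gr by blast+
  then obtain p' c' q' where k: "k (p, 0, 0) = (p', 0, 0)" "k (0, c, 0) = (0, c', 0)"
      "c' \<in> degree0 J" "k (0, 0, q) = (0, 0, q')"
    by (auto simp: grade_def)
  have "k w = k ((p, 0, 0) + (0, c, 0) + (0, 0, q))" by (simp add: w)
  also have "\<dots> = k (p, 0, 0) + k (0, c, 0) + k (0, 0, q)"
    using assms w by (simp add: G_add del: add_Pair)
  finally have kw: "k w = (p', c', q')" by (simp add: k)
  have "k (\<rho> w) = k ((0, c, 0) - (p, 0, 0) - (0, 0, q))" using w by (simp add: reflection_eq)
  also have "\<dots> = k (0, c, 0) - k (p, 0, 0) - k (0, 0, q)"
    using assms w by (simp add: G_diff del: diff_Pair)
  finally have "k (\<rho> w) = (- p', c', - q')" by (simp add: k)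
  thus "rfl k w = k w" using assms kw k(3) \<open>w \<in> L\<close> by (simp add: conjugate_apply reflection_eq)
qed (use assms in auto)

text \<open>Conjugation by \<rho> preserves \<open>P_minus\<close>, so it acts on cosets. The result
  does not depend on \<open>g\<close>: another choice differs by an element fixing \<open>E\<close>,
  which commutes with \<rho> and cancels.\<close>

lemma dilation_eq:
  assumes g: "g \<in> G" and h: "h \<in> G"
  shows "dilation J (- 1) (g \<cdot> o_plus J) (g \<cdot> o_minus J) (h \<cdot> o_plus J) =
    (g \<otimes>\<^bsub>\<A>\<^esub> rfl (inv\<^bsub>\<A>\<^esub> g \<otimes>\<^bsub>\<A>\<^esub> h)) \<cdot> o_plus J"
proof -
  have im: "(\<lambda>h. g \<otimes>\<^bsub>\<A>\<^esub> (\<rho> \<otimes>\<^bsub>\<A>\<^esub> (inv\<^bsub>\<A>\<^esub> g \<otimes>\<^bsub>\<A>\<^esub> h) \<otimes>\<^bsub>\<A>\<^esub> inv\<^bsub>\<A>\<^esub> \<rho>)) ` (h \<cdot> o_plus J) =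
      (g \<otimes>\<^bsub>\<A>\<^esub> rfl (inv\<^bsub>\<A>\<^esub> g \<otimes>\<^bsub>\<A>\<^esub> h)) \<cdot> o_plus J" (is "?im g = _") if g: "g \<in> G" for g
  proof -
    have "?im g = g \<cdot> (rfl ` (inv\<^bsub>\<A>\<^esub> g \<cdot> h \<cdot> o_plus J))"
      unfolding l_coset_def amb.conjugate_def by blast
    also have "\<dots> = g \<cdot> rfl (inv\<^bsub>\<A>\<^esub> g \<otimes>\<^bsub>\<A>\<^esub> h) \<cdot> o_plus J"
      using g h by (simp add: amb.conjugate_l_coset rfl_o_plus)
    also have "\<dots> = (g \<otimes>\<^bsub>\<A>\<^esub> rfl (inv\<^bsub>\<A>\<^esub> g \<otimes>\<^bsub>\<A>\<^esub> h)) \<cdot> o_plus J" using g h by simp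
    finally show ?thesis .
  qed
  have indep: "g' \<otimes>\<^bsub>\<A>\<^esub> rfl (inv\<^bsub>\<A>\<^esub> g' \<otimes>\<^bsub>\<A>\<^esub> h) = g \<otimes>\<^bsub>\<A>\<^esub> rfl (inv\<^bsub>\<A>\<^esub> g \<otimes>\<^bsub>\<A>\<^esub> h)"
    if g': "g' \<in> G" "g \<cdot> o_plus J = g' \<cdot> o_plus J" "g \<cdot> o_minus J = g' \<cdot> o_minus J" for g'
  proof -
    define k where "k = inv\<^bsub>\<A>\<^esub> g \<otimes>\<^bsub>\<A>\<^esub> g'"
    have "k \<in> G" using g g' by (simp add: k_def)
    moreover have "k E = E"
      using coset_plus_eq_iff[of g g'] coset_minus_eq_iff[of g g'] g g'
      by (auto simp: k_def G_mult E_def)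
    ultimately have k: "k \<in> carrier \<A>" "rfl k = k" by (auto simp: rfl_H)
    have g'k: "g' = g \<otimes>\<^bsub>\<A>\<^esub> k" using g g' by (simp add: k_def flip: amb.m_assoc)
    have "rfl (inv\<^bsub>\<A>\<^esub> g' \<otimes>\<^bsub>\<A>\<^esub> h) = inv\<^bsub>\<A>\<^esub> k \<otimes>\<^bsub>\<A>\<^esub> rfl (inv\<^bsub>\<A>\<^esub> g \<otimes>\<^bsub>\<A>\<^esub> h)"
      using g h k by (simp add: g'k amb.inv_mult_group amb.m_assoc amb.conjugate_mult amb.conjugate_inv)
    moreover have "rfl (inv\<^bsub>\<A>\<^esub> g \<otimes>\<^bsub>\<A>\<^esub> h) \<in> carrier \<A>" using g h by simp
    ultimately show ?thesis
      using g k by (simp add: g'k amb.m_assoc) (simp flip: amb.m_assoc)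
  qed
  show ?thesis
    unfolding dilation_def
  proof (rule the_equality)
    show "\<exists>g'\<in>G. g \<cdot> o_plus J = g' \<cdot> o_plus J \<and> g \<cdot> o_minus J = g' \<cdot> o_minus J \<and>
      (g \<otimes>\<^bsub>\<A>\<^esub> rfl (inv\<^bsub>\<A>\<^esub> g \<otimes>\<^bsub>\<A>\<^esub> h)) \<cdot> o_plus J =
      (\<lambda>h. g' \<otimes>\<^bsub>\<A>\<^esub> (\<rho> \<otimes>\<^bsub>\<A>\<^esub> (inv\<^bsub>\<A>\<^esub> g' \<otimes>\<^bsub>\<A>\<^esub> h) \<otimes>\<^bsub>\<A>\<^esub> inv\<^bsub>\<A>\<^esub> \<rho>)) ` (h \<cdot> o_plus J)"
      using g im[OF g] by (intro bexI[of _ g]) auto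
  next
    fix q assume "\<exists>g'\<in>G. g \<cdot> o_plus J = g' \<cdot> o_plus J \<and> g \<cdot> o_minus J = g' \<cdot> o_minus J \<and>
      q = (\<lambda>h. g' \<otimes>\<^bsub>\<A>\<^esub> (\<rho> \<otimes>\<^bsub>\<A>\<^esub> (inv\<^bsub>\<A>\<^esub> g' \<otimes>\<^bsub>\<A>\<^esub> h) \<otimes>\<^bsub>\<A>\<^esub> inv\<^bsub>\<A>\<^esub> \<rho>)) ` (h \<cdot> o_plus J)"
    then obtain g' where g': "g' \<in> G" "g \<cdot> o_plus J = g' \<cdot> o_plus J" "g \<cdot> o_minus J = g' \<cdot> o_minus J"
      and q: "q = (\<lambda>h. g' \<otimes>\<^bsub>\<A>\<^esub> (\<rho> \<otimes>\<^bsub>\<A>\<^esub> (inv\<^bsub>\<A>\<^esub> g' \<otimes>\<^bsub>\<A>\<^esub> h) \<otimes>\<^bsub>\<A>\<^esub> inv\<^bsub>\<A>\<^esub> \<rho>)) ` (h \<cdot> o_plus J)"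
      by blast
    show "q = (g \<otimes>\<^bsub>\<A>\<^esub> rfl (inv\<^bsub>\<A>\<^esub> g \<otimes>\<^bsub>\<A>\<^esub> h)) \<cdot> o_plus J"
      unfolding q im[OF g'(1)] indep[OF g'] ..
  qed
qed

text \<open>Expanding the cubes of 1 + K and 1 - K gives 2K + 3K^2 + K^3 = 0 and 3K^2 = 2K + K^3.
  Together they give 6K^2 = 0, so K^2 = 0 and then 2K = 0; this takes both 2 and 3
  invertible.\<close>

lemma tripotent_pair_rigid:
  assumes add: "\<And>x y. K (x + y) = K x + K (y::'v)"
    and plus: "\<And>x. (let C = \<lambda>x. x + K x in C (C (C x)) = C x)"
    and minus: "\<And>x. (let C = \<lambda>x. x - K x in C (C (C x)) = C x)"
  shows "K x = 0"
proof -
  have zero: "K 0 = 0" using add[of 0 0] by simp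
  have neg: "K (- x) = - K x" for x using add[of x "- x"] zero by (simp add: eq_neg_iff_add_eq_0 add.commute)
  have diff: "K (x - y) = K x - K y" for x y using add[of x "- y"] neg by simp
  have p: "K x + K x + (K (K x) + K (K x) + K (K x)) + K (K (K x)) = 0" for x
    using plus[of x] by (simp add: Let_def add algebra_simps)
  have m: "K (K x) + K (K x) + K (K x) = K x + K x + K (K (K x))" for x
    using minus[of x] by (simp add: Let_def diff add algebra_simps)
  have "(K (K x) + K (K x) + K (K x)) + (K (K x) + K (K x) + K (K x)) = 0"
    using p[of x] unfolding m by (simp add: algebra_simps)
  hence "K (K x) + K (K x) + K (K x) = 0" by (rule double_zero)
  hence KK: "K (K x) = 0" by (rule triple_zero)
  hence "K x + K x = 0" using p[of x] by (simp add: zero)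
  thus ?thesis by (rule double_zero)
qed

text \<open>The cubic identities for \<open>g E\<close> and \<open>h E\<close> are read off in
  degrees 1 and -1. In degree -1 the element \<open>E\<close> acts by -1, so \<open>g\<close> and
  \<open>h\<close> exchange their roles.\<close>

lemma euler_pair_rigid:
  assumes g: "g \<in> G" and h: "h \<in> G" and gE: "g E = E + (0, (K, K'), 0)"
    and hE: "h E = E - (0, (K, K'), 0)" and k: "(K, K') \<in> degree0 J"
  shows "(K, K') = 0"
proof -
  have cube: "A (A (A x)) = A x" "B (B (B x)) = B x"
    if "k \<in> G" "k E = (0, (A, B), 0)" for k A B x
  proof -
    have "(A, B) \<in> degree0 J" using that G_L[of k E] by simp
    note lin = degree0_linear(9,10)[OF this]
    have "br (k E) (x, 0, 0) = (A x, 0, 0)" "br (k E) (0, 0, x) = (0, 0, B x)" for x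
      using lin by (simp_all add: that br_eq zero_prod_def fun_eq_iff)
    thus "A (A (A x)) = A x" "B (B (B x)) = B x"
      using br_GE_cube[OF that(1), of "(x, 0, 0)"] br_GE_cube[OF that(1), of "(0, 0, x)"] by simp_all
  qed
  note lin = degree0_linear[OF k]
  have gE': "g E = (0, (\<lambda>x. x + K x, \<lambda>x. K' x - x), 0)"
    and hE': "h E = (0, (\<lambda>x. x - K x, \<lambda>x. - x - K' x), 0)"
    unfolding gE hE by (simp_all add: E_def e0_def fun_eq_iff)
  have "K x = 0" for x
    using cube(1)[OF g gE'] cube(1)[OF h hE'] by (intro tripotent_pair_rigid) (simp_all add: lin Let_def)
  moreover have "K' x = 0" for x
  proof (rule tripotent_pair_rigid[of K'])
    show "let C = \<lambda>x. x + K' x in C (C (C x)) = C x" for x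
      using cube(2)[OF h hE', of "- x"] by (simp add: Let_def lin algebra_simps)
    show "let C = \<lambda>x. x - K' x in C (C (C x)) = C x" for x
      using cube(2)[OF g gE', of "- x"] by (simp add: Let_def lin algebra_simps)
  qed (rule lin)
  ultimately show ?thesis by (simp add: zero_prod_def fun_eq_iff)
qed

end

section \<open>Functoriality\<close>

locale jts_hom = S: jts_sixth sc T + R: jts_sixth sc' T'
  for sc :: "'k::comm_ring_1 \<Rightarrow> 'v::ab_group_add \<Rightarrow> 'v"
    and T :: "'v \<Rightarrow> 'v \<Rightarrow> 'v \<Rightarrow> 'v"
    and sc' :: "'k \<Rightarrow> 'w::ab_group_add \<Rightarrow> 'w"
    and T' :: "'w \<Rightarrow> 'w \<Rightarrow> 'w \<Rightarrow> 'w" +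
  fixes hp hm :: "'v \<Rightarrow> 'w"
  assumes hom: "jordan_pair_hom S.J R.J hp hm"
begin

lemma hp_hom: "module_hom sc sc' hp" and hm_hom: "module_hom sc sc' hm"
  and hp_T: "hp (T x y z) = T' (hp x) (hm y) (hp z)"
  and hm_T: "hm (T x y z) = T' (hm x) (hp y) (hm z)"
  using hom by (auto simp: jordan_pair_hom_def)

lemmas h_linear = module_hom.add[OF hp_hom] module_hom.add[OF hm_hom] module_hom.neg[OF hp_hom]
  module_hom.neg[OF hm_hom] module_hom.diff[OF hp_hom] module_hom.diff[OF hm_hom]
  module_hom.scale[OF hp_hom] module_hom.scale[OF hm_hom] module_hom.zero[OF hp_hom]
  module_hom.zero[OF hm_hom]

lemma h_Q: "hp (S.Q x y) = R.Q (hp x) (hm y)" "hm (S.Q y x) = R.Q (hm y) (hp x)"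
  by (simp_all add: quad_op_def h_linear hp_T hm_T)

text \<open>
  The Jordan pair homomorphism need not induce a map of elementary groups, since \<open>D x y = 0\<close> does not
  imply \<open>D (hp x) (hm y) = 0\<close>; corresponding words in the exponentials only form a relation.
\<close>

inductive_set words ::
    "((('v, 'v) tkk \<Rightarrow> ('v, 'v) tkk) \<times> (('w, 'w) tkk \<Rightarrow> ('w, 'w) tkk)) set" where
  one: "(\<one>\<^bsub>S.\<A>\<^esub>, \<one>\<^bsub>R.\<A>\<^esub>) \<in> words"
| plus: "(g, g') \<in> words \<Longrightarrow>
    (exp_plus S.J v \<otimes>\<^bsub>S.\<A>\<^esub> g, exp_plus R.J (hp v) \<otimes>\<^bsub>R.\<A>\<^esub> g') \<in> words"
| minus: "(g, g') \<in> words \<Longrightarrow>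
    (exp_minus S.J v \<otimes>\<^bsub>S.\<A>\<^esub> g, exp_minus R.J (hm v) \<otimes>\<^bsub>R.\<A>\<^esub> g') \<in> words"

lemma words_G [simp]: "(g, g') \<in> words \<Longrightarrow> g \<in> S.G" "(g, g') \<in> words \<Longrightarrow> g' \<in> R.G"
  by (induction rule: words.induct) auto

lemma words_total: "g \<in> S.G \<Longrightarrow> \<exists>g'. (g, g') \<in> words"
  by (induction rule: S.el_group_induct) (blast intro: words.intros)+

lemma words_mult:
  assumes "(g, g') \<in> words" "(k, k') \<in> words"
  shows "(g \<otimes>\<^bsub>S.\<A>\<^esub> k, g' \<otimes>\<^bsub>R.\<A>\<^esub> k') \<in> words"
  using assms(1) assms(2)
  by (induction rule: words.induct) (auto simp: S.amb.m_assoc R.amb.m_assoc intro: words.intros)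

lemma words_exp:
  "(exp_plus S.J v, exp_plus R.J (hp v)) \<in> words" "(exp_minus S.J v, exp_minus R.J (hm v)) \<in> words"
  using words.plus[OF words.one, of v] words.minus[OF words.one, of v] by simp_all

lemma words_inv: "(g, g') \<in> words \<Longrightarrow> (inv\<^bsub>S.\<A>\<^esub> g, inv\<^bsub>R.\<A>\<^esub> g') \<in> words"
proof (induction rule: words.induct)
  case one
  show ?case by (simp add: words.one)
next
  case (plus g g' v)
  thus ?case using words_mult[OF plus.IH words_exp(1)[of "- v"]]
    by (simp add: S.amb.inv_mult_group R.amb.inv_mult_group h_linear)
next
  case (minus g g' v)
  thus ?case using words_mult[OF minus.IH words_exp(2)[of "- v"]]
    by (simp add: S.amb.inv_mult_group R.amb.inv_mult_group h_linear)
qed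

lemma words_rfl: "(g, g') \<in> words \<Longrightarrow> (S.rfl g, R.rfl g') \<in> words"
proof (induction rule: words.induct)
  case (plus g g' v)
  thus ?case using words.plus[OF plus.IH, of "- v"] by (simp add: S.rfl_mult R.rfl_mult h_linear)
next
  case (minus g g' v)
  thus ?case using words.minus[OF minus.IH, of "- v"] by (simp add: S.rfl_mult R.rfl_mult h_linear)
qed (simp add: words.one)

text \<open>The components in degrees 1 and -1 correspond under \<open>hp\<close> and
  \<open>hm\<close>, but the degree 0 part of \<open>g' R.E\<close> is controlled only on the images
  of these maps.\<close>

lemma words_E:
  assumes "(g, g') \<in> words" "g S.E = (p, (A, B), q)"
  shows "\<exists>A' B'. g' R.E = (hp p, (A', B'), hm q) \<and>
    (\<forall>x. A' (hp x) = hp (A x)) \<and> (\<forall>y. B' (hm y) = hm (B y))"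
  using assms
proof (induction arbitrary: p A B q rule: words.induct)
  case one
  hence "S.E = (p, (A, B), q)" by (simp add: S.amb_one)
  hence "p = 0" "q = 0" "A = (\<lambda>x. x)" "B = (\<lambda>x. - x)" by (simp_all add: S.E_def S.e0_def)
  moreover have "\<one>\<^bsub>R.\<A>\<^esub> R.E = (0, (\<lambda>x. x, \<lambda>x. - x), 0)"
    by (simp only: R.amb_one R.E_in_L) (simp add: R.E_def R.e0_def)
  ultimately show ?case by (simp add: h_linear)
next
  case (plus g g' v)
  obtain p0 A0 B0 q0 where g: "g S.E = (p0, (A0, B0), q0)" by (metis surj_pair)
  then obtain A' B' where g': "g' R.E = (hp p0, (A', B'), hm q0)" "\<And>x. A' (hp x) = hp (A0 x)"
      "\<And>y. B' (hm y) = hm (B0 y)"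
    using plus.IH by blast
  have "(A0, B0) \<in> degree0 S.J" "(A', B') \<in> degree0 R.J"
    using S.G_L[OF words_G(1)[OF plus.hyps] S.E_in_L] R.G_L[OF words_G(2)[OF plus.hyps] R.E_in_L] g g'
    by auto
  thus ?case
    using plus.prems plus.hyps g g'
    by (auto simp: S.G_mult R.G_mult S.exp_plus_eq R.exp_plus_eq S.D_eq R.D_eq h_linear h_Q hp_T hm_T)
next
  case (minus g g' v)
  obtain p0 A0 B0 q0 where g: "g S.E = (p0, (A0, B0), q0)" by (metis surj_pair)
  then obtain A' B' where g': "g' R.E = (hp p0, (A', B'), hm q0)" "\<And>x. A' (hp x) = hp (A0 x)"
      "\<And>y. B' (hm y) = hm (B0 y)"
    using minus.IH by blast
  have "(A0, B0) \<in> degree0 S.J" "(A', B') \<in> degree0 R.J"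
    using S.G_L[OF words_G(1)[OF minus.hyps] S.E_in_L] R.G_L[OF words_G(2)[OF minus.hyps] R.E_in_L] g g'
    by auto
  thus ?case
    using minus.prems minus.hyps g g'
    by (auto simp: S.G_mult R.G_mult S.exp_minus_eq R.exp_minus_eq S.D_eq R.D_eq h_linear h_Q hp_T hm_T)
qed

text \<open>The exponents occurring in \<open>g'\<close> lie in the images of \<open>hp\<close> and
  \<open>hm\<close>, where this degree 0 element acts by zero.\<close>

lemma words_fix:
  assumes "(g, g') \<in> words" "(K, K') \<in> degree0 R.J" "\<And>x. K (hp x) = 0" "\<And>y. K' (hm y) = 0"
  shows "g' (0, (K, K'), 0) = (0, (K, K'), 0)"
  using assms(1)
  by (induction rule: words.induct)
    (simp_all add: R.amb_one R.amb_mult R.exp_plus_eq R.exp_minus_eq assms)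

lemma words_P_minus:
  assumes gg': "(g, g') \<in> words" and g: "g S.E = (0, S.e0, y)"
  shows "g' R.E = (0, R.e0, hm y)"
proof -
  obtain A B where g': "g' R.E = (0, (A, B), hm y)" and A: "\<And>x. A (hp x) = hp x"
    and B: "\<And>y. B (hm y) = - hm y"
    using words_E[OF gg'] g by (auto simp: S.e0_def h_linear)
  have AB: "(A, B) \<in> degree0 R.J" using R.G_L[OF words_G(2)[OF gg'] R.E_in_L] by (simp add: g')
  \<comment> \<open>Multiplying by this exponential removes the degree -1 part of
    \<open>g' R.E\<close> and stays within related words.\<close>
  define u' where "u' = exp_minus R.J (hm (- y)) \<otimes>\<^bsub>R.\<A>\<^esub> g'"
  have uu': "(exp_minus S.J (- y) \<otimes>\<^bsub>S.\<A>\<^esub> g, u') \<in> words"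
    unfolding u'_def by (rule words.minus[OF gg'])
  have u'E: "u' R.E = (0, (A, B), 0)"
    using gg' AB by (simp add: u'_def R.G_mult g' R.exp_minus_eq h_linear B R.degree0_linear[OF AB])
  obtain K K' where K: "(K, K') = (A, B) - R.e0" by (metis surj_pair)
  hence K_eq: "K = (\<lambda>x. A x - x)" "K' = (\<lambda>x. B x + x)" by (auto simp: R.e0_def fun_eq_iff)
  have KK: "(K, K') \<in> degree0 R.J" unfolding K using AB by blast
  have u': "u' \<in> R.G" "inv\<^bsub>R.\<A>\<^esub> u' \<in> R.G" using words_G(2)[OF uu'] by simp_all
  have u'E': "u' R.E = R.E + (0, (K, K'), 0)"
    unfolding u'E by (simp add: K_eq R.E_def R.e0_def fun_eq_iff)
  \<comment> \<open>The inverse of \<open>u'\<close> also occurs in a related pair, so it fixes the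
    error term. Applied to \<open>u' R.E\<close>, it shows that it sends \<open>R.E\<close> to
    \<open>R.E\<close> minus that term.\<close>
  have fix_k: "(inv\<^bsub>R.\<A>\<^esub> u') (0, (K, K'), 0) = (0, (K, K'), 0)"
    by (rule words_fix[OF words_inv[OF uu'] KK]) (simp_all add: K_eq A B)
  have "R.E = (inv\<^bsub>R.\<A>\<^esub> u') (R.E + (0, (K, K'), 0))"
    using R.G_inv(1)[OF u'(1) R.E_in_L] by (simp add: u'E')
  also have "\<dots> = (inv\<^bsub>R.\<A>\<^esub> u') R.E + (0, (K, K'), 0)"
    using u' KK by (simp add: R.G_add fix_k)
  finally have "(inv\<^bsub>R.\<A>\<^esub> u') R.E = R.E - (0, (K, K'), 0)" by (metis add_diff_cancel_right')
  from R.euler_pair_rigid[OF u' u'E' this KK] have "(A, B) = R.e0" using K by simp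
  thus ?thesis using g' by simp
qed

text \<open>Both Jordan pairs come from triple systems, so exchanging the two components of the
  homomorphism gives another one. Twisting words by the exchange realizes this and reduces
  \<open>P_plus\<close> to \<open>P_minus\<close>.\<close>

lemma swap: "jts_hom sc T sc' T' hm hp"
  by unfold_locales (use hom in \<open>auto simp: jordan_pair_hom_def\<close>)

lemma words_tw: "(g, g') \<in> words \<Longrightarrow> (S.tw g, R.tw g') \<in> jts_hom.words sc T sc' T' hm hp"
proof (induction rule: words.induct)
  interpret W: jts_hom sc T sc' T' hm hp by (rule swap)
  {
    case one
    show ?case using W.words.one by simp
  next
    case (plus g g' v)
    thus ?case using W.words.minus[OF plus.IH, of "- v"] by (simp add: S.tw_mult R.tw_mult h_linear)
  next
    case (minus g g' v)
    thus ?case using W.words.plus[OF minus.IH, of "- v"] by (simp add: S.tw_mult R.tw_mult h_linear)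
  }
qed

lemma words_P_plus:
  assumes gg': "(g, g') \<in> words" and g: "g \<in> P_plus S.J"
  shows "g' \<in> P_plus R.J"
proof -
  interpret W: jts_hom sc T sc' T' hm hp by (rule swap)
  have G: "g \<in> S.G" "g' \<in> R.G" using gg' by simp_all
  have "S.tw g \<in> P_minus S.J" using g G by (simp add: S.tw_P)
  then obtain y where "S.tw g S.E = (0, S.e0, y)" by (auto simp: S.P_minus_iff)
  hence "R.tw g' R.E = (0, R.e0, hp y)" using W.words_P_minus[OF words_tw[OF gg']] by blast
  hence "R.tw g' \<in> P_minus R.J" using G by (auto simp: R.P_minus_iff)
  thus ?thesis using G by (simp add: R.tw_P)
qed

text \<open>Injectivity on V^+ yields \<open>p = 0\<close> and \<open>A = id\<close>. Rigidity then
  determines \<open>B\<close>, so \<open>hm\<close> may fail to be injective, as \<alpha>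
  may.\<close>

lemma words_P_minus_inj:
  assumes gg': "(g, g') \<in> words" and "inj hp" and g': "g' R.E = (0, R.e0, y')"
  shows "\<exists>y. g S.E = (0, S.e0, y)"
proof -
  obtain p A B q where g: "g S.E = (p, (A, B), q)" by (metis surj_pair)
  then obtain A' B' where "g' R.E = (hp p, (A', B'), hm q)" and A: "\<And>x. A' (hp x) = hp (A x)"
    using words_E[OF gg'] by blast
  hence "hp p = hp 0" "A' = (\<lambda>x. x)" using g' by (auto simp: R.e0_def h_linear)
  hence "p = 0" "A = (\<lambda>x. x)" using \<open>inj hp\<close> A by (auto simp: inj_def fun_eq_iff)
  thus ?thesis using S.euler_rigid[OF words_G(1)[OF gg']] g by (simp add: S.e0_def)
qed

section \<open>The induced maps of coset spaces\<close>

abbreviation actS (infixr "\<cdot>\<^sub>S" 75) where "g \<cdot>\<^sub>S \<xi> \<equiv> g <#\<^bsub>S.\<A>\<^esub> \<xi>"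
abbreviation actR (infixr "\<cdot>\<^sub>R" 75) where "g \<cdot>\<^sub>R \<xi> \<equiv> g <#\<^bsub>R.\<A>\<^esub> \<xi>"

lemma words_coset_plus:
  assumes "(g, g') \<in> words" "(k, k') \<in> words" "g \<cdot>\<^sub>S o_plus S.J = k \<cdot>\<^sub>S o_plus S.J"
  shows "g' \<cdot>\<^sub>R o_plus R.J = k' \<cdot>\<^sub>R o_plus R.J"
proof -
  have w: "(inv\<^bsub>S.\<A>\<^esub> g \<otimes>\<^bsub>S.\<A>\<^esub> k, inv\<^bsub>R.\<A>\<^esub> g' \<otimes>\<^bsub>R.\<A>\<^esub> k') \<in> words"
    by (intro words_mult words_inv assms)
  have G: "g \<in> S.G" "k \<in> S.G" "g' \<in> R.G" "k' \<in> R.G" using assms by simp_all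
  obtain y where "(inv\<^bsub>S.\<A>\<^esub> g \<otimes>\<^bsub>S.\<A>\<^esub> k) S.E = (0, S.e0, y)"
    using assms(3) G by (auto simp: S.coset_plus_eq_iff S.G_mult)
  from words_P_minus[OF w this] show ?thesis using G by (auto simp: R.coset_plus_eq_iff R.G_mult)
qed

lemma words_coset_plus_inj:
  assumes "(g, g') \<in> words" "(k, k') \<in> words" "inj hp" "g' \<cdot>\<^sub>R o_plus R.J = k' \<cdot>\<^sub>R o_plus R.J"
  shows "g \<cdot>\<^sub>S o_plus S.J = k \<cdot>\<^sub>S o_plus S.J"
proof -
  have w: "(inv\<^bsub>S.\<A>\<^esub> g \<otimes>\<^bsub>S.\<A>\<^esub> k, inv\<^bsub>R.\<A>\<^esub> g' \<otimes>\<^bsub>R.\<A>\<^esub> k') \<in> words"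
    by (intro words_mult words_inv assms)
  have G: "g \<in> S.G" "k \<in> S.G" "g' \<in> R.G" "k' \<in> R.G" using assms by simp_all
  obtain y where "(inv\<^bsub>R.\<A>\<^esub> g' \<otimes>\<^bsub>R.\<A>\<^esub> k') R.E = (0, R.e0, y)"
    using assms(4) G by (auto simp: R.coset_plus_eq_iff R.G_mult)
  from words_P_minus_inj[OF w assms(3) this] show ?thesis
    using G by (auto simp: S.coset_plus_eq_iff S.G_mult)
qed

lemma words_coset_minus:
  assumes "(g, g') \<in> words" "(k, k') \<in> words" "g \<cdot>\<^sub>S o_minus S.J = k \<cdot>\<^sub>S o_minus S.J"
  shows "g' \<cdot>\<^sub>R o_minus R.J = k' \<cdot>\<^sub>R o_minus R.J"
proof -
  have w: "(inv\<^bsub>S.\<A>\<^esub> g \<otimes>\<^bsub>S.\<A>\<^esub> k, inv\<^bsub>R.\<A>\<^esub> g' \<otimes>\<^bsub>R.\<A>\<^esub> k') \<in> words"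
    by (intro words_mult words_inv assms)
  have G: "g \<in> S.G" "k \<in> S.G" "g' \<in> R.G" "k' \<in> R.G" using assms by simp_all
  have "inv\<^bsub>S.\<A>\<^esub> g \<otimes>\<^bsub>S.\<A>\<^esub> k \<in> P_plus S.J"
    using assms(3) G S.amb.l_coset_eq_iff[OF S.P_plus_subgroup, of g k] by (simp add: S.o_minus_eq)
  from words_P_plus[OF w this] show ?thesis
    using G R.amb.l_coset_eq_iff[OF R.P_plus_subgroup, of g' k'] by (simp add: R.o_minus_eq)
qed

text \<open>The relation \<open>words\<close> descended to cosets; \<open>words_coset_plus\<close>
  makes the value unique, although \<open>g'\<close> need not be determined by
  \<open>g\<close>.\<close>

definition ind_plus where
  "ind_plus \<xi> = (THE \<eta>. \<exists>(g, g')\<in>words. \<xi> = g \<cdot>\<^sub>S o_plus S.J \<and> \<eta> = g' \<cdot>\<^sub>R o_plus R.J)"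

definition ind_minus where
  "ind_minus \<xi> = (THE \<eta>. \<exists>(g, g')\<in>words. \<xi> = g \<cdot>\<^sub>S o_minus S.J \<and> \<eta> = g' \<cdot>\<^sub>R o_minus R.J)"

lemma ind_o:
  assumes "(g, g') \<in> words"
  shows "ind_plus (g \<cdot>\<^sub>S o_plus S.J) = g' \<cdot>\<^sub>R o_plus R.J"
    "ind_minus (g \<cdot>\<^sub>S o_minus S.J) = g' \<cdot>\<^sub>R o_minus R.J"
proof -
  show "ind_plus (g \<cdot>\<^sub>S o_plus S.J) = g' \<cdot>\<^sub>R o_plus R.J"
    unfolding ind_plus_def
  proof (rule the_equality)
    show "\<exists>(k, k')\<in>words. g \<cdot>\<^sub>S o_plus S.J = k \<cdot>\<^sub>S o_plus S.J \<and> g' \<cdot>\<^sub>R o_plus R.J = k' \<cdot>\<^sub>R o_plus R.J"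
      using assms by blast
  next
    fix \<eta> assume "\<exists>(k, k')\<in>words. g \<cdot>\<^sub>S o_plus S.J = k \<cdot>\<^sub>S o_plus S.J \<and> \<eta> = k' \<cdot>\<^sub>R o_plus R.J"
    then obtain k k' where "(k, k') \<in> words" "g \<cdot>\<^sub>S o_plus S.J = k \<cdot>\<^sub>S o_plus S.J"
        "\<eta> = k' \<cdot>\<^sub>R o_plus R.J" by blast
    thus "\<eta> = g' \<cdot>\<^sub>R o_plus R.J" using words_coset_plus[OF assms] by simp
  qed
  show "ind_minus (g \<cdot>\<^sub>S o_minus S.J) = g' \<cdot>\<^sub>R o_minus R.J"
    unfolding ind_minus_def
  proof (rule the_equality)
    show "\<exists>(k, k')\<in>words. g \<cdot>\<^sub>S o_minus S.J = k \<cdot>\<^sub>S o_minus S.J \<and> g' \<cdot>\<^sub>R o_minus R.J = k' \<cdot>\<^sub>R o_minus R.J"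
      using assms by blast
  next
    fix \<eta> assume "\<exists>(k, k')\<in>words. g \<cdot>\<^sub>S o_minus S.J = k \<cdot>\<^sub>S o_minus S.J \<and> \<eta> = k' \<cdot>\<^sub>R o_minus R.J"
    then obtain k k' where "(k, k') \<in> words" "g \<cdot>\<^sub>S o_minus S.J = k \<cdot>\<^sub>S o_minus S.J"
        "\<eta> = k' \<cdot>\<^sub>R o_minus R.J" by blast
    thus "\<eta> = g' \<cdot>\<^sub>R o_minus R.J" using words_coset_minus[OF assms] by simp
  qed
qed

lemma ind_affine:
  assumes "(g, g') \<in> words"
  shows "ind_plus (g \<cdot>\<^sub>S affine_plus S.J u) = g' \<cdot>\<^sub>R affine_plus R.J (hp u)"
    "ind_minus (g \<cdot>\<^sub>S affine_minus S.J u) = g' \<cdot>\<^sub>R affine_minus R.J (hm u)"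
  using ind_o(1)[OF words_mult[OF assms words_exp(1)[of u]]]
    ind_o(2)[OF words_mult[OF assms words_exp(2)[of "- u"]]] assms
  by (simp_all add: affine_plus_def affine_minus_def h_linear)

lemma ind_act:
  assumes "(k, k') \<in> words"
  shows "\<xi> \<in> X_plus S.J \<Longrightarrow> ind_plus (k \<cdot>\<^sub>S \<xi>) = k' \<cdot>\<^sub>R ind_plus \<xi>"
    "\<xi> \<in> X_minus S.J \<Longrightarrow> ind_minus (k \<cdot>\<^sub>S \<xi>) = k' \<cdot>\<^sub>R ind_minus \<xi>"
proof -
  have "ind_plus (k \<cdot>\<^sub>S g \<cdot>\<^sub>S o_plus S.J) = k' \<cdot>\<^sub>R ind_plus (g \<cdot>\<^sub>S o_plus S.J) \<and>
      ind_minus (k \<cdot>\<^sub>S g \<cdot>\<^sub>S o_minus S.J) = k' \<cdot>\<^sub>R ind_minus (g \<cdot>\<^sub>S o_minus S.J)" if "g \<in> S.G" for g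
  proof -
    obtain g' where "(g, g') \<in> words" using words_total \<open>g \<in> S.G\<close> by blast
    thus ?thesis
      using ind_o[OF words_mult[OF assms \<open>(g, g') \<in> words\<close>]] ind_o[OF \<open>(g, g') \<in> words\<close>] assms by simp
  qed
  thus "\<xi> \<in> X_plus S.J \<Longrightarrow> ind_plus (k \<cdot>\<^sub>S \<xi>) = k' \<cdot>\<^sub>R ind_plus \<xi>"
    "\<xi> \<in> X_minus S.J \<Longrightarrow> ind_minus (k \<cdot>\<^sub>S \<xi>) = k' \<cdot>\<^sub>R ind_minus \<xi>"
    by (auto simp: S.X_plus_iff S.X_minus_iff)
qed

lemma geom_hom: "geom_hom (geometry S.J) (geometry R.J) ind_plus ind_minus"
proof (rule chart_geometry.geom_homI[OF S.chart R.chart hp_hom hm_hom])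
  fix g assume "g \<in> S.G"
  then obtain g' where g': "(g, g') \<in> words" using words_total by blast
  thus "\<exists>g'\<in>R.G. (\<forall>u. ind_plus (g \<cdot>\<^sub>S affine_plus S.J u) = g' \<cdot>\<^sub>R affine_plus R.J (hp u)) \<and>
      (\<forall>u. ind_minus (g \<cdot>\<^sub>S affine_minus S.J u) = g' \<cdot>\<^sub>R affine_minus R.J (hm u))"
    using ind_affine by (intro bexI[of _ g']) auto
qed

lemma ind_base: "ind_plus (o_plus S.J) = o_plus R.J" "ind_minus (o_minus S.J) = o_minus R.J"
  using ind_o[OF words.one] by simp_all

lemma ind_affine_base:
  "ind_plus (affine_plus S.J u) = affine_plus R.J (hp u)"
  "ind_minus (affine_minus S.J u) = affine_minus R.J (hm u)"
  using ind_affine[OF words.one] by simp_all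

theorem induced: "induced_hom S.J R.J hp hm ind_plus ind_minus"
  using hom geom_hom ind_base ind_affine_base ind_act[OF words_exp(1)] ind_act[OF words_exp(2)]
  by (simp add: induced_hom_def)

lemma ind_plus_inj: "inj hp \<Longrightarrow> inj_on ind_plus (X_plus S.J)"
proof (rule inj_onI)
  fix \<xi> \<eta> assume "inj hp" "\<xi> \<in> X_plus S.J" "\<eta> \<in> X_plus S.J" and eq: "ind_plus \<xi> = ind_plus \<eta>"
  then obtain g k where "g \<in> S.G" "\<xi> = g \<cdot>\<^sub>S o_plus S.J" "k \<in> S.G" "\<eta> = k \<cdot>\<^sub>S o_plus S.J"
    by (auto simp: S.X_plus_iff)
  moreover obtain g' k' where "(g, g') \<in> words" "(k, k') \<in> words" using words_total calculation by blast
  ultimately show "\<xi> = \<eta>" using words_coset_plus_inj[of g g' k k'] eq \<open>inj hp\<close> by (simp add: ind_o)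
qed

text \<open>By \<open>dilation_eq\<close> a reflection is built from products, inverses and
  conjugation by \<rho>, and \<open>words\<close> is closed under all three.\<close>

lemma ind_dilation:
  assumes "(g, g') \<in> words" "\<eta> \<in> X_plus S.J"
  shows "ind_plus (dilation S.J (- 1) (g \<cdot>\<^sub>S o_plus S.J) (g \<cdot>\<^sub>S o_minus S.J) \<eta>) =
    dilation R.J (- 1) (g' \<cdot>\<^sub>R o_plus R.J) (g' \<cdot>\<^sub>R o_minus R.J) (ind_plus \<eta>)"
proof -
  obtain h where h: "h \<in> S.G" "\<eta> = h \<cdot>\<^sub>S o_plus S.J" using assms by (auto simp: S.X_plus_iff)
  then obtain h' where h': "(h, h') \<in> words" using words_total by blast
  have "(g \<otimes>\<^bsub>S.\<A>\<^esub> S.rfl (inv\<^bsub>S.\<A>\<^esub> g \<otimes>\<^bsub>S.\<A>\<^esub> h),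
      g' \<otimes>\<^bsub>R.\<A>\<^esub> R.rfl (inv\<^bsub>R.\<A>\<^esub> g' \<otimes>\<^bsub>R.\<A>\<^esub> h')) \<in> words"
    by (intro words_mult words_rfl words_inv assms h')
  from ind_o(1)[OF this] show ?thesis
    using assms h h' by (simp add: S.dilation_eq R.dilation_eq ind_o)
qed

end

text \<open>Reading a pair backwards, the exponent \<open>hp v\<close> must correspond to
  \<open>kp (hp v) = v\<close>; so a left inverse in each component suffices.\<close>

lemma words_converse:
  assumes "jts_hom sc T sc' T' hp hm" "jts_hom sc' T' sc T kp km"
    and "\<And>x. kp (hp x) = x" "\<And>y. km (hm y) = y"
    and "(g, g') \<in> jts_hom.words sc T sc' T' hp hm"
  shows "(g', g) \<in> jts_hom.words sc' T' sc T kp km"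
proof -
  interpret H: jts_hom sc T sc' T' hp hm by fact
  interpret K: jts_hom sc' T' sc T kp km by fact
  from assms(5) show ?thesis
  proof (induction rule: H.words.induct)
    case one
    show ?case by (rule K.words.one)
  next
    case (plus g g' v)
    thus ?case using K.words.plus[OF plus.IH, of "hp v"] by (simp add: assms)
  next
    case (minus g g' v)
    thus ?case using K.words.minus[OF minus.IH, of "hm v"] by (simp add: assms)
  qed
qed

lemma ind_inverse:
  assumes "jts_hom sc T sc' T' hp hm" "jts_hom sc' T' sc T kp km"
    and "\<And>x. kp (hp x) = x" "\<And>y. km (hm y) = y"
  shows "\<xi> \<in> X_plus (jts_pair sc T) \<Longrightarrow>
      jts_hom.ind_plus sc' T' sc T kp km (jts_hom.ind_plus sc T sc' T' hp hm \<xi>) = \<xi>"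
    "\<xi> \<in> X_minus (jts_pair sc T) \<Longrightarrow>
      jts_hom.ind_minus sc' T' sc T kp km (jts_hom.ind_minus sc T sc' T' hp hm \<xi>) = \<xi>"
proof -
  interpret H: jts_hom sc T sc' T' hp hm by fact
  interpret K: jts_hom sc' T' sc T kp km by fact
  have "K.ind_plus (H.ind_plus (g <#\<^bsub>H.S.\<A>\<^esub> o_plus H.S.J)) = g <#\<^bsub>H.S.\<A>\<^esub> o_plus H.S.J \<and>
      K.ind_minus (H.ind_minus (g <#\<^bsub>H.S.\<A>\<^esub> o_minus H.S.J)) = g <#\<^bsub>H.S.\<A>\<^esub> o_minus H.S.J"
    if "g \<in> H.S.G" for g
  proof -
    obtain g' where g': "(g, g') \<in> H.words" using H.words_total[OF \<open>g \<in> H.S.G\<close>] by blast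
    moreover have "(g', g) \<in> K.words" by (rule words_converse[OF assms g'])
    ultimately show ?thesis by (simp add: H.ind_o K.ind_o)
  qed
  thus "\<xi> \<in> X_plus H.S.J \<Longrightarrow> K.ind_plus (H.ind_plus \<xi>) = \<xi>"
    "\<xi> \<in> X_minus H.S.J \<Longrightarrow> K.ind_minus (H.ind_minus \<xi>) = \<xi>"
    by (auto simp: H.S.X_plus_iff H.S.X_minus_iff)
qed

section \<open>Homotopes\<close>

lemma ind_bij:
  assumes H: "jts_hom sc T sc' T' hp hm" and K: "jts_hom sc' T' sc T kp km"
    and inv: "\<And>x. kp (hp x) = x" "\<And>y. km (hm y) = y" "\<And>x. hp (kp x) = x" "\<And>y. hm (km y) = y"
  shows "bij_betw (jts_hom.ind_plus sc T sc' T' hp hm) (X_plus (jts_pair sc T)) (X_plus (jts_pair sc' T'))"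
    and "bij_betw (jts_hom.ind_minus sc T sc' T' hp hm) (X_minus (jts_pair sc T)) (X_minus (jts_pair sc' T'))"
    and "\<xi> \<in> X_plus (jts_pair sc' T') \<Longrightarrow>
      inv_into (X_plus (jts_pair sc T)) (jts_hom.ind_plus sc T sc' T' hp hm) \<xi> =
      jts_hom.ind_plus sc' T' sc T kp km \<xi>"
    and "\<xi> \<in> X_minus (jts_pair sc' T') \<Longrightarrow>
      inv_into (X_minus (jts_pair sc T)) (jts_hom.ind_minus sc T sc' T' hp hm) \<xi> =
      jts_hom.ind_minus sc' T' sc T kp km \<xi>"
proof -
  interpret H: jts_hom sc T sc' T' hp hm by fact
  interpret K: jts_hom sc' T' sc T kp km by fact
  have im: "H.ind_plus ` X_plus H.S.J \<subseteq> X_plus H.R.J" "H.ind_minus ` X_minus H.S.J \<subseteq> X_minus H.R.J"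
    "K.ind_plus ` X_plus H.R.J \<subseteq> X_plus H.S.J" "K.ind_minus ` X_minus H.R.J \<subseteq> X_minus H.S.J"
    using H.geom_hom K.geom_hom by (simp_all add: geom_hom_def geometry_def)
  note HK = ind_inverse[OF H K inv(1,2)] and KH = ind_inverse[OF K H inv(3,4)]
  show b: "bij_betw H.ind_plus (X_plus H.S.J) (X_plus H.R.J)"
    by (rule bij_betw_byWitness[where f' = K.ind_plus]) (use im HK KH in simp_all)
  show b': "bij_betw H.ind_minus (X_minus H.S.J) (X_minus H.R.J)"
    by (rule bij_betw_byWitness[where f' = K.ind_minus]) (use im HK KH in simp_all)
  show "inv_into (X_plus H.S.J) H.ind_plus \<xi> = K.ind_plus \<xi>" if "\<xi> \<in> X_plus H.R.J"
    using b im(3) KH(1)[OF that] that by (intro inv_into_f_eq) (auto simp: bij_betw_def)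
  show "inv_into (X_minus H.S.J) H.ind_minus \<xi> = K.ind_minus \<xi>" if "\<xi> \<in> X_minus H.R.J"
    using b' im(4) KH(2)[OF that] that by (intro inv_into_f_eq) (auto simp: bij_betw_def)
qed

lemma (in jts_sixth) affine_points:
  "g \<in> G \<Longrightarrow> g \<cdot> affine_plus J u \<in> X_plus J" "g \<in> G \<Longrightarrow> g \<cdot> affine_minus J u \<in> X_minus J"
  "affine_plus J u \<in> X_plus J"
  by (auto simp: affine_plus_def affine_minus_def X_plus_iff X_minus_iff)

lemma ind_geom_iso:
  assumes H: "jts_hom sc T sc' T' hp hm" and K: "jts_hom sc' T' sc T kp km"
    and inv: "\<And>x. kp (hp x) = x" "\<And>y. km (hm y) = y" "\<And>x. hp (kp x) = x" "\<And>y. hm (km y) = y"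
  shows "geom_iso (geometry (jts_pair sc T)) (geometry (jts_pair sc' T'))
    (jts_hom.ind_plus sc T sc' T' hp hm) (jts_hom.ind_minus sc T sc' T' hp hm)"
proof -
  interpret H: jts_hom sc T sc' T' hp hm by fact
  interpret K: jts_hom sc' T' sc T kp km by fact
  note bij = ind_bij[OF H K inv]
  have "geom_hom (geometry H.R.J) (geometry H.S.J) (inv_into (X_plus H.S.J) H.ind_plus)
      (inv_into (X_minus H.S.J) H.ind_minus)"
  proof (rule chart_geometry.geom_homI[OF H.R.chart H.S.chart K.hp_hom K.hm_hom])
    fix g assume g: "g \<in> H.R.G"
    then obtain g' where g': "(g, g') \<in> K.words" using K.words_total by blast
    thus "\<exists>g'\<in>H.S.G.
        (\<forall>u. inv_into (X_plus H.S.J) H.ind_plus (g <#\<^bsub>H.R.\<A>\<^esub> affine_plus H.R.J u) =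
          g' <#\<^bsub>H.S.\<A>\<^esub> affine_plus H.S.J (kp u)) \<and>
        (\<forall>u. inv_into (X_minus H.S.J) H.ind_minus (g <#\<^bsub>H.R.\<A>\<^esub> affine_minus H.R.J u) =
          g' <#\<^bsub>H.S.\<A>\<^esub> affine_minus H.S.J (km u))"
      using K.ind_affine[OF g'] g by (intro bexI[of _ g']) (simp_all add: bij H.R.affine_points)
  qed
  thus ?thesis using bij(1,2) H.geom_hom by (simp add: geom_iso_def geometry_def)
qed

section \<open>The embedding defined by a structural transformation\<close>

locale jts_structural = jts_sixth sc T
  for sc :: "'k::comm_ring_1 \<Rightarrow> 'v::ab_group_add \<Rightarrow> 'v" and T :: "'v \<Rightarrow> 'v \<Rightarrow> 'v \<Rightarrow> 'v" +
  fixes \<alpha> :: "'v \<Rightarrow> 'v"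
  assumes structural: "structural sc T \<alpha>"
begin

abbreviation T\<^sub>\<alpha> where "T\<^sub>\<alpha> \<equiv> homotope T \<alpha>"
abbreviation J\<^sub>\<alpha> where "J\<^sub>\<alpha> \<equiv> jts_pair sc T\<^sub>\<alpha>"

lemma \<alpha>_hom: "module_hom sc sc \<alpha>" and \<alpha>_T: "T (\<alpha> x) y (\<alpha> z) = \<alpha> (T x (\<alpha> y) z)"
  using structural by (auto simp: structural_def)

lemmas \<alpha>_linear = module_hom.add[OF \<alpha>_hom] module_hom.neg[OF \<alpha>_hom] module_hom.scale[OF \<alpha>_hom]

text \<open>This is the Jordan identity of \<open>T\<close> at \<open>u\<close>,
  \<open>\<alpha> v\<close>, \<open>x\<close>, \<open>\<alpha> y\<close>, \<open>z\<close>: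
  structurality rewrites its inner term \<open>T (\<alpha> v) u (\<alpha> y)\<close> as \<alpha> of
  a homotope product.\<close>

lemma homotope: "jts_sixth sc T\<^sub>\<alpha>"
proof unfold_locales
  show "T\<^sub>\<alpha> x y z = T\<^sub>\<alpha> z y x" for x y z using symmetric by (simp add: homotope_def)
  show "T\<^sub>\<alpha> u v (T\<^sub>\<alpha> x y z) = T\<^sub>\<alpha> (T\<^sub>\<alpha> u v x) y z - T\<^sub>\<alpha> x (T\<^sub>\<alpha> v u y) z + T\<^sub>\<alpha> x y (T\<^sub>\<alpha> u v z)"
    for u v x y z
    using jordan_identity[of u "\<alpha> v" x "\<alpha> y" z] by (simp add: homotope_def \<alpha>_T)
qed (use two_unit three_unit in \<open>auto simp: homotope_def T_add T_scale \<alpha>_linear\<close>)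

lemma embedding: "jts_hom sc T\<^sub>\<alpha> sc T (\<lambda>x. x) \<alpha>"
proof -
  have "module_hom sc sc (\<lambda>x. x)" by (intro module_homI) auto
  thus ?thesis
    using \<alpha>_hom
    by (intro jts_hom.intro homotope jts_sixth_axioms jts_hom_axioms.intro)
      (simp add: jordan_pair_hom_def jts_pair_def homotope_def \<alpha>_T)
qed

sublocale H: jts_sixth sc T\<^sub>\<alpha> by (rule homotope)

abbreviation \<Phi> where "\<Phi> \<equiv> jts_hom.ind_plus sc T\<^sub>\<alpha> sc T (\<lambda>x. x) \<alpha>"
abbreviation \<Phi>' where "\<Phi>' \<equiv> jts_hom.ind_minus sc T\<^sub>\<alpha> sc T (\<lambda>x. x) \<alpha>"
abbreviation M\<^sub>\<alpha> where "M\<^sub>\<alpha> \<equiv> sym_space (geometry J\<^sub>\<alpha>) (polar_map J\<^sub>\<alpha>)"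

text \<open>The quadratic operator of the homotope is Q(x) composed with \<alpha>, and structurality
  gives \<alpha> Q(x) \<alpha> = Q(\<alpha> x).\<close>

lemma bergman_homotope: "bergman sc T\<^sub>\<alpha> x (- x) = bergman sc T x (- \<alpha> x)"
  by (simp add: fun_eq_iff bergman_def quad_op_def homotope_def \<alpha>_linear \<alpha>_T T_scale)

lemma M_iff: "\<xi> \<in> M\<^sub>\<alpha> \<longleftrightarrow> \<xi> \<in> X_plus J\<^sub>\<alpha> \<and> transversal J\<^sub>\<alpha> \<xi> (polar_map J\<^sub>\<alpha> \<xi>)"
  by (simp add: sym_space_def geometry_def)

lemma affine_M_iff: "affine_plus J\<^sub>\<alpha> x \<in> M\<^sub>\<alpha> \<longleftrightarrow> bergman sc T x (- \<alpha> x) \<in> GL sc"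
  by (simp add: M_iff H.affine_points H.transversal_affine_iff bergman_homotope bergman_GL_iff)

text \<open>A point of the image with affine coordinate \<open>x\<close> is also the image of the
  affine point \<open>x\<close> upstairs. Injectivity identifies the two preimages, after which the
  Bergman criterion applies.\<close>

lemma image_chart:
  "\<Phi> ` M\<^sub>\<alpha> \<inter> range (affine_plus J) = affine_plus J ` {x. bergman sc T x (- \<alpha> x) \<in> GL sc}"
proof -
  interpret F: jts_hom sc T\<^sub>\<alpha> sc T "\<lambda>x. x" \<alpha> by (rule embedding)
  have inj: "inj_on \<Phi> (X_plus J\<^sub>\<alpha>)" by (rule F.ind_plus_inj) simp
  show ?thesis
  proof (intro equalityI subsetI)
    fix \<eta> assume "\<eta> \<in> \<Phi> ` M\<^sub>\<alpha> \<inter> range (affine_plus J)"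
    then obtain \<xi> x where \<xi>: "\<xi> \<in> M\<^sub>\<alpha>" "\<eta> = \<Phi> \<xi>" "\<eta> = affine_plus J x" by blast
    hence "\<Phi> \<xi> = \<Phi> (affine_plus J\<^sub>\<alpha> x)" by (simp add: F.ind_affine_base)
    moreover have "\<xi> \<in> X_plus J\<^sub>\<alpha>" using \<xi>(1) M_iff by blast
    ultimately have "\<xi> = affine_plus J\<^sub>\<alpha> x" using H.affine_points(3) by (rule inj_onD[OF inj])
    hence "bergman sc T x (- \<alpha> x) \<in> GL sc" using \<xi>(1) affine_M_iff by simp
    thus "\<eta> \<in> affine_plus J ` {x. bergman sc T x (- \<alpha> x) \<in> GL sc}" using \<xi>(3) by blast
  next
    fix \<eta> assume "\<eta> \<in> affine_plus J ` {x. bergman sc T x (- \<alpha> x) \<in> GL sc}"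
    then obtain x where x: "\<eta> = affine_plus J x" "affine_plus J\<^sub>\<alpha> x \<in> M\<^sub>\<alpha>"
      using affine_M_iff by blast
    hence "\<eta> = \<Phi> (affine_plus J\<^sub>\<alpha> x)" by (simp add: F.ind_affine_base)
    thus "\<eta> \<in> \<Phi> ` M\<^sub>\<alpha> \<inter> range (affine_plus J)" using x by blast
  qed
qed

section \<open>Invertible structural transformations\<close>

context
  assumes bij: "bij \<alpha>"
begin

abbreviation \<beta> where "\<beta> \<equiv> inv_into UNIV \<alpha>"

lemma \<alpha>_\<beta> [simp]: "\<alpha> (\<beta> x) = x" "\<beta> (\<alpha> x) = x"
  using bij by (simp_all add: bij_def surj_f_inv_f)

lemma \<beta>_hom: "module_hom sc sc \<beta>"
  by (intro module_homI) (metis \<alpha>_\<beta> \<alpha>_linear(1), metis \<alpha>_\<beta> \<alpha>_linear(3))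

lemma \<beta>_T: "\<beta> (T x y z) = T (\<beta> x) (\<alpha> y) (\<beta> z)"
  by (metis \<alpha>_\<beta> \<alpha>_T)

lemma automorphism: "jts_hom sc T sc T \<alpha> \<beta>"
  using \<alpha>_hom \<beta>_hom
  by (intro jts_hom.intro jts_sixth_axioms jts_hom_axioms.intro)
    (simp add: jordan_pair_hom_def jts_pair_def \<alpha>_T \<beta>_T)

lemma embedding_inverse: "jts_hom sc T sc T\<^sub>\<alpha> (\<lambda>x. x) \<beta>"
proof -
  have "module_hom sc sc (\<lambda>x. x)" by (intro module_homI) auto
  thus ?thesis
    using \<beta>_hom
    by (intro jts_hom.intro homotope jts_sixth_axioms jts_hom_axioms.intro)
      (simp add: jordan_pair_hom_def jts_pair_def homotope_def \<beta>_T)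
qed

interpretation F: jts_hom sc T\<^sub>\<alpha> sc T "\<lambda>x. x" \<alpha> by (rule embedding)
interpretation K: jts_hom sc T sc T\<^sub>\<alpha> "\<lambda>x. x" \<beta> by (rule embedding_inverse)
interpretation A: jts_hom sc T sc T \<alpha> \<beta> by (rule automorphism)
interpretation B: jts_hom sc T sc T \<beta> \<alpha> by (rule A.swap)

text \<open>The homomorphism (id, \<alpha>) followed by the automorphism (\<alpha>, \<beta>) is
  (\<alpha>, id), the swap of (id, \<alpha>). On words this says that the embedding intertwines the
  polarity of the homotope with that of \<open>T\<close> composed with \<alpha>.\<close>

lemma polar_words:
  "(g, g') \<in> F.words \<Longrightarrow> \<exists>g''. (g', g'') \<in> A.words \<and> (H.tw g, tw g'') \<in> F.words"
proof (induction rule: F.words.induct)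
  case one
  show ?case using A.words.one F.words.one by force
next
  case (plus g g' v)
  then obtain g'' where "(g', g'') \<in> A.words" "(H.tw g, tw g'') \<in> F.words" by blast
  thus ?case
    using A.words.plus[of g' g'' v] F.words.minus[of "H.tw g" "tw g''" "- v"] plus.hyps
    by (intro exI[of _ "exp_plus J (\<alpha> v) \<otimes>\<^bsub>\<A>\<^esub> g''"]) (simp add: H.tw_mult tw_mult \<alpha>_linear)
next
  case (minus g g' v)
  then obtain g'' where "(g', g'') \<in> A.words" "(H.tw g, tw g'') \<in> F.words" by blast
  thus ?case
    using A.words.minus[of g' g'' "\<alpha> v"] F.words.plus[of "H.tw g" "tw g''" "- v"] minus.hyps
    by (intro exI[of _ "exp_minus J v \<otimes>\<^bsub>\<A>\<^esub> g''"]) (simp add: H.tw_mult tw_mult)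
qed

lemma polar_embedding:
  assumes "\<xi> \<in> X_plus J\<^sub>\<alpha>"
  shows "\<Phi>' (polar_map J\<^sub>\<alpha> \<xi>) = polar_map J (A.ind_plus (\<Phi> \<xi>))"
proof -
  obtain g where g: "g \<in> H.G" "\<xi> = H.act g (o_plus J\<^sub>\<alpha>)" using assms by (auto simp: H.X_plus_iff)
  obtain g' where g': "(g, g') \<in> F.words" using F.words_total g by blast
  then obtain g'' where "(g', g'') \<in> A.words" "(H.tw g, tw g'') \<in> F.words" using polar_words by blast
  thus ?thesis
    using g g' by (simp add: H.polar_map_act polar_map_act F.ind_o A.ind_o)
qed

text \<open>Related words \<open>g\<close> and \<open>g'\<close> carry the base pairs to the point
  with its polar in both geometries, the form needed for the image and for the product.\<close>

lemma transversal_embedding: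
  assumes "\<xi> \<in> M\<^sub>\<alpha>"
  shows "\<exists>g g'. (g, g') \<in> F.words \<and> \<xi> = H.act g (o_plus J\<^sub>\<alpha>) \<and> polar_map J\<^sub>\<alpha> \<xi> = H.act g (o_minus J\<^sub>\<alpha>) \<and>
    \<Phi> \<xi> = g' \<cdot> o_plus J \<and> polar_map J (A.ind_plus (\<Phi> \<xi>)) = g' \<cdot> o_minus J"
proof -
  obtain g where g: "g \<in> H.G" "\<xi> = H.act g (o_plus J\<^sub>\<alpha>)" "polar_map J\<^sub>\<alpha> \<xi> = H.act g (o_minus J\<^sub>\<alpha>)"
    using assms by (auto simp: M_iff transversal_def)
  obtain g' where g': "(g, g') \<in> F.words" using F.words_total g by blast
  have "polar_map J (A.ind_plus (\<Phi> \<xi>)) = \<Phi>' (H.act g (o_minus J\<^sub>\<alpha>))"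
    using polar_embedding[of \<xi>] assms g(3) by (simp add: M_iff)
  also have "\<dots> = g' \<cdot> o_minus J" using g' by (simp add: F.ind_o)
  finally show ?thesis using g g' F.ind_o(1)[OF g'] by blast
qed

text \<open>For the converse inclusion, the element \<open>g'\<close> realizing transversality is
  lifted along the inverse homomorphism (id, \<beta>); injectivity of \<open>\<Phi>'\<close> then
  identifies the polar point upstairs.\<close>

lemma image_sym_space: "\<Phi> ` M\<^sub>\<alpha> = sym_space (geometry J) (polar_map J \<circ> A.ind_plus)"
proof (intro equalityI subsetI)
  fix \<eta> assume "\<eta> \<in> \<Phi> ` M\<^sub>\<alpha>"
  then obtain \<xi> where \<xi>: "\<xi> \<in> M\<^sub>\<alpha>" "\<eta> = \<Phi> \<xi>" by blast
  obtain g g' where "(g, g') \<in> F.words" "\<eta> = g' \<cdot> o_plus J"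
    "polar_map J (A.ind_plus \<eta>) = g' \<cdot> o_minus J"
    using transversal_embedding[OF \<xi>(1)] \<xi>(2) by blast
  moreover from this have "g' \<in> G" by simp
  ultimately show "\<eta> \<in> sym_space (geometry J) (polar_map J \<circ> A.ind_plus)"
    by (auto simp: sym_space_def geometry_def X_plus_iff transversal_def)
next
  fix \<eta> assume "\<eta> \<in> sym_space (geometry J) (polar_map J \<circ> A.ind_plus)"
  then obtain g' where g': "g' \<in> G" "\<eta> = g' \<cdot> o_plus J" "polar_map J (A.ind_plus \<eta>) = g' \<cdot> o_minus J"
    by (auto simp: sym_space_def geometry_def transversal_def)
  obtain g where "(g', g) \<in> K.words" using K.words_total g' by blast
  hence g: "(g, g') \<in> F.words" by (rule words_converse[OF embedding_inverse embedding, rotated 2]) simp_all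
  define \<xi> where "\<xi> = H.act g (o_plus J\<^sub>\<alpha>)"
  have \<xi>: "\<xi> \<in> X_plus J\<^sub>\<alpha>" "\<Phi> \<xi> = \<eta>"
    using g F.words_G(1)[OF g] g' by (auto simp: \<xi>_def H.X_plus_iff F.ind_o)
  have m: "polar_map J\<^sub>\<alpha> \<xi> \<in> X_minus J\<^sub>\<alpha>" "H.act g (o_minus J\<^sub>\<alpha>) \<in> X_minus J\<^sub>\<alpha>"
    using F.words_G(1)[OF g] by (auto simp: \<xi>_def H.polar_map_act H.X_minus_iff)
  have "\<Phi>' (polar_map J\<^sub>\<alpha> \<xi>) = \<Phi>' (H.act g (o_minus J\<^sub>\<alpha>))"
    using polar_embedding[OF \<xi>(1)] \<xi>(2) g'(3) by (simp add: F.ind_o(2)[OF g])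
  moreover have "K.ind_minus (\<Phi>' \<zeta>) = \<zeta>" if "\<zeta> \<in> X_minus J\<^sub>\<alpha>" for \<zeta>
    by (rule ind_inverse(2)[OF embedding embedding_inverse _ _ that]) simp_all
  ultimately have "polar_map J\<^sub>\<alpha> \<xi> = H.act g (o_minus J\<^sub>\<alpha>)" using m by metis
  hence "\<xi> \<in> M\<^sub>\<alpha>" using \<xi> F.words_G(1)[OF g] by (auto simp: M_iff transversal_def \<xi>_def)
  thus "\<eta> \<in> \<Phi> ` M\<^sub>\<alpha>" using \<xi>(2) by blast
qed

lemma embedding_sym_prod:
  assumes "x \<in> M\<^sub>\<alpha>" "y \<in> M\<^sub>\<alpha>"
  shows "\<Phi> (sym_prod J\<^sub>\<alpha> (polar_map J\<^sub>\<alpha>) x y) = sym_prod J (polar_map J \<circ> A.ind_plus) (\<Phi> x) (\<Phi> y)"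
proof -
  obtain g g' where g: "(g, g') \<in> F.words" "x = H.act g (o_plus J\<^sub>\<alpha>)"
      "polar_map J\<^sub>\<alpha> x = H.act g (o_minus J\<^sub>\<alpha>)"
      "\<Phi> x = g' \<cdot> o_plus J" "polar_map J (A.ind_plus (\<Phi> x)) = g' \<cdot> o_minus J"
    using transversal_embedding[OF assms(1)] by blast
  have "y \<in> X_plus J\<^sub>\<alpha>" using assms(2) by (simp add: M_iff)
  from F.ind_dilation[OF g(1) this] show ?thesis
    unfolding sym_prod_def comp_def g(5) unfolding g(3,4) using g(2) by simp
qed

lemma polarity: "polarity (geometry J) (polar_map J \<circ> A.ind_plus)"
proof -
  let ?X = "X_plus J" and ?Y = "X_minus J"
  let ?p = "polar_map J \<circ> A.ind_plus"
  \<comment> \<open>The inverse of \<open>?p\<close>: the polar map is an involution, and the swap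
    (\<beta>, \<alpha>) induces the inverse of \<open>A.ind_plus\<close>.\<close>
  let ?q = "\<lambda>\<eta>. B.ind_plus (polar_map J \<eta>)"
  \<comment> \<open>One element \<open>tw g'\<close> serves both maps, because
    \<open>A.words_tw\<close> relates the twists of \<open>g\<close> and \<open>g'\<close> by
    (\<beta>, \<alpha>). This is the chart criterion for a homomorphism to the dual
    geometry.\<close>
  have charts: "\<exists>g'\<in>G. (\<forall>u. ?p (g \<cdot> affine_plus J u) = g' \<cdot> affine_minus J (\<alpha> u)) \<and>
      (\<forall>u. ?q (g \<cdot> affine_minus J u) = g' \<cdot> affine_plus J (\<beta> u))" if "g \<in> G" for g
  proof -
    obtain g' where g': "(g, g') \<in> A.words" using A.words_total \<open>g \<in> G\<close> by blast
    hence "g' \<in> G" by simp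
    thus ?thesis
      using A.ind_affine(1)[OF g'] B.ind_affine(1)[OF A.words_tw[OF g']] \<open>g \<in> G\<close>
      by (intro bexI[of _ "tw g'"]) (simp_all add: polar_map_act)
  qed
  have polar: "polar_map J \<xi> \<in> ?Y" if "\<xi> \<in> ?X" for \<xi>
    using that by (auto simp: X_plus_iff X_minus_iff polar_map_act)
  have polar': "polar_map J \<xi> \<in> ?X" if "\<xi> \<in> ?Y" for \<xi>
    using that by (auto simp: X_plus_iff X_minus_iff polar_map_act)
  have im: "A.ind_plus ` ?X \<subseteq> ?X" "B.ind_plus ` ?X \<subseteq> ?X"
    using A.geom_hom B.geom_hom by (simp_all add: geom_hom_def geometry_def)
  have qp: "?q (?p \<xi>) = \<xi>" if "\<xi> \<in> ?X" for \<xi>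
  proof -
    have "A.ind_plus \<xi> \<subseteq> carrier \<A>" using im(1) that points_carrier(1) by blast
    moreover have "B.ind_plus (A.ind_plus \<xi>) = \<xi>"
      by (rule ind_inverse(1)[OF automorphism A.swap _ _ that]) simp_all
    ultimately show ?thesis by (simp add: polar_map_involution)
  qed
  have pq: "?p (?q \<xi>) = \<xi>" if "\<xi> \<in> ?Y" for \<xi>
  proof -
    have "A.ind_plus (B.ind_plus (polar_map J \<xi>)) = polar_map J \<xi>"
      by (rule ind_inverse(1)[OF A.swap automorphism _ _ polar'[OF that]]) simp_all
    thus ?thesis using points_carrier(2)[OF that] by (simp add: polar_map_involution)
  qed
  have bp: "bij_betw ?p ?X ?Y"
    using im polar polar' qp pq by (intro bij_betw_byWitness[where f' = ?q]) auto
  have inv_p: "inv_into ?X ?p \<eta> = ?q \<eta>" if "\<eta> \<in> ?Y" for \<eta>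
    using bp polar'[OF that] im(2) pq[OF that] by (intro inv_into_f_eq) (auto simp: bij_betw_def)
  have bq: "bij_betw (inv_into ?X ?p) ?Y ?X" using bp by (rule bij_betw_inv_into)
  have inv_q: "inv_into ?Y (inv_into ?X ?p) \<xi> = ?p \<xi>" if "\<xi> \<in> ?X" for \<xi>
  proof (rule inv_into_f_eq)
    show "inj_on (inv_into ?X ?p) ?Y" using bq by (simp add: bij_betw_def)
    show "?p \<xi> \<in> ?Y" using bp that by (auto simp: bij_betw_def)
    thus "inv_into ?X ?p (?p \<xi>) = \<xi>" using qp[OF that] inv_p by simp
  qed
  have hom: "geom_hom (geometry J) (dual_geom (geometry J)) ?p (inv_into ?X ?p)"
    by (rule chart_geometry.geom_homI[OF chart chart_geometry.dual[OF chart] \<alpha>_hom \<beta>_hom])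
      (use charts in \<open>simp add: inv_p affine_points\<close>)
  have hom': "geom_hom (dual_geom (geometry J)) (geometry J) (inv_into ?X ?p)
      (inv_into ?Y (inv_into ?X ?p))"
  proof (rule chart_geometry.geom_homI[OF chart_geometry.dual[OF chart] chart \<beta>_hom \<alpha>_hom])
    fix g assume g: "g \<in> G"
    from charts[OF g] obtain g' where g': "g' \<in> G"
      and p: "\<forall>u. ?p (g \<cdot> affine_plus J u) = g' \<cdot> affine_minus J (\<alpha> u)"
      and q: "\<forall>u. ?q (g \<cdot> affine_minus J u) = g' \<cdot> affine_plus J (\<beta> u)"
      by (elim bexE conjE)
    show "\<exists>g'\<in>G. (\<forall>u. inv_into ?X ?p (g \<cdot> affine_minus J u) = g' \<cdot> affine_plus J (\<beta> u)) \<and>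
        (\<forall>u. inv_into ?Y (inv_into ?X ?p) (g \<cdot> affine_plus J u) = g' \<cdot> affine_minus J (\<alpha> u))"
      using p q by (intro bexI[OF _ g']) (simp only: inv_p inv_q affine_points(1,2)[OF g] simp_thms)
  qed
  have base: "o_plus J \<in> ?X" using affine_points(3)[of 0] by (simp add: affine_zero)
  have "transversal J (o_plus J) (o_minus J)"
    unfolding transversal_def by (rule bexI[of _ "\<one>\<^bsub>\<A>\<^esub>"]) simp_all
  hence transv: "transversal J (o_plus J) (?p (o_plus J))" by (simp add: A.ind_base)
  have sel: "pts_plus (geometry J) = ?X" "pts_minus (geometry J) = ?Y"
    "pts_plus (dual_geom (geometry J)) = ?Y" "pts_minus (dual_geom (geometry J)) = ?X"
    "transv (geometry J) = transversal J"
    by (simp_all add: geometry_def dual_geom_def)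
  show ?thesis
    unfolding polarity_def geom_iso_def sel
    by (intro conjI bexI[of _ "o_plus J"] bp bq hom hom' transv base)
qed

lemma automorphism_embedding:
  "\<exists>A A'. induced_hom J J \<alpha> (inv_into UNIV \<alpha>) A A' \<and> geom_iso (geometry J) (geometry J) A A' \<and>
    polarity (geometry J) (polar_map J \<circ> A) \<and>
    \<Phi> ` M\<^sub>\<alpha> = sym_space (geometry J) (polar_map J \<circ> A) \<and>
    (\<forall>x\<in>M\<^sub>\<alpha>. \<forall>y\<in>M\<^sub>\<alpha>. \<Phi> (sym_prod J\<^sub>\<alpha> (polar_map J\<^sub>\<alpha>) x y) =
      sym_prod J (polar_map J \<circ> A) (\<Phi> x) (\<Phi> y))"
proof -
  have "geom_iso (geometry J) (geometry J) A.ind_plus A.ind_minus"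
    using automorphism A.swap by (rule ind_geom_iso) simp_all
  thus ?thesis using A.induced polarity image_sym_space embedding_sym_prod by blast
qed

end

end

theorem theorem4p3:
  fixes sc :: "'k::comm_ring_1 \<Rightarrow> 'v::ab_group_add \<Rightarrow> 'v"
    and T :: "'v \<Rightarrow> 'v \<Rightarrow> 'v \<Rightarrow> 'v"
    and \<alpha> :: "'v \<Rightarrow> 'v"
  assumes "(2::'k) dvd 1" and "(3::'k) dvd 1"
    and "jordan_triple_system sc T"
    and "structural sc T \<alpha>"
  shows "let J = jts_pair sc T; J\<^sub>\<alpha> = jts_pair sc (homotope T \<alpha>);
             p = polar_map J; p\<^sub>\<alpha> = polar_map J\<^sub>\<alpha>;
             M\<^sub>\<alpha> = sym_space (geometry J\<^sub>\<alpha>) p\<^sub>\<alpha>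
    in \<exists>\<Phi> \<Phi>'.
      induced_hom J\<^sub>\<alpha> J (\<lambda>x. x) \<alpha> \<Phi> \<Phi>' \<and> inj_on \<Phi> (X_plus J\<^sub>\<alpha>) \<and>
      \<Phi> ` M\<^sub>\<alpha> \<inter> range (affine_plus J) =
        affine_plus J ` {x. bergman sc T x (- \<alpha> x) \<in> GL sc} \<and>
      has_tangent_map_at_origin J\<^sub>\<alpha> J \<Phi> (\<lambda>x. x) \<and>
      (bij \<alpha> \<longrightarrow>
        (\<exists>A A'. induced_hom J J \<alpha> (inv_into UNIV \<alpha>) A A' \<and>
          geom_iso (geometry J) (geometry J) A A' \<and>
          polarity (geometry J) (p \<circ> A) \<and>
          \<Phi> ` M\<^sub>\<alpha> = sym_space (geometry J) (p \<circ> A) \<and>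
          (\<forall>x\<in>M\<^sub>\<alpha>. \<forall>y\<in>M\<^sub>\<alpha>.
            \<Phi> (sym_prod J\<^sub>\<alpha> p\<^sub>\<alpha> x y) = sym_prod J (p \<circ> A) (\<Phi> x) (\<Phi> y))))"
proof -
  interpret jts_structural sc T \<alpha>
    using assms by (intro jts_structural.intro jts_structural_axioms.intro jts_sixth.intro
        jts_sixth_axioms.intro)
  interpret F: jts_hom sc T\<^sub>\<alpha> sc T "\<lambda>x. x" \<alpha> by (rule embedding)
  have inj: "inj_on \<Phi> (X_plus J\<^sub>\<alpha>)" by (rule F.ind_plus_inj) simp
  have tangent: "has_tangent_map_at_origin J\<^sub>\<alpha> J \<Phi> (\<lambda>x. x)"
    using F.ind_base F.ind_affine_base F.hp_hom by (simp add: has_tangent_map_at_origin_def)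
  show ?thesis
    unfolding Let_def
    by (rule exI[of _ \<Phi>], rule exI[of _ \<Phi>'])
      (intro conjI impI F.induced inj image_chart tangent automorphism_embedding)
qed

end
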